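(* Let $k\ge3$. Then $$\frac{V_L^+(1)+C_2(V_L^+)}{C_2(V_L^+)}=\mathrm{span}\{L(-2)^iE+C_2(V_L^+): i=0,1,2\},$$ and $$\frac{M(1)^++C_2(V_L^+)}{C_2(V_L^+)}=\mathrm{span}\{L(-2)^m\mathbf1+C_2(V_L^+)\ (0\le m\le 2k+2),\ J+C_2(V_L^+),\ J_{-1}J+C_2(V_L^+),\ L(-2)J+C_2(V_L^+)\}.$$ In particular $L(-2)^3E\in C_2(V_L^+)$ and $L(-2)^{2k+3}\mathbf1\in C_2(V_L^+)$.
   Context: $L=\mathbb{Z}\alpha$, $\langle\alpha,\alpha\rangle=2k$; $V_L=M(1)\otimes\mathbb{C}[L]$ the lattice VOA with conformal vector $\omega=\frac1{4k}\alpha(-1)^2\mathbf1$, $L(n)=\omega_{n+1}$; $V_L^+$ the fixed points of the involution $\theta$ ($\alpha(-n_1)\cdots\alpha(-n_r)\otimes e^{\beta}\mapsto(-1)^r\alpha(-n_1)\cdots\alpha(-n_r)\otimes e^{-\beta}$), $M(1)^\pm$ its $\pm1$-eigenspaces on $M(1)$; $E=e^{\alpha}+e^{-\alpha}$, $F=e^\alpha-e^{-\alpha}$, $V_L^+(1)=M(1)^+\otimes E\oplus M(1)^-\otimes F$. $J=\frac{1}{4k^2}\alpha(-1)^4\mathbf1-\frac1k\alpha(-3)\alpha(-1)\mathbf1+\frac{3}{4k}\alpha(-2)^2\mathbf1$, $J_{-1}$ its $(-1)$-mode; $L(-2)^m$ is an operator power. $C_2(V)$ is the span of $\{v_{-2}u:u,v\in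 V\}$. *)

theory Defs
  imports Complex_Main "HOL-Library.Poly_Mapping" "HOL-Library.Groups_Big_Fun" "HOL-Library.Multiset"
begin

section \<open>The rank-one lattice VOA V_L, L = Z alpha, <alpha,alpha> = 2k\<close>

text \<open>Basis of V_L = M(1) (x) C[L]: a pair (a, m) with a a multiset of positive integers
  (a = {#n_1,...,n_r#} stands for alpha(-n_1)...alpha(-n_r)) and m an integer
  (standing for e^{m alpha}).  Vectors are finitely supported complex combinations.\<close>

type_synonym vb = "nat multiset \<times> int"
type_synonym vec = "vb \<Rightarrow>\<^sub>0 complex"

definition smul :: "complex \<Rightarrow> vec \<Rightarrow> vec" where
  "smul c v = Poly_Mapping.map (\<lambda>x. c * x) v"

definition bvec :: "vb \<Rightarrow> vec" where
  "bvec b = Poly_Mapping.single b 1"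

definition lext :: "(vb \<Rightarrow> vec) \<Rightarrow> vec \<Rightarrow> vec" where
  "lext f v = (\<Sum>b\<in>Poly_Mapping.keys v. smul (Poly_Mapping.lookup v b) (f b))"

definition cspan :: "vec set \<Rightarrow> vec set" where
  "cspan S = {(\<Sum>x\<in>F. smul (c x) x) | F c. finite F \<and> F \<subseteq> S}"

definition setsum :: "vec set \<Rightarrow> vec set \<Rightarrow> vec set" where
  "setsum A B = {x + y | x y. x \<in> A \<and> y \<in> B}"

definition VL :: "vec set" where
  "VL = {v. \<forall>b\<in>Poly_Mapping.keys v. 0 \<notin># fst b}"

text \<open>Heisenberg operators alpha(j): alpha(-n) (n>0) creates, alpha(0) acts on e^{m alpha}
  by <alpha, m alpha> = 2km, alpha(n) (n>0) acts as 2k n d/dx_n.\<close>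
definition heis_b :: "nat \<Rightarrow> int \<Rightarrow> vb \<Rightarrow> vec" where
  "heis_b k j b = (case b of (a, m) \<Rightarrow>
     if j < 0 then bvec (add_mset (nat (- j)) a, m)
     else if j = 0 then smul (of_int (2 * int k * m)) (bvec (a, m))
     else smul (of_int (2 * int k * j * int (count a (nat j)))) (bvec (a - {#nat j#}, m)))"

definition heis :: "nat \<Rightarrow> int \<Rightarrow> vec \<Rightarrow> vec" where
  "heis k j = lext (heis_b k j)"

text \<open>Modes of Y(e^{p alpha}, z) = E^-(-p alpha,z) E^+(-p alpha,z) e_{p alpha} z^{p alpha}
  (trivial cocycle, which is admissible since <alpha,alpha> is even).
  E^+ acts as the translation x_n -> x_n - 2kp z^{-n}, E^- multiplies by
  exp(sum_{n>0} p x_n z^n / n).  The mode (e^{p alpha})_q is the coefficient of z^{-q-1}.\<close>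
definition vexp_coeff :: "nat \<Rightarrow> int \<Rightarrow> nat multiset \<Rightarrow> nat multiset \<Rightarrow> nat multiset \<Rightarrow> complex" where
  "vexp_coeff k p a b c =
     (\<Prod>n\<in>set_mset a. of_nat (count a n choose count b n) * (of_int (- 2 * int k * p)) ^ (count b n))
   * (\<Prod>n\<in>set_mset c. (of_int p / of_nat n) ^ (count c n) / of_nat (fact (count c n)))"

definition vexp_b :: "nat \<Rightarrow> int \<Rightarrow> int \<Rightarrow> vb \<Rightarrow> vec" where
  "vexp_b k p q u = (case u of (a, m) \<Rightarrow>
     (\<Sum>bc\<in>{(b, c). b \<subseteq># a \<and> 0 \<notin># c \<and>
              2 * int k * p * m + int (sum_mset c) - int (sum_mset b) = - q - 1}.
        smul (vexp_coeff k p a (fst bc) (snd bc)) (bvec (a - fst bc + snd bc, p + m))))"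

text \<open>Modes of Y(alpha(-n_1)...alpha(-n_r) e^{p alpha}, z), via the normal ordered product
  Y(alpha(-n)v,z) = :(1/(n-1)!) d^{n-1}alpha(z) Y(v,z):, i.e.
  (alpha(-n)v)_q = sum_{j<0} binom(-j-1,n-1) alpha(j) v_{q-j-n}
                 + sum_{j>=0} binom(-j-1,n-1) v_{q-j-n} alpha(j).
  Each sum has only finitely many nonzero terms (Sum_any).\<close>
fun Yl :: "nat \<Rightarrow> nat list \<Rightarrow> int \<Rightarrow> int \<Rightarrow> vec \<Rightarrow> vec" where
  "Yl k [] p q u = lext (vexp_b k p q) u"
| "Yl k (n # ns) p q u = Sum_any (\<lambda>j::int.
      if j < 0 then smul ((of_int (- j - 1) :: complex) gchoose (n - 1)) (heis k j (Yl k ns p (q - j - int n) u))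
      else smul ((of_int (- j - 1) :: complex) gchoose (n - 1)) (Yl k ns p (q - j - int n) (heis k j u)))"

definition mode :: "nat \<Rightarrow> vec \<Rightarrow> int \<Rightarrow> vec \<Rightarrow> vec" where
  "mode k v q u = (\<Sum>b\<in>Poly_Mapping.keys v.
      smul (Poly_Mapping.lookup v b) (Yl k (sorted_list_of_multiset (fst b)) (snd b) q u))"

definition theta :: "vec \<Rightarrow> vec" where
  "theta = lext (\<lambda>(a, m). smul ((- 1) ^ size a) (bvec (a, - m)))"

definition VLplus :: "vec set" where
  "VLplus = {v \<in> VL. theta v = v}"

definition M1 :: "vec set" where
  "M1 = {v \<in> VL. \<forall>b\<in>Poly_Mapping.keys v. snd b = 0}"

definition M1plus :: "vec set" where
  "M1plus = {v \<in> M1. theta v = v}"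

definition M1minus :: "vec set" where
  "M1minus = {v \<in> M1. theta v = - v}"

definition tensor_e :: "vec \<Rightarrow> int \<Rightarrow> vec" where
  "tensor_e f m = lext (\<lambda>(a, _). bvec (a, m)) f"

definition VLplus1 :: "vec set" where
  "VLplus1 = {(tensor_e f 1 + tensor_e f (-1)) + (tensor_e g 1 - tensor_e g (-1)) | f g.
                f \<in> M1plus \<and> g \<in> M1minus}"

definition vac :: vec where
  "vac = bvec ({#}, 0)"

definition Evec :: vec where
  "Evec = bvec ({#}, 1) + bvec ({#}, -1)"

definition omega :: "nat \<Rightarrow> vec" where
  "omega k = smul (1 / (4 * of_nat k)) (bvec ({#1, 1#}, 0))"

definition Lm2 :: "nat \<Rightarrow> vec \<Rightarrow> vec" where
  "Lm2 k v = mode k (omega k) (-1) v"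

definition Jvec :: "nat \<Rightarrow> vec" where
  "Jvec k = smul (1 / (4 * of_nat k ^ 2)) (bvec ({#1, 1, 1, 1#}, 0))
          - smul (1 / of_nat k) (bvec ({#3, 1#}, 0))
          + smul (3 / (4 * of_nat k)) (bvec ({#2, 2#}, 0))"

definition C2 :: "nat \<Rightarrow> vec set" where
  "C2 k = cspan {mode k v (-2) u | u v. u \<in> VLplus \<and> v \<in> VLplus}"

end

theory Submission
  imports Defs "HOL-Library.Product_Plus"
begin

text \<open>
  \<open>V\<^sub>L\<close> is the polynomial ring in \<open>x\<^sub>n = \<alpha>(-n)\<close> tensored with the group algebra of \<open>\<int>\<close>.
  Modulo shorter monomials, the \<open>-2\<close> mode of \<open>x\<^sub>m x\<^sub>n\<close> is multiplication by
  \<open>m x\<^sub>m\<^sub>+\<^sub>1 x\<^sub>n + n x\<^sub>m x\<^sub>n\<^sub>+\<^sub>1\<close>. In charge 0 this reduces every monomial of weight \<open>W\<close> other than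
  \<open>x\<^sub>1\<^bsup>W\<^esup>\<close> to a multiple of \<open>x\<^sub>1 x\<^sub>W\<^sub>-\<^sub>1\<close>. That vector lies in \<open>C\<^sub>2\<close> for odd \<open>W\<close>, and for \<open>W \<ge> 10\<close> because two
  reductions of \<open>x\<^sub>1 x\<^sub>2 x\<^sub>3 x\<^sub>W\<^sub>-\<^sub>6\<close> disagree; weights 4, 6, 8 account for \<open>J\<close>, \<open>L(-2)J\<close>, \<open>J\<^sub>-\<^sub>1J\<close>. In charge 1
  the vectors \<open>v\<^sub>-\<^sub>2 1 = L(-1)v\<close> allow one to eliminate \<open>x\<^sub>1\<close> as well, leaving \<open>x\<^sub>W e\<^sup>\<alpha>\<close>, which lies in
  \<open>C\<^sub>2\<close> unless \<open>W\<close> is 0, 2 or 4. High powers of \<open>x\<^sub>1\<close> come from \<open>E\<^sub>-\<^sub>2 u\<close> and \<open>(L(-1)E)\<^sub>-\<^sub>2 u\<close>, where \<open>u\<close>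
  symmetrizes \<open>S\<^sub>r(-x/2k) e\<^sup>-\<^sup>\<alpha>\<close> (a Schur polynomial): this choice kills the charge 2 part, and
  the coefficients of \<open>x\<^sub>1\<^bsup>W\<^esup>\<close> are consecutive partial sums of a series with nonzero terms, so
  one of them is nonzero.
\<close>

subsection \<open>The ring structure of \<open>V\<^sub>L\<close>\<close>

text \<open>The exceptional weights come out of the eliminations themselves. For even W, combining
  the two reductions of the quartic monomial leaves a multiple of x_1 x_(W-1) that contains the
  factor 240 - 16(W-5)(W-3), zero at W = 8; for W <= 6 there is no index W-6 left for the fourth
  factor. In charge 1 the even weights W >= 4 give, with c = W-3, the factor c(c+2) - 3, zero at W =
  4.

  The Schur parameter is 1/(2k) up to sign because the translation then multiplies the generating
  function by (1-t)^(+1) or (1-t)^(-1). In charge 2 the polynomial 1-t leaves two terms, both with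
  negative Schur index, hence zero. In charge 0 all coefficients of 1/(1-t) are 1, whence the
  partial sums.

  Expanding modes from their defining sums would be unmanageable. Most operator identities are
  instead derived from the commutator with multiplication by x_n and from the values on e^(m
  alpha).\<close>

definition cst :: "complex \<Rightarrow> vec" where "cst c = Poly_Mapping.single 0 c"
definition X :: "nat \<Rightarrow> vec" where "X n = bvec ({#n#}, 0)"
definition ee :: "int \<Rightarrow> vec" where "ee m = bvec ({#}, m)"

text \<open>Pairs of a multiset and an integer form a commutative monoid, so finitely supported
  functions on them already carry the convolution ring. With scalars as ring elements
  \<open>cst c\<close>, ring normalization treats scalars and monomials alike.\<close>

lemma smul_eq: "smul c v = cst c * v"
  by (simp add: smul_def cst_def mult_map_scale_conv_mult)

lemma bvec_mult: "bvec (a, m) * bvec (b, n) = bvec (a + b, m + n)"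
  by (simp add: bvec_def mult_single)

lemma bvec_add_mset: "bvec (add_mset n a, m) = X n * bvec (a, m)"
  by (simp add: X_def bvec_mult)

lemma bvec_empty: "bvec ({#}, m) = ee m"
  by (simp add: ee_def)

lemma ee_0 [simp]: "ee 0 = 1"
  by (simp add: ee_def bvec_def flip: zero_prod_def single_one)

lemma cst_0 [simp]: "cst 0 = 0" and cst_1 [simp]: "cst 1 = 1"
  by (simp_all add: cst_def)

lemma cst_add: "cst (a + b) = cst a + cst b"
  by (simp add: cst_def single_add)

lemma cst_minus: "cst (- a) = - cst a"
  by (simp add: cst_def single_uminus)

lemma cst_mult: "cst (a * b) = cst a * cst b"
  by (simp add: cst_def mult_single)

lemma cst_of_nat [simp]: "cst (of_nat n) = of_nat n"
  by (simp add: cst_def)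

lemma cst_of_int [simp]: "cst (of_int n) = of_int n"
  by (simp add: cst_def)

lemma cst_numeral [simp]: "cst (numeral n) = numeral n"
  by (simp add: cst_def)

lemma cst_mult_cancel: "a * b = 1 \<Longrightarrow> cst a * (cst b * v) = v"
  by (metis cst_1 cst_mult mult.assoc mult_1)

lemma vec_expand: "v = (\<Sum>b\<in>Poly_Mapping.keys v. cst (Poly_Mapping.lookup v b) * bvec b)"
proof -
  have "cst c * bvec b = Poly_Mapping.single b c" for c b
    by (simp add: cst_def bvec_def mult_single)
  moreover have "v = (\<Sum>b\<in>Poly_Mapping.keys v. Poly_Mapping.single b (Poly_Mapping.lookup v b))"
    by (rule poly_mapping_eqI)
       (auto simp: lookup_sum lookup_single when_def in_keys_iff)
  ultimately show ?thesis by simp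
qed

lemma vec_induct [case_names add cst bvec]:
  assumes "\<And>u v. P u \<Longrightarrow> P v \<Longrightarrow> P (u + v)" "\<And>c u. P u \<Longrightarrow> P (cst c * u)" "\<And>b. P (bvec b)"
  shows "P v"
proof -
  have P0: "P 0" using assms(2)[OF assms(3), of 0] by simp
  have "P (\<Sum>b\<in>B. cst (f b) * bvec b)" if "finite B" for B f
    using that by induction (auto intro: assms P0)
  then show ?thesis by (subst vec_expand) simp
qed

text \<open>The last case remembers membership in the support of the original vector, so that
  further restrictions on that support, such as charge zero in \<open>M1\<close>, stay
  available.\<close>

lemma VL_induct [consumes 1, case_names zero add cst bvec]:
  assumes "v \<in> VL" "P 0" "\<And>u v. P u \<Longrightarrow> P v \<Longrightarrow> P (u + v)" "\<And>c u. P u \<Longrightarrow> P (cst c * u)"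
    "\<And>a m. 0 \<notin># a \<Longrightarrow> (a, m) \<in> Poly_Mapping.keys v \<Longrightarrow> P (bvec (a, m))"
  shows "P v"
proof -
  have "P (\<Sum>b\<in>B. cst (f b) * bvec b)" if "finite B" "B \<subseteq> Poly_Mapping.keys v" for B f
    using that assms(1) by induction (auto intro!: assms(2-5) simp: VL_def)
  then show ?thesis by (subst vec_expand) simp
qed

section \<open>Linear operators and criteria for their equality\<close>

definition lin :: "(vec \<Rightarrow> vec) \<Rightarrow> bool" where
  "lin F \<longleftrightarrow> (\<forall>u v. F (u + v) = F u + F v) \<and> (\<forall>c u. F (cst c * u) = cst c * F u)"

lemma linD: assumes "lin F"
  shows lin_add: "F (u + v) = F u + F v" and lin_cst: "F (cst c * u) = cst c * F u"
    and lin_0: "F 0 = 0" and lin_minus: "F (- u) = - F u" and lin_diff: "F (u - v) = F u - F v"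
proof -
  show 1: "F (u + v) = F u + F v" and 2: "F (cst c * u) = cst c * F u" for u v c
    using assms by (auto simp: lin_def)
  show "F 0 = 0" using 2[of 0 0] by simp
  show 3: "F (- u) = - F u" for u using 2[of "-1" u] by (simp add: cst_minus)
  show "F (u - v) = F u - F v" using 1[of u "- v"] 3[of v] by simp
qed

lemma lin_of_nat: "lin F \<Longrightarrow> F (of_nat n * u) = of_nat n * F u"
  by (metis cst_of_nat lin_cst)

lemma lin_of_int: "lin F \<Longrightarrow> F (of_int n * u) = of_int n * F u"
  by (metis cst_of_int lin_cst)

lemma lin_numeral: "lin F \<Longrightarrow> F (numeral n * u) = numeral n * F u"
  by (metis cst_numeral lin_cst)

lemma lin_sum: "lin F \<Longrightarrow> F (sum g A) = (\<Sum>x\<in>A. F (g x))"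
  by (induction A rule: infinite_finite_induct) (simp_all add: linD)

lemma lin_intros [intro, simp]:
  shows lin_id: "lin (\<lambda>u. u)"
    and lin_zero: "lin (\<lambda>u. 0)"
    and lin_plus: "lin F \<Longrightarrow> lin G \<Longrightarrow> lin (\<lambda>u. F u + G u)"
    and lin_minus': "lin F \<Longrightarrow> lin G \<Longrightarrow> lin (\<lambda>u. F u - G u)"
    and lin_uminus: "lin F \<Longrightarrow> lin (\<lambda>u. - F u)"
    and lin_mult: "lin F \<Longrightarrow> lin (\<lambda>u. v * F u)"
    and lin_if: "lin F \<Longrightarrow> lin G \<Longrightarrow> lin (\<lambda>u. if b then F u else G u)"
  by (auto simp: lin_def algebra_simps)

lemma lin_comp: "lin F \<Longrightarrow> lin G \<Longrightarrow> lin (\<lambda>u. F (G u))"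
  by (simp add: lin_def)

lemma lin_eqI:
  assumes "lin F" "lin G" "\<And>a m. F (bvec (a, m)) = G (bvec (a, m))"
  shows "F v = G v"
  by (induction v rule: vec_induct) (use assms in \<open>auto simp: linD\<close>)

text \<open>The \<open>ee m\<close> generate everything under multiplication by the
  \<open>X n\<close>, so operators with known commutators with \<open>X n\<close> need to be
  compared on \<open>ee m\<close> only.\<close>

lemma lin_eqI_X:
  assumes "lin F" "lin G" "\<And>m. F (ee m) = G (ee m)"
    "\<And>n u. F u = G u \<Longrightarrow> F (X n * u) = G (X n * u)"
  shows "F v = G v"
proof (rule lin_eqI[OF assms(1,2)])
  fix a m show "F (bvec (a, m)) = G (bvec (a, m))"
    by (induction a) (use assms in \<open>auto simp: bvec_add_mset bvec_empty\<close>)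
qed

lemma vec_induct_X [case_names add cst ee X]:
  assumes "\<And>u v. P u \<Longrightarrow> P v \<Longrightarrow> P (u + v)" "\<And>c u. P u \<Longrightarrow> P (cst c * u)" "\<And>m. P (ee m)"
    "\<And>n u. P u \<Longrightarrow> P (X n * u)"
  shows "P v"
proof (induction v rule: vec_induct)
  case (bvec b)
  obtain a m where "b = (a, m)" by fastforce
  moreover have "P (bvec (a, m))"
    by (induction a) (use assms in \<open>auto simp: bvec_add_mset bvec_empty\<close>)
  ultimately show ?case by simp
qed (use assms in auto)

lemma lookup_cst_mult: "Poly_Mapping.lookup (cst c * u) b = c * Poly_Mapping.lookup u b"
  by (simp add: cst_def Poly_Mapping.map.rep_eq when_def flip: mult_map_scale_conv_mult)

lemma lin_lext: "lin (lext f)"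
proof -
  have ext: "lext f v = (\<Sum>b\<in>A. cst (Poly_Mapping.lookup v b) * f b)"
    if "finite A" "Poly_Mapping.keys v \<subseteq> A" for A v
    unfolding lext_def smul_eq
    by (rule sum.mono_neutral_left) (use that in \<open>auto simp: in_keys_iff\<close>)
  have "lext f (u + v) = lext f u + lext f v" for u v
    using keys_add[of u v]
    by (subst (1 2 3) ext[of "Poly_Mapping.keys u \<union> Poly_Mapping.keys v"])
       (auto simp: lookup_add cst_add distrib_right sum.distrib)
  moreover have "lext f (cst c * u) = cst c * lext f u" for c u
  proof -
    note l = lookup_cst_mult
    have "Poly_Mapping.keys (cst c * u) \<subseteq> Poly_Mapping.keys u"
      by (auto simp: in_keys_iff l)
    then show ?thesis
      by (subst (1 2) ext[of "Poly_Mapping.keys u"])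
         (auto simp: l cst_mult sum_distrib_left mult.assoc)
  qed
  ultimately show ?thesis by (simp add: lin_def)
qed

lemma lext_bvec [simp]: "lext f (bvec b) = f b"
  by (simp add: lext_def bvec_def smul_eq)

subsection \<open>The Heisenberg operators\<close>

lemma lin_heis: "lin (heis k j)"
  by (simp add: heis_def lin_lext)

lemma heis_neg: assumes "n > 0" shows "heis k (- int n) u = X n * u"
proof (rule lin_eqI[of "heis k (- int n)" "\<lambda>u. X n * u"])
  show "heis k (- int n) (bvec (a, m)) = X n * bvec (a, m)" for a m
    using assms by (simp add: heis_def heis_b_def bvec_add_mset)
qed (simp_all add: lin_heis)

lemma heis_less: "j < 0 \<Longrightarrow> heis k j u = X (nat (- j)) * u"
  using heis_neg[of "nat (- j)" k u] by simp

lemma heis_0_ee: "heis k 0 (ee m) = of_int (2 * int k * m) * ee m"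
  by (simp add: heis_def heis_b_def ee_def smul_eq cst_mult)

lemma heis_pos_ee: "j > 0 \<Longrightarrow> heis k j (ee m) = 0"
  by (simp add: heis_def heis_b_def ee_def smul_eq)

text \<open>The Heisenberg commutation relation. Multisets containing 0 are not excluded at this
  point; for \<open>c = 0\<close> the contraction carries the factor \<open>c\<close> and
  vanishes.\<close>

lemma heis_X:
  "heis k j (X c * u) = X c * heis k j u + (if j = int c then of_nat (2 * k * c) * u else 0)"
proof (rule lin_eqI[of "\<lambda>u. heis k j (X c * u)"])
  show "lin (\<lambda>u. heis k j (X c * u))"
    by (rule lin_comp) (simp_all add: lin_heis)
  show "lin (\<lambda>u. X c * heis k j u + (if j = int c then of_nat (2 * k * c) * u else 0))"
    by (simp add: lin_heis del: of_nat_mult)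
  fix a m
  have e: "heis k j (bvec (b, m)) = of_int (2 * int k * j * int (count b (nat j))) * bvec (b - {#nat j#}, m)"
    if "j > 0" for b using that by (simp add: heis_def heis_b_def smul_eq cst_mult)
  consider "j < 0" | "j = 0" | "j > 0" by linarith
  then show "heis k j (X c * bvec (a, m)) =
      X c * heis k j (bvec (a, m)) + (if j = int c then of_nat (2 * k * c) * bvec (a, m) else 0)"
  proof cases
    case 1 then show ?thesis by (simp add: heis_less algebra_simps)
  next
    case 2
    have "heis k 0 (bvec (b, m)) = of_int (2 * int k * m) * bvec (b, m)" for b
      by (simp add: heis_def heis_b_def smul_eq cst_mult)
    from this[of "add_mset c a"] this[of a] show ?thesis
      using 2 by (cases "c = 0") (simp_all add: bvec_add_mset algebra_simps)
  next
    case 3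
    show ?thesis
    proof (cases "j = int c")
      case True
      have "of_nat (count a c) * bvec (add_mset c (a - {#c#}), m) = of_nat (count a c) * bvec (a, m)"
        by (cases "c \<in># a") (auto simp: not_in_iff)
      then have *: "X c * (of_nat (count a c) * bvec (a - {#c#}, m)) = of_nat (count a c) * bvec (a, m)"
        by (simp add: bvec_add_mset mult.left_commute)
      have "heis k j (X c * bvec (a, m)) = of_int (2 * int k * j * int (count a c)) * bvec (a, m) + of_nat (2 * k * c) * bvec (a, m)"
        using e[of "add_mset c a"] 3 True by (simp add: bvec_add_mset algebra_simps)
      moreover have "X c * heis k j (bvec (a, m)) = of_int (2 * int k * j) * (X c * (of_nat (count a c) * bvec (a - {#c#}, m)))"
        using e[of a] 3 True by (simp add: algebra_simps)
      ultimately show ?thesis unfolding * using True by simp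
    next
      case False
      then have "nat j \<noteq> c" using 3 by auto
      then show ?thesis using 3 False e[of "add_mset c a"] e[of a]
        by (simp add: bvec_add_mset algebra_simps)
    qed
  qed
qed

lemma heis_eventually_0: "\<exists>N. \<forall>j\<ge>N. heis k j u = 0"
proof (induction u rule: vec_induct_X)
  case (add u v)
  then obtain N M where "\<forall>j\<ge>N. heis k j u = 0" "\<forall>j\<ge>M. heis k j v = 0" by auto
  then show ?case by (intro exI[of _ "max N M"]) (simp add: lin_add[OF lin_heis])
next
  case (cst c u) then show ?case by (metis lin_cst[OF lin_heis] mult_zero_right)
next
  case (ee m) show ?case by (rule exI[of _ 1]) (simp add: heis_pos_ee)
next
  case (X n u)
  then obtain N where "\<forall>j\<ge>N. heis k j u = 0" by auto
  then show ?case by (intro exI[of _ "max N (int n + 1)"]) (simp add: heis_X)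
qed

subsection \<open>Fields and normally ordered products\<close>

text \<open>Fields in the sense of vertex algebras. Truncation on each vector is what makes a
  normally ordered product a finite sum.\<close>

definition fld :: "(int \<Rightarrow> vec \<Rightarrow> vec) \<Rightarrow> bool" where
  "fld F \<longleftrightarrow> (\<forall>q. lin (F q)) \<and> (\<forall>u. \<exists>N. \<forall>q\<ge>N. F q u = 0)"

text \<open>The coefficient with which the mode alpha(j) enters the field of alpha(-n).\<close>

definition bin :: "nat \<Rightarrow> int \<Rightarrow> complex" where
  "bin n j = (of_int (- j - 1) :: complex) gchoose (n - 1)"

definition nop_term :: "nat \<Rightarrow> nat \<Rightarrow> (int \<Rightarrow> vec \<Rightarrow> vec) \<Rightarrow> int \<Rightarrow> vec \<Rightarrow> int \<Rightarrow> vec" where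
  "nop_term k n F q u j = cst (bin n j) *
     (if j < 0 then heis k j (F (q - j - int n) u) else F (q - j - int n) (heis k j u))"

definition nop :: "nat \<Rightarrow> nat \<Rightarrow> (int \<Rightarrow> vec \<Rightarrow> vec) \<Rightarrow> int \<Rightarrow> vec \<Rightarrow> vec" where
  "nop k n F q u = Sum_any (nop_term k n F q u)"

lemma fld_lin: "fld F \<Longrightarrow> lin (F q)"
  by (simp add: fld_def)

lemma Yl_Cons: "Yl k (n # ns) p = nop k n (Yl k ns p)"
proof (intro ext)
  fix q u
  have *: "(\<lambda>j. if j < 0 then smul ((of_int (- j - 1) :: complex) gchoose (n - 1)) (heis k j (Yl k ns p (q - j - int n) u))
      else smul ((of_int (- j - 1) :: complex) gchoose (n - 1)) (Yl k ns p (q - j - int n) (heis k j u)))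
      = nop_term k n (Yl k ns p) q u"
    by (auto simp: fun_eq_iff nop_term_def bin_def smul_eq)
  then show "Yl k (n # ns) p q u = nop k n (Yl k ns p) q u"
    by (simp only: Yl.simps(2) nop_def *)
qed

declare Yl.simps [simp del]

lemma lin_nop_term: "fld F \<Longrightarrow> lin (\<lambda>u. nop_term k n F q u j)"
  unfolding nop_term_def
  using lin_comp[OF lin_heis fld_lin[of F]] lin_comp[OF fld_lin[of F] lin_heis]
  by (cases "j < 0") (simp_all add: lin_mult)

lemma nop_term_support:
  assumes "fld F" "\<forall>q\<ge>N. F q u = 0" "\<forall>j\<ge>M. heis k j u = 0" "nop_term k n F q u j \<noteq> 0"
  shows "j \<in> {q - int n - N..<0} \<union> {0..<M}"
proof -
  have "F (q - j - int n) u = 0" if "j < q - int n - N" using assms(2) that by auto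
  moreover have "heis k j u = 0" if "j \<ge> M" using assms(3) that by auto
  ultimately show ?thesis
    using assms(4) by (force simp: nop_term_def lin_0[OF lin_heis] lin_0[OF fld_lin[OF assms(1)]] split: if_splits)
qed

lemma finite_nop_term:
  assumes "fld F" shows "finite {j. nop_term k n F q u j \<noteq> 0}"
proof -
  obtain N where N: "\<forall>q\<ge>N. F q u = 0" using assms unfolding fld_def by blast
  obtain M where M: "\<forall>j\<ge>M. heis k j u = 0" using heis_eventually_0 by blast
  have "{j. nop_term k n F q u j \<noteq> 0} \<subseteq> {q - int n - N..<0} \<union> {0..<M}"
    using nop_term_support[OF assms N M] by blast
  then show ?thesis by (rule finite_subset) simp
qed

lemma lin_nop:
  assumes "fld F" shows "lin (nop k n F q)"
  unfolding lin_def
proof safe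
  note fin = finite_nop_term[OF assms]
  show "nop k n F q (u + v) = nop k n F q u + nop k n F q v" for u v
    unfolding nop_def lin_add[OF lin_nop_term[OF assms]]
    by (rule Sum_any.distrib[OF fin fin])
  show "nop k n F q (cst c * u) = cst c * nop k n F q u" for c u
    unfolding nop_def lin_cst[OF lin_nop_term[OF assms]]
    by (rule Sum_any_right_distrib[OF fin, symmetric])
qed

lemma fld_nop:
  assumes "fld F" shows "fld (nop k n F)"
proof -
  have "\<exists>L. \<forall>q\<ge>L. nop k n F q u = 0" for u
  proof -
    obtain N where N: "\<forall>q\<ge>N. F q u = 0" using assms unfolding fld_def by blast
    obtain M where M: "\<forall>j\<ge>M. heis k j u = 0" using heis_eventually_0 by blast
    have "\<forall>j. \<exists>K. \<forall>q\<ge>K. F q (heis k j u) = 0" using assms by (auto simp: fld_def)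
    then obtain K where K: "\<And>j q. q \<ge> K j \<Longrightarrow> F q (heis k j u) = 0" by metis
    \<comment> \<open>One bound for the finitely many vectors \<open>heis k j u\<close> with 0 <= j
      < M: the sum dominates every \<open>K j\<close>, M absorbs the shift by j, and N + n empties
      the range of creation indices.\<close>
    define L where "L = (\<Sum>j\<in>{0..<M}. \<bar>K j\<bar>) + \<bar>M\<bar> + \<bar>N\<bar> + int n"
    have "nop_term k n F q u j = 0" if "q \<ge> L" for q j
    proof (rule ccontr)
      assume nz: "nop_term k n F q u j \<noteq> 0"
      have L0: "L \<ge> N + int n" unfolding L_def
        using sum_nonneg[of "{0..<M}" "\<lambda>j. \<bar>K j\<bar>"] by linarith
      have "j \<in> {0..<M}"
        using nop_term_support[OF assms N M nz] L0 that by auto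
      then have "\<bar>K j\<bar> \<le> (\<Sum>j\<in>{0..<M}. \<bar>K j\<bar>)" by (intro member_le_sum) auto
      then have "q - j - int n \<ge> K j" using that \<open>j \<in> {0..<M}\<close> by (auto simp: L_def)
      then show False using nz \<open>j \<in> {0..<M}\<close> K by (auto simp: nop_term_def)
    qed
    then have "nop_term k n F q u = (\<lambda>j. 0)" if "q \<ge> L" for q
      using that by (simp add: fun_eq_iff)
    then show ?thesis unfolding nop_def by (metis Sum_any.neutral)
  qed
  then show ?thesis using lin_nop[OF assms] by (auto simp: fld_def)
qed

lemma nop_eqI:
  assumes "finite A" "\<And>j. j \<notin> A \<Longrightarrow> nop_term k n F q u j = 0"
  shows "nop k n F q u = (\<Sum>j\<in>A. nop_term k n F q u j)"
  unfolding nop_def using assms by (intro Sum_any.expand_superset) auto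

text \<open>Wick's rule for one factor: \<open>X c\<close> is contracted either inside
  \<open>F\<close>, which gives \<open>G\<close>, or with the new field, in which only alpha(c)
  fails to commute with it; this gives the last summand.\<close>

lemma nop_X:
  assumes "fld F" "fld G" "\<And>q u. F q (X c * u) = X c * F q u + G q u"
  shows "nop k n F q (X c * u) = X c * nop k n F q u + nop k n G q u
           + cst (of_nat (2 * k * c) * bin n (int c)) * F (q - int c - int n) u"
proof -
  let ?d = "\<lambda>j. (cst (of_nat (2 * k * c) * bin n (int c)) * F (q - int c - int n) u when j = int c)"
  note fin = finite_nop_term[OF assms(1)] finite_nop_term[OF assms(2)]
  have fin1: "finite {j. X c * nop_term k n F q u j \<noteq> 0}"
    by (rule finite_subset[OF _ fin(1)[of k n q u]]) auto
  have fin2: "finite {j. X c * nop_term k n F q u j + nop_term k n G q u j \<noteq> 0}"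
    by (rule finite_subset[OF _ finite_UnI[OF fin1 fin(2)[of k n q u]]]) auto
  have fin3: "finite {j. ?d j \<noteq> 0}"
    by (rule finite_subset[of _ "{int c}"]) auto
  have "nop_term k n F q (X c * u) j = X c * nop_term k n F q u j + nop_term k n G q u j + ?d j" for j
  proof (cases "j < 0")
    case True
    then show ?thesis
      by (simp add: nop_term_def assms(3) heis_less distrib_left mult.left_commute)
  next
    case False
    have "F q' (of_nat (2 * k * c) * u) = of_nat (2 * k * c) * F q' u" for q'
      by (rule lin_of_nat[OF fld_lin[OF assms(1)]])
    then show ?thesis using False
      by (cases "j = int c")
         (simp_all add: nop_term_def assms(3) heis_X lin_add[OF fld_lin[OF assms(1)]] cst_mult
            distrib_left mult.left_commute mult.assoc del: of_nat_mult)
  qed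
  then have "nop k n F q (X c * u) = Sum_any (\<lambda>j. X c * nop_term k n F q u j + nop_term k n G q u j + ?d j)"
    by (simp add: nop_def)
  also have "\<dots> = X c * nop k n F q u + nop k n G q u + Sum_any ?d"
    unfolding nop_def Sum_any.distrib[OF fin2 fin3] Sum_any.distrib[OF fin1 fin(2)]
    by (simp add: Sum_any_right_distrib[OF fin(1)])
  finally show ?thesis by simp
qed

subsection \<open>Vertex operators of the lattice vectors\<close>

declare of_nat_sum_mset [simp del]

lemma member_le_sum_mset: "x \<in># c \<Longrightarrow> x \<le> (sum_mset c :: nat)"
  by (auto dest: multi_member_split)

lemma size_le_sum_mset: "0 \<notin># c \<Longrightarrow> size c \<le> (sum_mset c :: nat)"
  by (induction c) auto

lemma finite_sub_mset: "finite {b. b \<subseteq># a}"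
proof (rule finite_subset)
  show "{b. b \<subseteq># a} \<subseteq> (\<Union>n\<le>size a. multisets_of_size (set_mset a) n)"
    by (auto simp: multisets_of_size_def size_mset_mono dest: mset_subset_eqD)
qed auto

lemma finite_mset_sum: "finite {c. 0 \<notin># c \<and> sum_mset c = (N::nat)}"
proof (rule finite_subset)
  have "x \<le> N" if "x \<in># c" "sum_mset c = N" for x c
    using that member_le_sum_mset by blast
  then show "{c. 0 \<notin># c \<and> sum_mset c = N} \<subseteq> (\<Union>n\<le>N. multisets_of_size {1..N} n)"
    using size_le_sum_mset by (force simp: multisets_of_size_def Suc_le_eq intro: gr0I)
qed auto

lemma sum_mset_count: "finite A \<Longrightarrow> set_mset c \<subseteq> A \<Longrightarrow> sum_mset c = (\<Sum>j\<in>A. j * count c j :: nat)"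
proof (induction c)
  case (add x c)
  have "(\<Sum>j\<in>A. j * count (add_mset x c) j) = (\<Sum>j\<in>A. j * count c j + (if j = x then x else 0))"
    by (intro sum.cong) auto
  then show ?case using add by (simp add: sum.distrib)
qed auto

text \<open>\<open>vexp_coeff\<close> splits into this factor and \<open>annih_coeff\<close>. The
  creation factor depends on \<open>c\<close> alone, so for a fixed annihilated part the sum over
  \<open>c\<close> can be done first.\<close>

definition creat_coeff :: "int \<Rightarrow> nat multiset \<Rightarrow> complex" where
  "creat_coeff p c = (\<Prod>n\<in>set_mset c. (of_int p / of_nat n) ^ count c n / of_nat (fact (count c n)))"

definition annih_coeff :: "complex \<Rightarrow> nat multiset \<Rightarrow> nat multiset \<Rightarrow> complex" where
  "annih_coeff y a b = (\<Prod>n\<in>set_mset a. of_nat (count a n choose count b n) * y ^ count b n)"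

text \<open>The elementary Schur polynomial: the coefficient of z^N in exp(p sum x_n z^n / n). An
  integer index lets negative N yield zero without a case distinction.\<close>

definition Sm :: "int \<Rightarrow> int \<Rightarrow> vec" where
  "Sm p N = (\<Sum>c\<in>{c. 0 \<notin># c \<and> int (sum_mset c) = N}. cst (creat_coeff p c) * bvec (c, 0))"

lemma finite_mset_sum_int: "finite {c. 0 \<notin># c \<and> int (sum_mset c) = N}"
  by (rule finite_subset[OF _ finite_mset_sum[of "nat N"]]) auto

lemma creat_coeff_superset:
  "finite A \<Longrightarrow> set_mset c \<subseteq> A \<Longrightarrow>
     creat_coeff p c = (\<Prod>n\<in>A. (of_int p / of_nat n) ^ count c n / of_nat (fact (count c n)))"
  unfolding creat_coeff_def by (rule prod.mono_neutral_left) (auto simp: not_in_iff)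

lemma creat_coeff_add:
  assumes "j > 0"
  shows "of_nat (j * count (add_mset j c) j) * creat_coeff p (add_mset j c) = of_int p * creat_coeff p c"
proof -
  let ?f = "\<lambda>c n. (of_int p / of_nat n) ^ count c n / of_nat (fact (count c n)) :: complex"
  let ?A = "set_mset c - {j}"
  have H: "creat_coeff p c' = ?f c' j * prod (?f c') ?A" if "set_mset c' \<subseteq> insert j ?A" for c'
  proof -
    have "creat_coeff p c' = prod (?f c') (insert j ?A)"
      by (rule creat_coeff_superset) (use that in auto)
    also have "\<dots> = ?f c' j * prod (?f c') ?A" by (rule prod.insert) auto
    finally show ?thesis .
  qed
  have R: "prod (?f (add_mset j c)) ?A = prod (?f c) ?A"
    by (rule prod.cong) auto
  have *: "of_nat (j * Suc m) * (x ^ Suc m / of_nat (fact (Suc m))) = (of_nat j * x) * (x ^ m / of_nat (fact m))"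
    for m and x :: complex
  proof -
    have "of_nat (fact (Suc m)) = (of_nat (Suc m) * of_nat (fact m) :: complex)"
      by (simp only: fact_Suc of_nat_mult of_nat_id)
    then show ?thesis by (simp add: field_simps del: of_nat_Suc fact_Suc mult_Suc_right)
  qed
  have "count (add_mset j c) j = Suc (count c j)" by simp
  then have "of_nat (j * count (add_mset j c) j) * ?f (add_mset j c) j = (of_nat j * (of_int p / of_nat j)) * ?f c j"
    by (simp only: *)
  also have "of_nat j * (of_int p / of_nat j) = (of_int p :: complex)" using assms by simp
  finally have "of_nat (j * count (add_mset j c) j) * (?f (add_mset j c) j * prod (?f c) ?A) = of_int p * (?f c j * prod (?f c) ?A)"
    by (simp only: mult.assoc[symmetric])
  moreover have "creat_coeff p c = ?f c j * prod (?f c) ?A" by (rule H) auto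
  moreover have "creat_coeff p (add_mset j c) = ?f (add_mset j c) j * prod (?f c) ?A"
    unfolding R[symmetric] by (rule H) auto
  ultimately show ?thesis by metis
qed

lemma Sm_neg: "N < 0 \<Longrightarrow> Sm p N = 0"
  by (auto simp: Sm_def intro: sum.neutral)

text \<open>Logarithmic derivative: z d/dz multiplies the exponential by p sum x_j z^j.\<close>

lemma Sm_rec: "of_int N * Sm p N = of_int p * (\<Sum>j=1..nat N. X j * Sm p (N - int j))"
proof (cases "N \<ge> 0")
  case True
  define n where "n = nat N"
  have N: "N = int n" using True by (simp add: n_def)
  define S where "S = (\<lambda>n::nat. {c. 0 \<notin># c \<and> sum_mset c = n})"
  have Sm: "Sm p (int m) = (\<Sum>c\<in>S m. cst (creat_coeff p c) * bvec (c, 0))" for m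
    by (simp add: Sm_def S_def)
  have "of_nat n * Sm p N = (\<Sum>c\<in>S n. of_nat (sum_mset c) * (cst (creat_coeff p c) * bvec (c, 0)))"
    unfolding N Sm sum_distrib_left by (rule sum.cong) (auto simp: S_def)
  \<comment> \<open>The weight of a monomial is split over its parts. For fixed \<open>j\<close> the
    factor \<open>j * count c j\<close> cancels against the coefficient when one copy of
    \<open>j\<close> is removed.\<close>
  also have "\<dots> = (\<Sum>c\<in>S n. \<Sum>j=1..n. of_nat (j * count c j) * (cst (creat_coeff p c) * bvec (c, 0)))"
  proof (rule sum.cong)
    fix c assume c: "c \<in> S n"
    have "set_mset c \<subseteq> {1..n}"
      using c member_le_sum_mset[of _ c] by (auto simp: S_def Suc_le_eq intro: gr0I)
    then show "of_nat (sum_mset c) * (cst (creat_coeff p c) * bvec (c, 0)) =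
        (\<Sum>j=1..n. of_nat (j * count c j) * (cst (creat_coeff p c) * bvec (c, 0)))"
      by (subst sum_mset_count[of "{1..n}"]) (simp_all add: sum_distrib_right)
  qed simp
  also have "\<dots> = (\<Sum>j=1..n. \<Sum>c\<in>S n. of_nat (j * count c j) * (cst (creat_coeff p c) * bvec (c, 0)))"
    by (rule sum.swap)
  also have "\<dots> = (\<Sum>j=1..n. of_int p * (X j * Sm p (N - int j)))"
  proof (rule sum.cong)
    fix j assume j: "j \<in> {1..n}"
    have "(\<Sum>c\<in>S n. of_nat (j * count c j) * (cst (creat_coeff p c) * bvec (c, 0)))
        = (\<Sum>c\<in>{c\<in>S n. j \<in># c}. of_nat (j * count c j) * (cst (creat_coeff p c) * bvec (c, 0)))"
      using finite_mset_sum[of n] by (intro sum.mono_neutral_right) (auto simp: S_def intro: count_inI)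
    also have "\<dots> = (\<Sum>c\<in>S (n - j). of_int p * (X j * (cst (creat_coeff p c) * bvec (c, 0))))"
    proof (rule sum.reindex_bij_witness[of _ "add_mset j" "\<lambda>c. c - {#j#}"])
      fix c assume "c \<in> {c \<in> S n. j \<in># c}"
      then obtain c' where c: "c = add_mset j c'" by (auto dest: multi_member_split)
      have "of_nat (j * count c j) * cst (creat_coeff p c) = of_int p * cst (creat_coeff p c')"
        using creat_coeff_add[of j c' p] j unfolding c by (metis atLeastAtMost_iff cst_mult cst_of_int cst_of_nat less_eq_Suc_le One_nat_def)
      then show "of_int p * (X j * (cst (creat_coeff p (c - {#j#})) * bvec (c - {#j#}, 0))) =
          of_nat (j * count c j) * (cst (creat_coeff p c) * bvec (c, 0))"
        by (simp add: c bvec_add_mset mult.assoc[symmetric] del: of_nat_mult)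
    qed (use j in \<open>auto simp: S_def dest!: multi_member_split\<close>)
    also have "\<dots> = of_int p * (X j * Sm p (N - int j))"
      using j by (simp add: N Sm sum_distrib_left flip: of_nat_diff)
    finally show "(\<Sum>c\<in>S n. of_nat (j * count c j) * (cst (creat_coeff p c) * bvec (c, 0))) =
        of_int p * (X j * Sm p (N - int j))" .
  qed simp
  finally show ?thesis by (simp add: N sum_distrib_left)
qed (simp add: Sm_neg)

lemma Sm_0 [simp]: "Sm p 0 = 1"
proof -
  have "{c. 0 \<notin># c \<and> int (sum_mset c) = 0} = {{#}}"
    by (auto simp: set_mset_eq_empty_iff[symmetric] simp del: set_mset_eq_empty_iff)
  then show ?thesis by (simp add: Sm_def creat_coeff_def bvec_empty)
qed

lemma Sm_1: "Sm p 1 = of_int p * X 1"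
  using Sm_rec[of 1 p] by simp

text \<open>Annihilation is a substitution x_n -> x_n + y, hence multiplicative: an additional
  factor x_n either stays or is replaced by y. The binomials recombine by Pascal's rule.
  \<open>\<psi>\<close> receives the remaining and the removed part.\<close>

lemma annih_coeff_add:
  fixes \<psi> :: "nat multiset \<Rightarrow> nat multiset \<Rightarrow> vec"
  shows "(\<Sum>b\<in>{b. b \<subseteq># add_mset n a}. cst (annih_coeff y (add_mset n a) b) * \<psi> (add_mset n a - b) b)
    = (\<Sum>b\<in>{b. b \<subseteq># a}. cst (annih_coeff y a b) * (\<psi> (add_mset n (a - b)) b + cst y * \<psi> (a - b) (add_mset n b)))"
proof -
  let ?S = "set_mset (add_mset n a)"
  let ?f = "\<lambda>a b i. of_nat (count a i choose count b i) * y ^ count b i :: complex"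
  \<comment> \<open>\<open>g\<close> is the coefficient for \<open>a\<close>, taken over the larger
    index set of \<open>add_mset n a\<close>; it vanishes as soon as \<open>b\<close> is not
    contained in \<open>a\<close>.\<close>
  define g where "g b = prod (?f a b) ?S" for b
  have g: "g b = annih_coeff y a b" if "b \<subseteq># a" for b
    unfolding g_def annih_coeff_def
  proof (rule prod.mono_neutral_right)
    show "\<forall>i\<in>?S - set_mset a. ?f a b i = 1"
    proof
      fix i assume "i \<in> ?S - set_mset a"
      then have "count a i = 0" "count b i = 0"
        using mset_subset_eq_count[OF that, of i] by (auto simp: not_in_iff)
      then show "?f a b i = 1" by simp
    qed
  qed auto
  have g0: "g b = 0" if "\<not> b \<subseteq># a" "b \<subseteq># add_mset n a" for b
  proof -
    obtain i where i: "count b i > count a i" using \<open>\<not> b \<subseteq># a\<close> by (auto simp: subseteq_mset_def not_le)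
    then have "i \<in> ?S" using that(2) by (metis count_greater_zero_iff gr0I mset_subset_eqD not_less0)
    then show ?thesis unfolding g_def using i by (intro prod_zero) (auto simp: binomial_eq_0)
  qed
  have rec: "annih_coeff y (add_mset n a) b = g b + (if n \<in># b then y * g (b - {#n#}) else 0)" for b
  proof -
    define R where "R = (\<Prod>i\<in>?S - {n}. ?f a b i)"
    have 1: "g b = ?f a b n * R" unfolding g_def R_def by (rule prod.remove) auto
    have "annih_coeff y (add_mset n a) b = ?f (add_mset n a) b n * (\<Prod>i\<in>?S - {n}. ?f (add_mset n a) b i)"
      unfolding annih_coeff_def by (rule prod.remove) auto
    also have "(\<Prod>i\<in>?S - {n}. ?f (add_mset n a) b i) = R"
      unfolding R_def by (rule prod.cong) auto
    finally have 2: "annih_coeff y (add_mset n a) b = ?f (add_mset n a) b n * R" .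
    have "g (b - {#n#}) = ?f a (b - {#n#}) n * (\<Prod>i\<in>?S - {n}. ?f a (b - {#n#}) i)"
      unfolding g_def by (rule prod.remove) auto
    also have "(\<Prod>i\<in>?S - {n}. ?f a (b - {#n#}) i) = R"
      unfolding R_def by (rule prod.cong) auto
    finally have 3: "g (b - {#n#}) = ?f a (b - {#n#}) n * R" .
    show ?thesis
    proof (cases "count b n")
      case 0
      then have "n \<notin># b" by (simp add: not_in_iff)
      then show ?thesis by (simp add: 0 1 2)
    next
      case (Suc d)
      moreover have "n \<in># b" using Suc by (simp add: count_inI)
      ultimately show ?thesis by (simp add: 1 2 3 algebra_simps)
    qed
  qed
  let ?A = "{b. b \<subseteq># add_mset n a}" and ?B = "{b. b \<subseteq># a}"
  have fin: "finite ?A" "finite ?B" by (rule finite_sub_mset)+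
  have BA: "?B \<subseteq> ?A" by (auto intro: subset_mset.order_trans)
  have "(\<Sum>b\<in>?A. cst (annih_coeff y (add_mset n a) b) * \<psi> (add_mset n a - b) b)
     = (\<Sum>b\<in>?A. cst (g b) * \<psi> (add_mset n a - b) b)
       + (\<Sum>b\<in>?A. (if n \<in># b then cst (y * g (b - {#n#})) * \<psi> (add_mset n a - b) b else 0))"
    unfolding rec by (subst sum.distrib[symmetric]) (auto intro!: sum.cong simp: cst_add algebra_simps)
  also have "(\<Sum>b\<in>?A. cst (g b) * \<psi> (add_mset n a - b) b) = (\<Sum>b\<in>?B. cst (g b) * \<psi> (add_mset n a - b) b)"
    by (rule sum.mono_neutral_right) (use fin BA g0 in auto)
  also have "\<dots> = (\<Sum>b\<in>?B. cst (annih_coeff y a b) * \<psi> (add_mset n (a - b)) b)"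
  proof (rule sum.cong)
    fix b assume "b \<in> ?B"
    then have "add_mset n a - b = add_mset n (a - b)"
      by (auto simp: multiset_eq_iff subseteq_mset_def Suc_diff_le)
    then show "cst (g b) * \<psi> (add_mset n a - b) b = cst (annih_coeff y a b) * \<psi> (add_mset n (a - b)) b"
      using \<open>b \<in> ?B\<close> g by simp
  qed simp
  also have "(\<Sum>b\<in>?A. (if n \<in># b then cst (y * g (b - {#n#})) * \<psi> (add_mset n a - b) b else 0))
     = (\<Sum>b\<in>{b\<in>?A. n \<in># b}. cst (y * g (b - {#n#})) * \<psi> (add_mset n a - b) b)"
    by (rule sum.inter_filter[OF fin(1), symmetric])
  also have "\<dots> = (\<Sum>b\<in>?B. cst (annih_coeff y a b) * (cst y * \<psi> (a - b) (add_mset n b)))"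
    by (rule sum.reindex_bij_witness[of _ "add_mset n" "\<lambda>b. b - {#n#}"])
       (auto simp: g cst_mult ac_simps dest!: multi_member_split)
  finally show ?thesis by (simp add: sum.distrib distrib_left)
qed

text \<open>For a given annihilated part \<open>b\<close> the mode condition fixes the weight of the
  created part, so the inner sum is one Schur polynomial.\<close>

lemma vexp_b_eq:
  "vexp_b k p q (a, m) = (\<Sum>b\<in>{b. b \<subseteq># a}. cst (annih_coeff (of_int (- 2 * int k * p)) a b) *
      (bvec (a - b, p + m) * Sm p (- q - 1 - 2 * int k * p * m + int (sum_mset b))))"
proof -
  let ?N = "\<lambda>b. - q - 1 - 2 * int k * p * m + int (sum_mset b)"
  let ?C = "\<lambda>b. {c. 0 \<notin># c \<and> int (sum_mset c) = ?N b}"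
  have "{(b, c). b \<subseteq># a \<and> 0 \<notin># c \<and> 2 * int k * p * m + int (sum_mset c) - int (sum_mset b) = - q - 1}
     = Sigma {b. b \<subseteq># a} ?C" by auto
  then have "vexp_b k p q (a, m) = (\<Sum>bc\<in>Sigma {b. b \<subseteq># a} ?C.
        cst (vexp_coeff k p a (fst bc) (snd bc)) * bvec (a - fst bc + snd bc, p + m))"
    by (simp add: vexp_b_def smul_eq)
  also have "\<dots> = (\<Sum>b\<in>{b. b \<subseteq># a}. \<Sum>c\<in>?C b. cst (vexp_coeff k p a b c) * bvec (a - b + c, p + m))"
    by (subst sum.Sigma) (auto simp: finite_sub_mset finite_mset_sum_int case_prod_unfold)
  also have "\<dots> = (\<Sum>b\<in>{b. b \<subseteq># a}. cst (annih_coeff (of_int (- 2 * int k * p)) a b) * (bvec (a - b, p + m) * Sm p (?N b)))"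
  proof (rule sum.cong)
    fix b
    have "cst (vexp_coeff k p a b c) * bvec (a - b + c, p + m) =
      cst (annih_coeff (of_int (- 2 * int k * p)) a b) * (bvec (a - b, p + m) * (cst (creat_coeff p c) * bvec (c, 0)))" for c
    proof -
      have "bvec (a - b + c, p + m) = bvec (a - b, p + m) * bvec (c, 0)"
        by (simp add: bvec_mult)
      then show ?thesis
        unfolding vexp_coeff_def annih_coeff_def creat_coeff_def cst_mult
        by (simp only: mult.left_commute mult.assoc)
    qed
    then show "(\<Sum>c\<in>?C b. cst (vexp_coeff k p a b c) * bvec (a - b + c, p + m)) =
      cst (annih_coeff (of_int (- 2 * int k * p)) a b) * (bvec (a - b, p + m) * Sm p (?N b))"
      by (simp add: Sm_def sum_distrib_left)
  qed simp
  finally show ?thesis .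
qed

definition vop :: "nat \<Rightarrow> int \<Rightarrow> int \<Rightarrow> vec \<Rightarrow> vec" where
  "vop k p q u = lext (vexp_b k p q) u"

lemma Yl_Nil: "Yl k [] p = vop k p"
  by (simp add: fun_eq_iff vop_def Yl.simps)

lemma lin_vop: "lin (vop k p q)"
  by (simp add: vop_def[abs_def] lin_lext)

lemma vop_ee: "vop k p q (ee m) = Sm p (- q - 1 - 2 * int k * p * m) * ee (p + m)"
  by (simp add: vop_def ee_def vexp_b_eq annih_coeff_def)

text \<open>The vertex operator translates x_n by -2kp z^(-n), hence commutes with
  \<open>X n\<close> up to a shift of the mode by n. Together with \<open>vop_ee\<close> this
  determines \<open>vop\<close>; the sums over submultisets are not opened again.\<close>

lemma vop_X: "vop k p q (X n * u) = X n * vop k p q u - of_int (2 * int k * p) * vop k p (q - int n) u"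
proof (rule lin_eqI[of "\<lambda>u. vop k p q (X n * u)"])
  fix a m
  let ?y = "of_int (- 2 * int k * p) :: complex"
  let ?N = "\<lambda>b. - q - 1 - 2 * int k * p * m + int (sum_mset b)"
  have "vop k p q (X n * bvec (a, m)) = vexp_b k p q (add_mset n a, m)"
    by (simp add: vop_def flip: bvec_add_mset)
  also have "\<dots> = (\<Sum>b\<in>{b. b \<subseteq># a}. cst (annih_coeff ?y a b) *
      (bvec (add_mset n (a - b), p + m) * Sm p (?N b) + cst ?y * (bvec (a - b, p + m) * Sm p (?N (add_mset n b)))))"
    unfolding vexp_b_eq by (rule annih_coeff_add)
  also have "\<dots> = X n * vexp_b k p q (a, m) + cst ?y * vexp_b k p (q - int n) (a, m)"
    unfolding vexp_b_eq sum_distrib_left sum.distrib[symmetric]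
    by (rule sum.cong) (simp_all add: bvec_add_mset algebra_simps)
  finally show "vop k p q (X n * bvec (a, m)) =
      X n * vop k p q (bvec (a, m)) - of_int (2 * int k * p) * vop k p (q - int n) (bvec (a, m))"
    by (simp add: vop_def cst_minus cst_mult)
qed (auto intro!: lin_comp[OF lin_vop] lin_minus' simp: lin_vop)

lemma fld_vop: "fld (vop k p)"
proof -
  have "\<exists>N. \<forall>q\<ge>N. vop k p q u = 0" for u
  proof (induction u rule: vec_induct_X)
    case (add u v)
    then obtain N M where "\<forall>q\<ge>N. vop k p q u = 0" "\<forall>q\<ge>M. vop k p q v = 0" by auto
    then show ?case by (intro exI[of _ "max N M"]) (simp add: lin_add[OF lin_vop])
  next
    case (cst c u) then show ?case by (metis lin_cst[OF lin_vop] mult_zero_right)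
  next
    case (ee m) show ?case by (rule exI[of _ "- 2 * int k * p * m"]) (simp add: vop_ee Sm_neg)
  next
    case (X n u)
    then obtain N where "\<forall>q\<ge>N. vop k p q u = 0" by auto
    then show ?case by (intro exI[of _ "N + int n"]) (simp add: vop_X)
  qed
  then show ?thesis by (simp add: fld_def lin_vop)
qed

lemma fld_Yl: "fld (Yl k ns p)"
  by (induction ns) (simp_all only: Yl_Nil Yl_Cons fld_vop fld_nop)

lemma lin_Yl: "lin (Yl k ns p q)"
  by (rule fld_lin[OF fld_Yl])

subsection \<open>The involution and quadratic fields\<close>

lemma lin_theta: "lin theta"
  unfolding theta_def by (rule lin_lext)

lemma theta_bvec: "theta (bvec (a, m)) = cst ((- 1) ^ size a) * bvec (a, - m)"
  by (simp add: theta_def smul_eq)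

lemma theta_ee [simp]: "theta (ee m) = ee (- m)"
  by (simp add: ee_def theta_bvec)

lemma theta_X [simp]: "theta (X n * u) = - (X n * theta u)"
proof (rule lin_eqI[of "\<lambda>u. theta (X n * u)"])
  show "theta (X n * bvec (a, m)) = - (X n * theta (bvec (a, m)))" for a m
    unfolding bvec_add_mset[symmetric] theta_bvec by (simp add: bvec_add_mset cst_minus)
qed (auto intro!: lin_comp[OF lin_theta] simp: lin_theta)

lemmas theta_lin [simp] = linD[OF lin_theta] lin_of_nat[OF lin_theta] lin_of_int[OF lin_theta]
  lin_numeral[OF lin_theta]

lemma theta_theta [simp]: "theta (theta u) = u"
  by (induction u rule: vec_induct_X) auto

lemma VL_0 [simp]: "0 \<in> VL"
  by (simp add: VL_def)

lemma VL_mult: "u \<in> VL \<Longrightarrow> v \<in> VL \<Longrightarrow> u * v \<in> VL"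
  unfolding VL_def using keys_mult[of u v] by fastforce

lemma VL_add: "u \<in> VL \<Longrightarrow> v \<in> VL \<Longrightarrow> u + v \<in> VL"
  unfolding VL_def using keys_add[of u v] by blast

lemma VL_bvec [simp]: "bvec (a, m) \<in> VL \<longleftrightarrow> 0 \<notin># a"
  by (simp add: VL_def bvec_def)

lemma VL_cst [simp]: "cst c \<in> VL"
  by (simp add: VL_def cst_def zero_prod_def)

lemma VL_cst_mult: "u \<in> VL \<Longrightarrow> cst c * u \<in> VL"
  by (rule VL_mult) simp_all

lemma VL_ee [simp]: "ee m \<in> VL"
  by (simp add: ee_def)

lemma VL_X [simp]: "n > 0 \<Longrightarrow> X n \<in> VL"
  by (simp add: X_def)

lemma VL_theta: "u \<in> VL \<Longrightarrow> theta u \<in> VL"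
proof (induction u rule: VL_induct)
  case (bvec a m) then show ?case by (simp add: theta_bvec VL_cst_mult)
qed (auto intro: VL_add VL_cst_mult)

lemma VLplus_theta: "u \<in> VL \<Longrightarrow> u + theta u \<in> VLplus"
  by (simp add: VLplus_def VL_add VL_theta add.commute)

section \<open>Binomial coefficients and the modes of x_m x_n\<close>

lemma bin_neg: "i > 0 \<Longrightarrow> bin n (- int i) = of_nat ((i - 1) choose (n - 1))"
  by (simp add: bin_def binomial_gbinomial of_nat_diff)

lemma bin_nonneg: "n > 0 \<Longrightarrow> bin n (int c) = (- 1) ^ (n - 1) * of_nat ((c + n - 1) choose (n - 1))"
  unfolding bin_def binomial_gbinomial
  by (subst gbinomial_negated_upper) (simp add: of_nat_diff algebra_simps)

lemma cst_cancel: "c \<noteq> 0 \<Longrightarrow> cst c * u = 0 \<Longrightarrow> u = 0"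
  by (metis cst_mult_cancel left_inverse mult_zero_right)

lemma Sm_p0: "N \<noteq> 0 \<Longrightarrow> Sm 0 N = 0"
  using Sm_rec[of N 0] cst_cancel[of "of_int N" "Sm 0 N"] by simp

lemma vop_0: "vop k 0 q u = (if q = -1 then u else 0)"
proof (rule lin_eqI_X[of "vop k 0 q" "\<lambda>u. if q = -1 then u else 0"])
  show "vop k 0 q (ee m) = (if q = - 1 then ee m else 0)" for m
    by (simp add: vop_ee Sm_p0)
qed (simp_all add: lin_vop vop_X)

text \<open>A field with a single nonzero mode, which is a scalar. The vacuum field has this form,
  and so has the commutator of a Heisenberg field with \<open>X c\<close>.\<close>

definition dfield :: "complex \<Rightarrow> int \<Rightarrow> int \<Rightarrow> vec \<Rightarrow> vec" where
  "dfield a r q u = (if q = r then cst a * u else 0)"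

lemma fld_dfield: "fld (dfield a r)"
proof -
  have "lin (dfield a r q)" for q
    by (cases "q = r") (simp_all add: dfield_def[abs_def])
  moreover have "\<forall>q\<ge>r + 1. dfield a r q u = 0" for u by (simp add: dfield_def)
  ultimately show ?thesis unfolding fld_def by blast
qed

lemma nop_dfield: "nop k n (dfield a r) q u = cst (a * bin n (q - r - int n)) * heis k (q - r - int n) u"
proof -
  have "nop k n (dfield a r) q u = (\<Sum>j\<in>{q - r - int n}. nop_term k n (dfield a r) q u j)"
    by (rule nop_eqI) (auto simp: nop_term_def dfield_def lin_0[OF lin_heis])
  then show ?thesis
    by (simp add: nop_term_def dfield_def lin_cst[OF lin_heis] cst_mult mult.left_commute mult.assoc)
qed

lemma vop_0_dfield: "vop k 0 = dfield 1 (-1)"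
  by (simp add: fun_eq_iff vop_0 dfield_def)

lemma Yl_single: "Yl k [n] 0 q u = cst (bin n (q + 1 - int n)) * heis k (q + 1 - int n) u"
  by (simp add: Yl_Cons Yl_Nil vop_0_dfield nop_dfield)

lemma Yl_single_X:
  "Yl k [n] 0 q (X c * u) = X c * Yl k [n] 0 q u + dfield (of_nat (2 * k * c) * bin n (int c)) (int c + int n - 1) q u"
proof -
  have "q + 1 - int n = int c \<longleftrightarrow> q = int c + int n - 1" by auto
  then show ?thesis
    by (simp add: Yl_single heis_X dfield_def distrib_left cst_mult mult.left_commute mult.assoc del: of_nat_mult)
qed

lemma Yl_pair_X:
  "Yl k [m, n] 0 q (X c * u) = X c * Yl k [m, n] 0 q u
    + cst (of_nat (2 * k * c) * (bin n (int c) * bin m (q + 1 - int m - int n - int c)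
              + bin m (int c) * bin n (q + 1 - int m - int n - int c)))
      * heis k (q + 1 - int m - int n - int c) u"
proof -
  have "Yl k [m, n] 0 q (X c * u) = X c * Yl k [m, n] 0 q u
      + nop k m (dfield (of_nat (2 * k * c) * bin n (int c)) (int c + int n - 1)) q u
      + cst (of_nat (2 * k * c) * bin m (int c)) * Yl k [n] 0 (q - int c - int m) u"
    unfolding Yl_Cons[of k m "[n]"] by (rule nop_X[OF fld_Yl fld_dfield Yl_single_X])
  then show ?thesis
    by (simp add: nop_dfield Yl_single cst_add cst_mult algebra_simps del: of_nat_mult)
qed

text \<open>\<open>qco d m n c\<close> collects the binomial coefficients of the term of \<open>(x\<^sub>m x\<^sub>n)\<^sub>-\<^sub>1\<^sub>-\<^sub>d\<close> that
  contracts \<open>x\<^sub>c\<close>; the value at \<open>c = 0\<close> belongs to \<open>\<alpha>(0)\<close>.\<close>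

definition qco :: "nat \<Rightarrow> nat \<Rightarrow> nat \<Rightarrow> nat \<Rightarrow> int" where
  "qco d m n c = (-1) ^ (n - 1) * int ((c + n - 1) choose (n - 1)) * int ((m + n + c + d - 1) choose (m - 1))
               + (-1) ^ (m - 1) * int ((c + m - 1) choose (m - 1)) * int ((m + n + c + d - 1) choose (n - 1))"

lemma bin_qco:
  assumes "m > 0" "n > 0"
  shows "bin n (int c) * bin m (- int (m + n + c + d)) + bin m (int c) * bin n (- int (m + n + c + d))
    = of_int (qco d m n c)"
  using assms by (simp only: bin_neg bin_nonneg qco_def) (simp add: bin_neg bin_nonneg)

lemma Yl_pair_neg_X:
  assumes "m > 0" "n > 0"
  shows "Yl k [m, n] 0 (- 1 - int d) (X c * u) = X c * Yl k [m, n] 0 (- 1 - int d) u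
    + of_int (2 * int k * int c * qco d m n c) * (X (m + n + c + d) * u)"
proof -
  have e: "- 1 - int d + 1 - int m - int n - int c = - int (m + n + c + d)" by simp
  have "heis k (- int (m + n + c + d)) u = X (m + n + c + d) * u"
    by (rule heis_neg) (use assms in simp)
  then show ?thesis unfolding Yl_pair_X e bin_qco[OF assms]
    by (simp add: cst_mult)
qed

text \<open>On \<open>ee p\<close> the binomials kill every pair of creation modes except those with
  m <= i <= m + d; \<open>A\<close> lists the indices where the product of binomials survives. The
  two extreme indices of the sum meet alpha(0) and give the term with
  \<open>qco d m n 0\<close>.\<close>

lemma Yl_pair_ee:
  assumes "m > 0" "n > 0" "finite A" "A \<subseteq> {m..m + d}"
    "\<And>i. m \<le> i \<Longrightarrow> i \<le> m + d \<Longrightarrow> i \<notin> A \<Longrightarrow> bin m (- int i) * bin n (- int (m + n + d - i)) = 0"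
  shows "Yl k [m, n] 0 (- 1 - int d) (ee p) =
    (\<Sum>i\<in>A. cst (bin m (- int i) * bin n (- int (m + n + d - i))) * (X i * (X (m + n + d - i) * ee p)))
    + of_int (2 * int k * p * qco d m n 0) * (X (m + n + d) * ee p)"
proof -
  let ?A = "{m..m + d}"
  let ?I = "(\<lambda>i. - int i) ` ?A"
  let ?B = "{0, - int (m + n + d)} \<union> ?I"
  let ?t = "nop_term k m (Yl k [n] 0) (- 1 - int d) (ee p)"
  let ?g = "\<lambda>i. cst (bin m (- int i) * bin n (- int (m + n + d - i))) * (X i * (X (m + n + d - i) * ee p))"
  have t0: "?t j = 0" if "j \<notin> ?B" for j
  proof -
    consider "j > 0" | "j < 0" "- j < int m" | "- j > int (m + d)" "- j < int (m + n + d)" | "- j > int (m + n + d)"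
    proof -
      have "- j < int m \<or> - j > int (m + d)" if "j < 0"
      proof (rule ccontr)
        assume "\<not> ?thesis"
        then have "j \<in> ?I" using that by (intro image_eqI[of _ _ "nat (- j)"]) auto
        then show False using \<open>j \<notin> ?B\<close> by simp
      qed
      then show thesis using that \<open>j \<notin> ?B\<close> by force
    qed
    then show ?thesis
    proof cases
      case 1 then show ?thesis by (simp add: nop_term_def heis_pos_ee lin_0[OF lin_Yl])
    next
      case 2
      then have "bin m j = 0" using bin_neg[of "nat (- j)" m] by (simp add: binomial_eq_0)
      then show ?thesis by (simp add: nop_term_def)
    next
      case 3
      then have "bin n (- int (nat (j + int (m + n + d)))) = 0"
        by (subst bin_neg) (auto simp: binomial_eq_0)
      moreover have "- int (nat (j + int (m + n + d))) = - 1 - int d - j - int m + 1 - int n"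
        using 3 by simp
      ultimately have "Yl k [n] 0 (- 1 - int d - j - int m) u = 0" for u
        by (simp only: Yl_single) simp
      then show ?thesis by (simp only: nop_term_def lin_0[OF lin_heis]) simp
    next
      case 4 then show ?thesis by (simp add: nop_term_def Yl_single heis_pos_ee lin_0[OF lin_heis] lin_0[OF lin_Yl])
    qed
  qed
  have ti: "?t (- int i) = ?g i" if "i \<in> ?A" for i
  proof -
    have l: "- 1 - int d - (- int i) - int m + 1 - int n = - int (m + n + d - i)" using that by auto
    have "?t (- int i) = cst (bin m (- int i)) * heis k (- int i) (cst (bin n (- int (m + n + d - i))) *
        heis k (- int (m + n + d - i)) (ee p))"
      using that assms(1) by (simp only: nop_term_def Yl_single l) simp
    also have "\<dots> = ?g i"
    proof -
      have "i > 0" "m + n + d - i > 0" using that assms by auto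
      then show ?thesis by (simp only: heis_neg cst_mult mult.left_commute mult.assoc)
    qed
    finally show ?thesis .
  qed
  have "heis k (- int (m + n + d)) u = X (m + n + d) * u" for u
    by (rule heis_neg) (use assms in simp)
  note heis_neg' = this
  have tz: "?t 0 = cst (bin n (- int (m + n + d)) * bin m 0) * (of_int (2 * int k * p) * (X (m + n + d) * ee p))"
  proof -
    have l: "- 1 - int d - 0 - int m + 1 - int n = - int (m + n + d)" by simp
    have "?t 0 = cst (bin m 0) * (cst (bin n (- int (m + n + d))) * heis k (- int (m + n + d)) (heis k 0 (ee p)))"
      by (simp only: nop_term_def Yl_single l) simp
    then show ?thesis by (simp only: heis_neg' heis_0_ee cst_mult mult.left_commute mult.assoc)
  qed
  have tl: "?t (- int (m + n + d)) = cst (bin m (- int (m + n + d)) * bin n 0) * (of_int (2 * int k * p) * (X (m + n + d) * ee p))"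
  proof -
    have l: "- 1 - int d - (- int (m + n + d)) - int m + 1 - int n = 0" by simp
    have "?t (- int (m + n + d)) = cst (bin m (- int (m + n + d))) * heis k (- int (m + n + d)) (cst (bin n 0) * heis k 0 (ee p))"
      using assms(1) by (simp only: nop_term_def Yl_single l) simp
    then show ?thesis by (simp only: heis_neg' heis_0_ee cst_mult mult.left_commute mult.assoc)
  qed
  have "Yl k [m, n] 0 (- 1 - int d) (ee p) = (\<Sum>j\<in>?B. ?t j)"
    unfolding Yl_Cons[of k m] by (intro nop_eqI t0) auto
  also have "\<dots> = (\<Sum>j\<in>{0, - int (m + n + d)}. ?t j) + (\<Sum>j\<in>?I. ?t j)"
    by (rule sum.union_disjoint) (use assms in auto)
  also have "(\<Sum>j\<in>?I. ?t j) = (\<Sum>i\<in>?A. ?g i)"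
    by (subst sum.reindex) (auto simp: inj_on_def ti simp del: of_nat_add)
  also have "\<dots> = (\<Sum>i\<in>A. ?g i)"
  proof (rule sum.mono_neutral_right)
    show "\<forall>i\<in>?A - A. ?g i = 0"
    proof
      fix i assume "i \<in> ?A - A"
      then have "bin m (- int i) * bin n (- int (m + n + d - i)) = 0" by (intro assms(5)) auto
      then show "?g i = 0" by (simp only: cst_0 mult_zero_left)
    qed
  qed (use assms in auto)
  also have "(\<Sum>j\<in>{0, - int (m + n + d)}. ?t j) = ?t 0 + ?t (- int (m + n + d))"
    using assms by simp
  also have "\<dots> = of_int (2 * int k * p * qco d m n 0) * (X (m + n + d) * ee p)"
  proof -
    have "of_int (qco d m n 0) = cst (bin n (- int (m + n + d)) * bin m 0) + cst (bin m (- int (m + n + d)) * bin n 0)"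
      using bin_qco[OF assms(1,2), of 0 d] by (simp flip: cst_add cst_of_int add: mult.commute add.commute)
    then show ?thesis unfolding tz tl by (simp add: algebra_simps)
  qed
  finally show ?thesis by (simp only: add.commute)
qed

text \<open>\<open>Pop k 1 1\<close> is 4k L(-2), while \<open>Qop\<close> maps fixed vectors into
  C_2: the first family produces the generators, the second the relations.\<close>

abbreviation "Pop k m n \<equiv> Yl k [m, n] 0 (- 1)"
abbreviation "Qop k m n \<equiv> Yl k [m, n] 0 (- 2)"

lemma Pop_ee:
  assumes "m > 0" "n > 0"
  shows "Pop k m n (ee p) = X m * (X n * ee p) + of_int (2 * int k * p * qco 0 m n 0) * (X (m + n) * ee p)"
  using Yl_pair_ee[OF assms, of "{m}" 0 k p] assms by (simp add: bin_neg)

lemma Qop_ee: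
  assumes "m > 0" "n > 0"
  shows "Qop k m n (ee p) = of_nat m * (X (m + 1) * (X n * ee p)) + of_nat n * (X m * (X (n + 1) * ee p))
    + of_int (2 * int k * p * qco 1 m n 0) * (X (m + n + 1) * ee p)"
proof -
  have "int (Suc (m + n) - Suc m) = int n" "int (Suc (m + n) - m) = int (n + 1)" by auto
  moreover have "Suc (m + n) - m = n + 1" by simp
  moreover have "of_nat (m choose (m - Suc 0)) = (of_nat m :: complex)" "of_nat (n choose (n - Suc 0)) = (of_nat n :: complex)"
    using assms by (metis One_nat_def Suc_leI Suc_pred binomial_Suc_n)+
  ultimately show ?thesis
  using Yl_pair_ee[OF assms, of "{m, m + 1}" 1 k p] assms bin_neg[of "m + 1" m] bin_neg[of "n + 1" n] bin_neg[of n n] bin_neg[of m m]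
    by (simp add: add.commute)
qed

lemma Pop_X:
  assumes "m > 0" "n > 0"
  shows "Pop k m n (X c * u) = X c * Pop k m n u + of_int (2 * int k * int c * qco 0 m n c) * (X (m + n + c) * u)"
  using Yl_pair_neg_X[OF assms, of k 0 c u] by simp

lemma Qop_X:
  assumes "m > 0" "n > 0"
  shows "Qop k m n (X c * u) = X c * Qop k m n u + of_int (2 * int k * int c * qco 1 m n c) * (X (m + n + c + 1) * u)"
  using Yl_pair_neg_X[OF assms, of k 1 c u] by simp

lemma theta_Pop:
  assumes "m > 0" "n > 0"
  shows "theta (Pop k m n u) = Pop k m n (theta u)"
proof (rule lin_eqI_X[of "\<lambda>u. theta (Pop k m n u)"])
qed (auto intro!: lin_comp[OF lin_theta] lin_comp[OF lin_Yl] simp: lin_theta lin_Yl Pop_ee Pop_X assms linD[OF lin_Yl]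
    simp del: of_int_mult)

lemma theta_Qop:
  assumes "m > 0" "n > 0"
  shows "theta (Qop k m n u) = Qop k m n (theta u)"
proof (rule lin_eqI_X[of "\<lambda>u. theta (Qop k m n u)"])
qed (auto intro!: lin_comp[OF lin_theta] lin_comp[OF lin_Yl] simp: lin_theta lin_Yl Qop_ee Qop_X assms linD[OF lin_Yl]
    simp del: of_int_mult)

section \<open>Subspaces, spans and C_2\<close>

interpretation vec: vector_space smul
  by unfold_locales (simp_all add: smul_eq cst_add cst_mult algebra_simps)

lemma cspan_eq: "cspan A = vec.span A"
  by (auto simp: cspan_def vec.span_explicit)

definition csub :: "vec set \<Rightarrow> bool" where
  "csub U \<longleftrightarrow> 0 \<in> U \<and> (\<forall>u\<in>U. \<forall>v\<in>U. u + v \<in> U) \<and> (\<forall>c. \<forall>u\<in>U. cst c * u \<in> U)"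

lemma csubD: assumes "csub U"
  shows csub_0: "0 \<in> U" and csub_add: "u \<in> U \<Longrightarrow> v \<in> U \<Longrightarrow> u + v \<in> U"
    and csub_cst: "u \<in> U \<Longrightarrow> cst c * u \<in> U"
    and csub_of_nat: "u \<in> U \<Longrightarrow> of_nat n * u \<in> U"
    and csub_of_int: "u \<in> U \<Longrightarrow> of_int i * u \<in> U"
    and csub_numeral: "u \<in> U \<Longrightarrow> numeral w * u \<in> U"
    and csub_minus: "u \<in> U \<Longrightarrow> - u \<in> U"
    and csub_diff: "u \<in> U \<Longrightarrow> v \<in> U \<Longrightarrow> u - v \<in> U"
proof -
  show 1: "0 \<in> U" "u \<in> U \<Longrightarrow> v \<in> U \<Longrightarrow> u + v \<in> U" "u \<in> U \<Longrightarrow> cst c * u \<in> U" for u v c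
    using assms by (auto simp: csub_def)
  show "u \<in> U \<Longrightarrow> of_nat n * u \<in> U" "u \<in> U \<Longrightarrow> of_int i * u \<in> U" "u \<in> U \<Longrightarrow> numeral w * u \<in> U"
    using 1(3)[of u "of_nat n"] 1(3)[of u "of_int i"] 1(3)[of u "numeral w"] by simp_all
  show 2: "u \<in> U \<Longrightarrow> - u \<in> U" for u
    using 1(3)[of u "-1"] by (simp add: cst_minus)
  show "u \<in> U \<Longrightarrow> v \<in> U \<Longrightarrow> u - v \<in> U"
    using 1(2)[of u "- v"] 2[of v] by simp
qed

lemma csub_diff_iff: "csub U \<Longrightarrow> v \<in> U \<Longrightarrow> u - v \<in> U \<longleftrightarrow> u \<in> U"
  using csub_add[of U "u - v" v] csub_diff[of U u v] by auto

lemma csub_cst_iff: "csub U \<Longrightarrow> c \<noteq> 0 \<Longrightarrow> cst c * u \<in> U \<longleftrightarrow> u \<in> U"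
  by (metis csub_cst cst_mult_cancel left_inverse)

lemma csub_sum: "csub U \<Longrightarrow> (\<And>x. x \<in> A \<Longrightarrow> f x \<in> U) \<Longrightarrow> sum f A \<in> U"
  by (induction A rule: infinite_finite_induct) (auto simp: csub_0 csub_add)

lemma csub_span: "csub (vec.span A)"
  using vec.span_zero vec.span_add vec.span_scale by (auto simp: csub_def smul_eq[symmetric])

lemma csub_C2: "csub (C2 k)"
  by (simp add: C2_def cspan_eq csub_span)

lemma csub_VL: "csub VL"
  by (simp add: csub_def VL_add VL_cst_mult)

lemma csub_plus:
  assumes "csub U" "csub W" shows "csub {u + v | u v. u \<in> W \<and> v \<in> U}"
  unfolding csub_def
proof (intro conjI ballI allI)
  let ?Z = "{u + v |u v. u \<in> W \<and> v \<in> U}"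
  have I: "u + v \<in> ?Z" if "u \<in> W" "v \<in> U" for u v using that by blast
  show "0 \<in> ?Z" using I[OF csub_0[OF assms(2)] csub_0[OF assms(1)]] by simp
  fix x assume "x \<in> ?Z"
  then obtain u v where x: "x = u + v" "u \<in> W" "v \<in> U" by blast
  show "cst c * x \<in> ?Z" for c
    unfolding x(1) distrib_left by (intro I csub_cst assms x)
  fix y assume "y \<in> ?Z"
  then obtain u' v' where y: "y = u' + v'" "u' \<in> W" "v' \<in> U" by blast
  have "x + y = (u + u') + (v + v')" by (simp add: x y)
  then show "x + y \<in> ?Z"
    using I csub_add[OF assms(2) x(2) y(2)] csub_add[OF assms(1) x(3) y(3)] by simp
qed

lemma lin_mode: "lin (\<lambda>v. mode k v q u)"
proof -
  have "(\<lambda>v. mode k v q u) = lext (\<lambda>b. Yl k (sorted_list_of_multiset (fst b)) (snd b) q u)"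
    by (simp add: fun_eq_iff mode_def lext_def)
  then show ?thesis by (simp add: lin_lext)
qed

lemma mode_bvec: "mode k (bvec (a, p)) q u = Yl k (sorted_list_of_multiset a) p q u"
  by (simp add: mode_def bvec_def smul_eq)

lemma lin_mode_right: "lin (mode k v q)"
  unfolding lin_def by (simp add: mode_def smul_eq linD[OF lin_Yl] distrib_left sum.distrib sum_distrib_left mult.left_commute)

lemma mode_C2: "u \<in> VLplus \<Longrightarrow> v \<in> VLplus \<Longrightarrow> mode k v (- 2) u \<in> C2 k"
  unfolding C2_def cspan_eq by (rule vec.span_base, rule CollectI, intro exI conjI) (rule refl)

text \<open>Symmetrizing by \<open>\<theta>\<close> lets all computations take place in \<open>V\<^sub>L\<close> itself.\<close>

definition symC2 :: "nat \<Rightarrow> vec set" where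
  "symC2 k = {v. v + theta v \<in> C2 k}"

lemma csub_symC2: "csub (symC2 k)"
  unfolding csub_def symC2_def
proof (intro conjI ballI allI CollectI)
  show "0 + theta 0 \<in> C2 k" by (simp add: csub_0[OF csub_C2])
  fix u assume u: "u \<in> {v. v + theta v \<in> C2 k}"
  show "cst c * u + theta (cst c * u) \<in> C2 k" for c
    using csub_cst[OF csub_C2, of "u + theta u" k c] u by (simp add: distrib_left)
  fix v assume v: "v \<in> {v. v + theta v \<in> C2 k}"
  have "(u + v) + theta (u + v) = (u + theta u) + (v + theta v)" by simp
  then show "(u + v) + theta (u + v) \<in> C2 k"
    using csub_add[OF csub_C2, of "u + theta u" k "v + theta v"] u v by (simp only: mem_Collect_eq)
qed

lemma symC2_fixed: assumes "theta v = v" shows "v \<in> symC2 k \<longleftrightarrow> v \<in> C2 k"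
proof -
  have "v + theta v = cst 2 * v" by (simp only: assms cst_numeral mult_2)
  then show ?thesis
    unfolding symC2_def mem_Collect_eq by (metis csub_C2 csub_cst_iff zero_neq_numeral)
qed

lemma symC2_anti: "theta v = - v \<Longrightarrow> v \<in> symC2 k"
  by (simp add: symC2_def csub_0[OF csub_C2])

text \<open>The symmetrization of such a monomial is zero, so odd length costs nothing in charge
  0.\<close>

lemma symC2_odd: "odd (size a) \<Longrightarrow> bvec (a, 0) \<in> symC2 k"
  by (rule symC2_anti) (simp add: theta_bvec cst_minus)

text \<open>The order \<open>m \<le> n\<close> is required because \<open>mode\<close> reads a
  multiset through its sorted list, here \<open>[m, n]\<close>.\<close>

lemma Qop_symC2:
  assumes "0 < m" "m \<le> n" "f \<in> VL"
  shows "Qop k m n f \<in> symC2 k"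
proof -
  have "bvec ({#m, n#}, 0) \<in> VLplus" using assms by (simp add: VLplus_def theta_bvec)
  from mode_C2[OF VLplus_theta[OF assms(3)] this, of k]
  have "Qop k m n (f + theta f) \<in> C2 k"
    using assms by (simp add: mode_bvec sorted_list_of_multiset_insert)
  then show ?thesis
    using assms by (simp add: symC2_def theta_Qop linD[OF lin_Yl])
qed

subsection \<open>Translation\<close>

text \<open>L(-1), as the derivation with x_n -> n x_(n+1) and e^(m alpha) -> m x_1 e^(m alpha). It
  is defined combinatorially here and identified with v -> v_(-2) 1 in
  \<open>mode_vac\<close>.\<close>

definition tder :: "vec \<Rightarrow> vec" where
  "tder = lext (\<lambda>(a, m). (\<Sum>n\<in>#a. of_nat n * bvec (add_mset (n + 1) (a - {#n#}), m)) + of_int m * bvec (add_mset 1 a, m))"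

lemma lin_tder: "lin tder"
  unfolding tder_def by (rule lin_lext)

lemma tder_ee: "tder (ee m) = of_int m * (X 1 * ee m)"
  by (simp add: tder_def ee_def bvec_add_mset)

lemma tder_X: "tder (X n * u) = X n * tder u + of_nat n * (X (n + 1) * u)"
proof (rule lin_eqI[of "\<lambda>u. tder (X n * u)"])
  fix a m
  let ?f = "\<lambda>a x. of_nat x * bvec (add_mset (x + 1) (a - {#x#}), m)"
  have *: "X n * ?f a x = ?f (add_mset n a) x" if "x \<in># a" for x
  proof -
    have "add_mset n a - {#x#} = add_mset n (a - {#x#})" using that by (simp add: multiset_eq_iff)
    then show ?thesis by (simp add: bvec_add_mset algebra_simps)
  qed
  have "image_mset (\<lambda>x. X n * ?f a x) a = image_mset (?f (add_mset n a)) a"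
    by (rule image_mset_cong) (rule *)
  then have "X n * (\<Sum>x\<in>#a. ?f a x) = (\<Sum>x\<in>#a. ?f (add_mset n a) x)"
    by (simp only: sum_mset_distrib_left)
  then show "tder (X n * bvec (a, m)) = X n * tder (bvec (a, m)) + of_nat n * (X (n + 1) * bvec (a, m))"
    by (simp add: tder_def bvec_add_mset[symmetric, of n]) (simp add: distrib_left bvec_add_mset mult.left_commute)
qed (auto intro!: lin_comp[OF lin_tder] lin_plus lin_mult simp: lin_tder)

lemma theta_tder: "theta (tder u) = tder (theta u)"
  by (rule lin_eqI_X[of "\<lambda>u. theta (tder u)"])
     (auto intro!: lin_comp[OF lin_tder lin_theta] lin_comp[OF lin_theta lin_tder] simp: tder_ee tder_X linD[OF lin_tder])

lemma heis_nonneg_1: "j \<ge> 0 \<Longrightarrow> heis k j 1 = 0"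
  using heis_0_ee[of k 0] heis_pos_ee[of j k 0] by (cases "j = 0") auto

text \<open>The creation property. The three claims are proved together: for a longer product the
  mode -2 involves the modes -1 and -2 of the shorter one and the vanishing of its nonnegative
  modes.\<close>

lemma Yl_1_aux:
  assumes "0 \<notin> set ns"
  shows "(\<forall>q\<ge>0. Yl k ns p q 1 = 0) \<and> Yl k ns p (- 1) 1 = bvec (mset ns, p)
    \<and> Yl k ns p (- 2) 1 = tder (bvec (mset ns, p))"
  using assms
proof (induction ns)
  case Nil
  have e: "vop k p q 1 = Sm p (- q - 1) * ee p" for q
    using vop_ee[of k p q 0] by simp
  show ?case by (simp add: Yl_Nil e Sm_neg bvec_empty Sm_1 tder_ee mult.assoc)
next
  case (Cons n ns)
  let ?F = "Yl k ns p"
  have n: "n > 0" and ns: "0 \<notin> set ns" using Cons.prems by auto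
  have IH: "q \<ge> 0 \<Longrightarrow> ?F q 1 = 0" "?F (- 1) 1 = bvec (mset ns, p)" "?F (- 2) 1 = tder (bvec (mset ns, p))" for q
    using Cons.IH[OF ns] by auto
  have t: "nop_term k n ?F q 1 j = (if j < 0 then cst (bin n j) * (X (nat (- j)) * ?F (q - j - int n) 1) else 0)" for q j
    by (simp add: nop_term_def heis_nonneg_1 heis_less lin_0[OF lin_Yl])
  have b: "bin n j = 0" if "j < 0" "- j < int n" for j
    using bin_neg[of "nat (- j)" n] that by (simp add: binomial_eq_0)
  have z: "nop_term k n ?F q 1 j = 0" if "j \<ge> 0 \<or> - j < int n \<or> q - j - int n \<ge> 0" for q j
    using that b[of j] IH(1) by (auto simp: t)
  have bn: "bin n (- int n) = 1" "bin n (- int (n + 1)) = of_nat n"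
    using n by (simp_all only: bin_neg) (simp_all, metis One_nat_def Suc_pred binomial_Suc_n)
  have 1: "nop k n ?F q 1 = 0" if "q \<ge> 0" for q
  proof -
    have "nop k n ?F q 1 = (\<Sum>j\<in>{}. nop_term k n ?F q 1 j)"
      by (rule nop_eqI, simp, rule z) (use that in linarith)
    then show ?thesis by simp
  qed
  have 2: "nop k n ?F (- 1) 1 = X n * bvec (mset ns, p)"
  proof -
    have "nop k n ?F (- 1) 1 = (\<Sum>j\<in>{- int n}. nop_term k n ?F (- 1) 1 j)"
      by (rule nop_eqI, simp, rule z, simp) arith
    then show ?thesis using IH(2) n bn by (simp add: t)
  qed
  have 3: "nop k n ?F (- 2) 1 = X n * tder (bvec (mset ns, p)) + of_nat n * (X (n + 1) * bvec (mset ns, p))"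
  proof -
    have "nop k n ?F (- 2) 1 = (\<Sum>j\<in>{- int n, - int (n + 1)}. nop_term k n ?F (- 2) 1 j)"
      by (rule nop_eqI, simp, rule z, simp) arith
    also have "\<dots> = nop_term k n ?F (- 2) 1 (- int n) + nop_term k n ?F (- 2) 1 (- int (n + 1))" by simp
    also have "nop_term k n ?F (- 2) 1 (- int n) = X n * tder (bvec (mset ns, p))"
      using IH(3) n bn(1) by (simp add: t)
    also have "nop_term k n ?F (- 2) 1 (- int (n + 1)) = of_nat n * (X (n + 1) * bvec (mset ns, p))"
    proof -
      have "- 2 - (- int (n + 1)) - int n = - 1" "nat (- (- int (n + 1))) = n + 1" "- int (n + 1) < 0" by auto
      then show ?thesis using IH(2) bn(2) by (simp only: t if_True) simp
    qed
    finally show ?thesis .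
  qed
  show ?case using 1 2 3 by (simp add: Yl_Cons bvec_add_mset tder_X)
qed

lemma Yl_1:
  assumes "0 \<notin> set ns"
  shows "Yl k ns p (- 1) 1 = bvec (mset ns, p)"
    and "Yl k ns p (- 2) 1 = tder (bvec (mset ns, p))"
  using Yl_1_aux[OF assms] by auto

lemma vac_eq: "vac = 1"
  by (simp add: vac_def bvec_empty)

lemma one_VLplus: "1 \<in> VLplus"
proof -
  have "ee 0 \<in> VLplus" by (simp only: VLplus_def mem_Collect_eq VL_ee theta_ee) simp
  then show ?thesis by simp
qed

lemma mode_vac: "v \<in> VL \<Longrightarrow> mode k v (- 2) 1 = tder v"
proof (induction rule: VL_induct)
  case (bvec a m)
  then show ?case by (simp add: mode_bvec Yl_1(2))
qed (simp_all add: linD[OF lin_mode] linD[OF lin_tder])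

lemma tder_symC2: assumes "f \<in> VL" shows "tder f \<in> symC2 k"
proof -
  have "mode k (f + theta f) (- 2) 1 \<in> C2 k"
    by (rule mode_C2[OF one_VLplus VLplus_theta[OF assms]])
  then show ?thesis
    using assms by (simp add: mode_vac VL_add VL_theta symC2_def theta_tder linD[OF lin_tder])
qed

subsection \<open>Reduction modulo \<open>C\<^sub>2\<close>\<close>

text \<open>In inductions on a monomial the target subspace is left arbitrary: a factor
  \<open>X c\<close> is moved from the vector into the subspace by pulling back along
  multiplication.\<close>

lemma csub_vimage_X: "csub U \<Longrightarrow> csub {v. X c * v \<in> U}"
  by (auto simp: csub_def distrib_left) (metis mult.left_commute)

text \<open>Without contractions (x_m x_n)_(-2) multiplies by two factors. Each contraction merges
  x_m, x_n with a factor of the monomial or with alpha(0), which loses at least one unit of length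
  at the same weight.\<close>

lemma Qop_lead:
  assumes "m > 0" "n > 0" "csub U" "0 \<notin># a"
    "\<And>b. 0 \<notin># b \<Longrightarrow> sum_mset b = sum_mset a + m + n + 1 \<Longrightarrow> size b \<le> size a + 1 \<Longrightarrow> bvec (b, p) \<in> U"
  shows "Qop k m n (bvec (a, p)) -
    (of_nat m * bvec (add_mset (m + 1) (add_mset n a), p) + of_nat n * bvec (add_mset m (add_mset (n + 1) a), p)) \<in> U"
  using assms(3-)
proof (induction a arbitrary: U)
  case empty
  have "X (m + n + 1) * ee p \<in> U"
    using empty(3)[of "{#m + n + 1#}"] by (simp add: bvec_add_mset bvec_empty)
  then have "of_int (2 * int k * p * qco 1 m n 0) * (X (m + n + 1) * ee p) \<in> U"
    by (rule csub_of_int[OF empty(1)])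
  moreover have "Qop k m n (bvec ({#}, p)) -
    (of_nat m * bvec (add_mset (m + 1) (add_mset n {#}), p) + of_nat n * bvec (add_mset m (add_mset (n + 1) {#}), p))
     = of_int (2 * int k * p * qco 1 m n 0) * (X (m + n + 1) * ee p)"
    unfolding bvec_add_mset bvec_empty Qop_ee[OF assms(1,2)] by simp
  ultimately show ?case by simp
next
  case (add c a)
  have c: "c > 0" "0 \<notin># a" using add.prems(2) by auto
  let ?d = "\<lambda>a. Qop k m n (bvec (a, p)) -
    (of_nat m * bvec (add_mset (m + 1) (add_mset n a), p) + of_nat n * bvec (add_mset m (add_mset (n + 1) a), p))"
  have "?d a \<in> {v. X c * v \<in> U}"
  proof (rule add.IH[OF csub_vimage_X[OF add.prems(1)] c(2)])
    fix b :: "nat multiset" assume b: "0 \<notin># b" "sum_mset b = sum_mset a + m + n + 1" "size b \<le> size a + 1"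
    then have "bvec (add_mset c b, p) \<in> U"
      using c by (intro add.prems(3)) auto
    then show "bvec (b, p) \<in> {v. X c * v \<in> U}" by (simp add: bvec_add_mset)
  qed
  then have 1: "X c * ?d a \<in> U" by simp
  have "bvec (add_mset (m + n + c + 1) a, p) \<in> U"
    using c by (intro add.prems(3)) auto
  then have 2: "of_int (2 * int k * int c * qco 1 m n c) * (X (m + n + c + 1) * bvec (a, p)) \<in> U"
    unfolding bvec_add_mset by (rule csub_of_int[OF add.prems(1)])
  have "?d (add_mset c a) = X c * ?d a + of_int (2 * int k * int c * qco 1 m n c) * (X (m + n + c + 1) * bvec (a, p))"
    unfolding bvec_add_mset Qop_X[OF assms(1,2)] by (simp add: algebra_simps)
  then show ?case using csub_add[OF add.prems(1) 1 2] by (simp only:)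
qed

text \<open>Only differentiating the exponential lengthens the monomial; the derivation applied to a
  factor keeps the length.\<close>

lemma tder_lead:
  assumes "csub U" "0 \<notin># a"
    "\<And>b. 0 \<notin># b \<Longrightarrow> sum_mset b = sum_mset a + 1 \<Longrightarrow> size b = size a \<Longrightarrow> bvec (b, p) \<in> U"
  shows "tder (bvec (a, p)) - of_int p * bvec (add_mset 1 a, p) \<in> U"
  using assms
proof (induction a arbitrary: U)
  case empty
  then show ?case by (simp add: bvec_add_mset bvec_empty tder_ee csub_0)
next
  case (add c a)
  have c: "c > 0" "0 \<notin># a" using add.prems(2) by auto
  have "tder (bvec (a, p)) - of_int p * bvec (add_mset 1 a, p) \<in> {v. X c * v \<in> U}"
  proof (rule add.IH[OF csub_vimage_X[OF add.prems(1)] c(2)])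
    fix b :: "nat multiset" assume b: "0 \<notin># b" "sum_mset b = sum_mset a + 1" "size b = size a"
    then have "bvec (add_mset c b, p) \<in> U"
      using c by (intro add.prems(3)) auto
    then show "bvec (b, p) \<in> {v. X c * v \<in> U}" by (simp add: bvec_add_mset)
  qed
  then have 1: "X c * (tder (bvec (a, p)) - of_int p * bvec (add_mset 1 a, p)) \<in> U" by simp
  have "bvec (add_mset (c + 1) a, p) \<in> U"
    using c by (intro add.prems(3)) auto
  then have 2: "of_nat c * (X (c + 1) * bvec (a, p)) \<in> U"
    unfolding bvec_add_mset by (rule csub_of_nat[OF add.prems(1)])
  have "tder (bvec (add_mset c a, p)) - of_int p * bvec (add_mset 1 (add_mset c a), p)
     = X c * (tder (bvec (a, p)) - of_int p * bvec (add_mset 1 a, p)) + of_nat c * (X (c + 1) * bvec (a, p))"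
    unfolding bvec_add_mset tder_X by (simp add: algebra_simps)
  then show ?case using csub_add[OF add.prems(1) 1 2] by (simp only:)
qed

text \<open>Bundles what an induction on length provides: \<open>U\<close> contains all relations
  and all shorter monomials of this weight and charge. Congruences between monomials then become
  equivalences of membership in \<open>U\<close>.\<close>

definition absorbing :: "nat \<Rightarrow> int \<Rightarrow> nat \<Rightarrow> nat \<Rightarrow> vec set \<Rightarrow> bool" where
  "absorbing k p W L U \<longleftrightarrow> csub U \<and> symC2 k \<subseteq> U \<and>
     (\<forall>b. 0 \<notin># b \<longrightarrow> sum_mset b = W \<longrightarrow> size b < L \<longrightarrow> bvec (b, p) \<in> U)"

lemma absorbing_rel:
  assumes "absorbing k p (sum_mset a + m + n + 1) (size a + 2) U" "m > 0" "n > 0" "0 \<notin># a"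
  shows "of_nat m * bvec (add_mset (m + 1) (add_mset n a), p) + of_nat n * bvec (add_mset m (add_mset (n + 1) a), p) \<in> U"
proof -
  have U: "csub U" using assms by (simp add: absorbing_def)
  have *: "of_nat m * bvec (add_mset (m + 1) (add_mset n a), p) + of_nat n * bvec (add_mset m (add_mset (n + 1) a), p) \<in> U"
    if "m \<le> n" "m > 0" "n > 0" "absorbing k p (sum_mset a + m + n + 1) (size a + 2) U" for m n
  proof -
    let ?q = "Qop k m n (bvec (a, p))"
    let ?l = "of_nat m * bvec (add_mset (m + 1) (add_mset n a), p) + of_nat n * bvec (add_mset m (add_mset (n + 1) a), p)"
    have "?q - ?l \<in> U"
      using that by (intro Qop_lead U assms(4)) (auto simp: absorbing_def)
    moreover have "?q \<in> U"
      using Qop_symC2[of m n "bvec (a, p)" k] that assms(4) by (auto simp: absorbing_def)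
    ultimately show ?thesis using csub_diff[OF U, of ?q "?q - ?l"] by simp
  qed
  show ?thesis
  proof (cases "m \<le> n")
    case True then show ?thesis using * assms by blast
  next
    case False
    then show ?thesis using *[of n m] assms by (simp add: add_mset_commute add.commute add.left_commute)
  qed
qed

lemma absorbing_shift1:
  assumes "absorbing k p (sum_mset a + m + n + 1) (size a + 2) U" "m > 0" "n > 0" "0 \<notin># a"
  shows "bvec (add_mset (m + 1) (add_mset n a), p) \<in> U \<longleftrightarrow> bvec (add_mset m (add_mset (n + 1) a), p) \<in> U"
proof -
  have U: "csub U" using assms by (simp add: absorbing_def)
  let ?A = "bvec (add_mset (m + 1) (add_mset n a), p)" and ?B = "bvec (add_mset m (add_mset (n + 1) a), p)"
  note rel = absorbing_rel[OF assms]
  have c: "of_nat i * v \<in> U \<longleftrightarrow> v \<in> U" if "i > 0" for i v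
    using csub_cst_iff[OF U, of "of_nat i" v] that by simp
  have "?A \<in> U \<longleftrightarrow> of_nat m * ?A \<in> U" using c[OF assms(2)] by simp
  also have "\<dots> \<longleftrightarrow> of_nat n * ?B \<in> U"
    using csub_diff[OF U rel, of "of_nat m * ?A"] csub_diff[OF U rel, of "of_nat n * ?B"] by auto
  also have "\<dots> \<longleftrightarrow> ?B \<in> U" using c[OF assms(3)] by simp
  finally show ?thesis .
qed

lemma absorbing_shift_1:
  assumes "absorbing k p (sum_mset a + i + j) (size a + 2) U" "i > 0" "j > 0" "0 \<notin># a"
  shows "bvec (add_mset i (add_mset j a), p) \<in> U \<longleftrightarrow> bvec (add_mset 1 (add_mset (i + j - 1) a), p) \<in> U"
  using assms(1-3)
proof (induction i arbitrary: j)
  case (Suc i)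
  show ?case
  proof (cases "i = 0")
    case False
    then have "bvec (add_mset (i + 1) (add_mset j a), p) \<in> U \<longleftrightarrow> bvec (add_mset i (add_mset (j + 1) a), p) \<in> U"
      using Suc.prems assms(4) by (intro absorbing_shift1) (auto simp: ac_simps)
    also have "\<dots> \<longleftrightarrow> bvec (add_mset 1 (add_mset (i + (j + 1) - 1) a), p) \<in> U"
      using Suc.prems False by (intro Suc.IH) (auto simp: ac_simps)
    finally show ?thesis by simp
  qed auto
qed simp

lemma absorbing_shift:
  assumes "absorbing k p (sum_mset a + i + j) (size a + 2) U" "i > 0" "j > 0" "i' > 0" "j' > 0"
    "i' + j' = i + j" "0 \<notin># a"
  shows "bvec (add_mset i (add_mset j a), p) \<in> U \<longleftrightarrow> bvec (add_mset i' (add_mset j' a), p) \<in> U"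
  using absorbing_shift_1[of k p a i j U] absorbing_shift_1[of k p a i' j' U] assms
  by (simp add: add.assoc)

lemma absorbing_odd:
  assumes "absorbing k p (sum_mset a + i + j) (size a + 2) U" "i > 0" "j > 0" "0 \<notin># a" "odd (i + j)"
  shows "bvec (add_mset i (add_mset j a), p) \<in> U"
proof -
  have U: "csub U" using assms by (simp add: absorbing_def)
  obtain m where m: "i + j = 2 * m + 1" using assms(5) by (elim oddE)
  then have "m > 0" using assms(2,3) by linarith
  have "absorbing k p (sum_mset a + m + m + 1) (size a + 2) U" using assms(1) m by (simp add: add.assoc mult_2)
  from absorbing_rel[OF this \<open>m > 0\<close> \<open>m > 0\<close> assms(4)]
  have "cst (of_nat (2 * m)) * bvec (add_mset (m + 1) (add_mset m a), p) \<in> U"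
    by (simp add: add_mset_commute algebra_simps cst_mult)
  then have "bvec (add_mset (m + 1) (add_mset m a), p) \<in> U"
    using csub_cst_iff[OF U, of "of_nat (2 * m)"] \<open>m > 0\<close> by auto
  then show ?thesis
    using absorbing_shift[OF assms(1-3), of "m + 1" m] assms(4) m \<open>m > 0\<close> by simp
qed

text \<open>A pair with odd index sum is absorbed. If all three indices have the same parity, moving
  one unit from i to j creates such a pair; \<open>i > 1\<close> keeps the lowered index
  positive.\<close>

lemma absorbing_triple:
  assumes "absorbing k p (sum_mset a + i + j + l) (size a + 3) U" "i > 1" "j > 0" "l > 0" "0 \<notin># a"
  shows "bvec (add_mset i (add_mset j (add_mset l a)), p) \<in> U"
proof -
  have ab: "absorbing k p (sum_mset (add_mset c a) + x + y) (size (add_mset c a) + 2) U" if "c + x + y = i + j + l" for c x y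
  proof -
    have "sum_mset (add_mset c a) + x + y = sum_mset a + i + j + l" using that by simp
    moreover have "size (add_mset c a) + 2 = size a + 3" by simp
    ultimately show ?thesis using assms(1) by (simp only:)
  qed
  consider "odd (i + j)" | "odd (j + l)" | "even (i + j)" "even (j + l)" by blast
  then show ?thesis
  proof cases
    case 1 then show ?thesis
      using absorbing_odd[OF ab[of l i j]] assms by simp
  next
    case 2
    then have "bvec (add_mset j (add_mset l (add_mset i a)), p) \<in> U"
      using absorbing_odd[OF ab[of i j l]] assms by simp
    then show ?thesis by (simp add: add_mset_commute)
  next
    case 3
    then have "odd ((i - 1) + l)" using assms by presburger
    then have "bvec (add_mset (i - 1) (add_mset l (add_mset (j + 1) a)), p) \<in> U"
      using absorbing_odd[OF ab[of "j + 1" "i - 1" l]] assms by simp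
    then have "bvec (add_mset (i - 1) (add_mset (j + 1) (add_mset l a)), p) \<in> U"
      by (simp add: add_mset_commute)
    then show ?thesis
      using absorbing_shift[OF ab[of l i j], of "i - 1" "j + 1"] assms by simp
  qed
qed

lemma size_ge_3_cases:
  assumes "0 \<notin># a" "size a \<ge> 3" "size a < sum_mset (a :: nat multiset)"
  obtains i j l b where "a = add_mset i (add_mset j (add_mset l b))" "i > 1" "j > 0" "l > 0" "0 \<notin># b"
proof -
  have "\<exists>i\<in>#a. i > 1"
  proof (rule ccontr)
    assume "\<not> ?thesis"
    then have "\<forall>i\<in>#a. i \<le> 1" by auto
    then have "sum_mset a \<le> size a" by (induction a) auto
    then show False using assms(3) by simp
  qed
  then obtain i a' where i: "a = add_mset i a'" "i > 1" by (auto dest: multi_member_split)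
  then obtain j a'' where j: "a' = add_mset j a''" using assms(2) by (cases a') auto
  then obtain l b where l: "a'' = add_mset l b" using assms(2) i by (cases a'') auto
  show thesis using that[of i j l b] i j l assms(1) by auto
qed

lemma size_2_cases:
  assumes "0 \<notin># (a :: nat multiset)" "size a \<ge> 2"
  obtains i j b where "a = add_mset i (add_mset j b)" "i > 0" "j > 0" "0 \<notin># b"
proof -
  obtain i a' where i: "a = add_mset i a'" using assms(2) by (cases a) auto
  then obtain j b where j: "a' = add_mset j b" using assms(2) by (cases a') auto
  have "i > 0" "j > 0" "0 \<notin># b" using assms(1) i j by auto
  then show thesis using that i j by simp
qed

section \<open>Reduction of monomials to one generator per weight\<close>

definition modC2 :: "nat \<Rightarrow> vec set \<Rightarrow> vec set" where
  "modC2 k A = {u + v | u v. u \<in> vec.span A \<and> v \<in> symC2 k}"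

lemma csub_modC2: "csub (modC2 k A)"
  unfolding modC2_def by (intro csub_plus csub_symC2 csub_span)

lemma modC2_base: "x \<in> A \<Longrightarrow> x \<in> modC2 k A"
  unfolding modC2_def using vec.span_base csub_0[OF csub_symC2] by force

lemma symC2_subset_modC2: "symC2 k \<subseteq> modC2 k A"
  unfolding modC2_def using vec.span_zero by force

lemma modC2_subset:
  assumes "A \<subseteq> U" "symC2 k \<subseteq> U" "csub U" shows "modC2 k A \<subseteq> U"
proof -
  have "vec.span A \<subseteq> U"
  proof
    fix x assume "x \<in> vec.span A"
    then show "x \<in> U"
      by (induction rule: vec.span_induct_alt)
         (use assms in \<open>auto simp: csub_0 smul_eq intro!: csub_add csub_cst\<close>)
  qed
  then show ?thesis using assms unfolding modC2_def by (auto intro: csub_add)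
qed

text \<open>Modulo shorter monomials everything of length at least 3 is absorbed, and length 1 is
  odd; so only length 2 survives, and all its monomials are proportional modulo relations.\<close>

lemma charge_0_reduction:
  assumes "0 \<notin># a" "size a < sum_mset a"
  shows "bvec (a, 0) \<in> modC2 k {X 1 * X (sum_mset a - 1)}"
  using assms
proof (induction "size a" arbitrary: a rule: less_induct)
  case less
  let ?U = "modC2 k {X 1 * X (sum_mset a - 1)}"
  have ab: "absorbing k 0 (sum_mset a) (size a) ?U"
  proof -
    have "bvec (b, 0) \<in> ?U" if "0 \<notin># b" "sum_mset b = sum_mset a" "size b < size a" for b
      using less.hyps[of b] that less.prems by simp
    then show ?thesis by (simp add: absorbing_def csub_modC2 symC2_subset_modC2)
  qed
  show ?case
  proof (cases "size a \<ge> 3")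
    case True
    obtain i j l b where *: "a = add_mset i (add_mset j (add_mset l b))" "i > 1" "j > 0" "l > 0" "0 \<notin># b"
      using size_ge_3_cases less.prems True by blast
    show ?thesis unfolding *(1)
      by (rule absorbing_triple[where k = k]) (use * ab in \<open>simp_all add: ac_simps numeral_3_eq_3\<close>)
  next
    case False
    show ?thesis
    proof (cases "size a = 2")
      case True
      then obtain i j b where *: "a = add_mset i (add_mset j b)" "i > 0" "j > 0"
        using size_2_cases less.prems by (metis order_refl)
      then have b: "b = {#}" using True by simp
      have "bvec ({#1, i + j - 1#}, 0) \<in> ?U"
        using * b by (intro modC2_base) (simp add: bvec_add_mset bvec_empty)
      then show ?thesis using absorbing_shift_1[of k 0 "{#}" i j ?U] ab * b by (simp add: add_mset_commute)
    next
      case False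
      moreover have "size a \<noteq> 0" using less.prems by auto
      ultimately have "size a = 1" using \<open>\<not> size a \<ge> 3\<close> by linarith
      then show ?thesis using symC2_odd[of a k] symC2_subset_modC2 by auto
    qed
  qed
qed

lemma charge_1_reduction:
  assumes "0 \<notin># a" "a \<noteq> {#}"
  shows "bvec (a, 1) \<in> modC2 k {X (sum_mset a) * ee 1}"
  using assms
proof (induction "size a" arbitrary: a rule: less_induct)
  case less
  let ?U = "modC2 k {X (sum_mset a) * ee 1}"
  have low: "bvec (b, 1) \<in> ?U" if "0 \<notin># b" "sum_mset b = sum_mset a" "size b < size a" for b
  proof -
    have "sum_mset a \<noteq> 0" using less.prems by (metis size_le_sum_mset le_zero_eq size_eq_0_iff_empty)
    then have "b \<noteq> {#}" using that(2) by auto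
    then show ?thesis using less.hyps[of b] that less.prems by simp
  qed
  then have ab: "absorbing k 1 (sum_mset a) (size a) ?U"
    by (simp add: absorbing_def csub_modC2 symC2_subset_modC2)
  show ?case
  proof (cases "size a \<ge> 2")
    case True
    then obtain i j b where *: "a = add_mset i (add_mset j b)" "i > 0" "j > 0" "0 \<notin># b"
      using size_2_cases less.prems by metis
    \<comment> \<open>The pair i, j can be shifted to 1, i + j - 1, and then x_1 times the rest is
      the leading term of the derivative of the rest.\<close>
    let ?c = "add_mset (i + j - 1) b"
    have "tder (bvec (?c, 1)) - of_int 1 * bvec (add_mset 1 ?c, 1) \<in> ?U"
    proof (rule tder_lead[OF csub_modC2])
      fix d :: "nat multiset" assume "0 \<notin># d" "sum_mset d = sum_mset ?c + 1" "size d = size ?c"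
      then show "bvec (d, 1) \<in> ?U" using * by (intro low) auto
    qed (use * in auto)
    moreover have "tder (bvec (?c, 1)) \<in> ?U"
      using tder_symC2[of "bvec (?c, 1)" k] symC2_subset_modC2 * by auto
    ultimately have "bvec (add_mset 1 ?c, 1) \<in> ?U"
      using csub_diff[OF csub_modC2, of "tder (bvec (?c, 1))"] by fastforce
    then show ?thesis using absorbing_shift_1[of k 1 b i j ?U] ab * by (simp add: ac_simps)
  next
    case False
    moreover have "size a \<noteq> 0" using less.prems by auto
    ultimately have "size a = 1" by linarith
    then obtain x where "a = {#x#}" using size_1_singleton_mset by blast
    then show ?thesis by (intro modC2_base) (simp add: bvec_add_mset bvec_empty)
  qed
qed

text \<open>In charge 0, (x_i x_j)_(-2) 1 has no contraction, so i x_(i+1) x_j = -j x_i x_(j+1)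
  holds modulo relations without error term. Iterating gives the signed binomial, whose exact value
  is needed to compare two reductions.\<close>

lemma quadratic_reduction:
  assumes "i > 0" "j > 0"
  shows "X i * X j - of_int ((- 1) ^ (i - 1) * int ((i + j - 2) choose (i - 1))) * (X 1 * X (i + j - 1)) \<in> symC2 k"
  using assms
proof (induction i arbitrary: j)
  case (Suc i)
  note S = csub_symC2[of k]
  show ?case
  proof (cases "i = 0")
    case True then show ?thesis by (simp add: csub_0[OF S])
  next
    case False
    let ?d = "\<lambda>i j. X i * X j - of_int ((- 1) ^ (i - 1) * int ((i + j - 2) choose (i - 1))) * (X 1 * X (i + j - 1))"
    have "absorbing k 0 (sum_mset {#} + i + j + 1) (size {#} + 2) (symC2 k)"
    proof -
      have "bvec (b, 0) \<in> symC2 k" if "sum_mset b = i + j + 1" "size b < 2" for b :: "nat multiset"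
      proof -
        have "size b \<noteq> 0" using that(1) by auto
        then have "odd (size b)" using that(2) by (cases "size b = 1") auto
        then show ?thesis by (rule symC2_odd)
      qed
      then show ?thesis by (simp add: absorbing_def S)
    qed
    from absorbing_rel[OF this] False Suc.prems
    have rel: "of_nat i * (X (i + 1) * X j) + of_nat j * (X i * X (j + 1)) \<in> symC2 k"
      by (simp add: bvec_add_mset bvec_empty)
    have IH: "?d i (j + 1) \<in> symC2 k" using Suc.IH[of "j + 1"] False Suc.prems by simp
    define N where "N = i + j - 1"
    obtain i' where i': "i = Suc i'" using False by (cases i) auto
    have N: "i' + j = N" "Suc i + j - 2 = N" "i + (j + 1) - 2 = N" "N - i' = j"
      using i' Suc.prems by (auto simp: N_def)
    \<comment> \<open>This is the ratio of consecutive coefficients that the relation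
      demands.\<close>
    have "i * (N choose i) = j * (N choose i')"
      using binomial_absorb_comp[of N i'] binomial_absorption[of i' N] i' N by simp
    then have ch: "int i * int (N choose i) = int j * int (N choose i')"
      by (metis of_nat_mult)
    define \<alpha> \<beta> :: vec where "\<alpha> = of_int ((- 1) ^ (Suc i - 1) * int (N choose i))"
      and "\<beta> = of_int ((- 1) ^ (i - 1) * int (N choose i'))"
    have h: "of_nat i * \<alpha> = - (of_nat j * \<beta>)"
    proof -
      have "of_int ((-1) ^ (Suc i - 1) * (int i * int (N choose i))) = (- of_int ((- 1) ^ (i - 1) * (int j * int (N choose i'))) :: vec)"
        unfolding ch using i' by simp
      then show ?thesis by (simp add: \<alpha>_def \<beta>_def ac_simps)
    qed
    have d: "?d (Suc i) j = X (i + 1) * X j - \<alpha> * (X 1 * X (i + j))" "?d i (j + 1) = X i * X (j + 1) - \<beta> * (X 1 * X (i + j))"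
      using N i' by (simp_all add: \<alpha>_def \<beta>_def)
    have "of_nat i * (P - \<alpha> * Y) = of_nat i * P + of_nat j * Q - of_nat j * (Q - \<beta> * Y)" for P Q Y
      using h by (simp add: right_diff_distrib mult.assoc[symmetric])
    then have "of_nat i * ?d (Suc i) j = (of_nat i * (X (i + 1) * X j) + of_nat j * (X i * X (j + 1))) - of_nat j * ?d i (j + 1)"
      unfolding d by blast
    then have "cst (of_nat i) * ?d (Suc i) j \<in> symC2 k"
      using csub_diff[OF S rel csub_of_nat[OF S IH]] by (simp only: cst_of_nat)
    then show ?thesis using csub_cst_iff[OF S] False by (simp only: of_nat_eq_0_iff not_False_eq_True)
  qed
qed simp

section \<open>Generators that vanish\<close>

lemma Qop_X_idx:
  "m > 0 \<Longrightarrow> n > 0 \<Longrightarrow> r = m + n + c + 1 \<Longrightarrow>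
   Qop k m n (X c * u) = X c * Qop k m n u + of_int (2 * int k * int c * qco 1 m n c) * (X r * u)"
  using Qop_X by simp

text \<open>Like its neighbours, a variant with the resulting indices as variables: instances such
  as \<open>X (c + 3)\<close> are stated in the desired form and the index equations become side
  conditions.\<close>

lemma Qop_ee_idx:
  "m > 0 \<Longrightarrow> n > 0 \<Longrightarrow> m' = m + 1 \<Longrightarrow> n' = n + 1 \<Longrightarrow> r = m + n + 1 \<Longrightarrow>
   Qop k m n (ee p) = of_int (int m) * (X m' * (X n * ee p)) + of_int (int n) * (X m * (X n' * ee p))
    + of_int (2 * int k * p * qco 1 m n 0) * (X r * ee p)"
  using Qop_ee by simp

lemma Qop_1_idx:
  "m > 0 \<Longrightarrow> n > 0 \<Longrightarrow> m' = m + 1 \<Longrightarrow> n' = n + 1 \<Longrightarrow>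
   Qop k m n 1 = of_int (int m) * (X m' * X n) + of_int (int n) * (X m * X n')"
  using Qop_ee[of m n k 0] by simp

lemma tder_X_idx: "r = n + 1 \<Longrightarrow> tder (X n * u) = X n * tder u + of_int (int n) * (X r * u)"
  using tder_X by simp

lemma symC2_of_int_cancel: "c \<noteq> 0 \<Longrightarrow> of_int c * u \<in> symC2 k \<Longrightarrow> u \<in> symC2 k"
  using csub_cst_iff[OF csub_symC2, of "of_int c" u k] by simp

lemma choose_small:
  "2 * int (n + 2 choose 2) = (int n + 1) * (int n + 2)"
  "6 * int (n + 3 choose 3) = (int n + 1) * (int n + 2) * (int n + 3)"
  "120 * int (n + 5 choose 5) = (int n + 1) * (int n + 2) * (int n + 3) * (int n + 4) * (int n + 5)"
proof -
  have s: "int (j + 1) * int (m + 1 choose (j + 1)) = (int m + 1) * int (m choose j)" for m j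
    using arg_cong[OF Suc_times_binomial_eq[of m j], of int] by (simp add: algebra_simps)
  have c: "int (n + 1 choose 1) = int n + 1" by simp
  have 2: "2 * int (n + 2 choose 2) = (int n + 2) * int (n + 1 choose 1)"
    using s[of 1 "n + 1"] by (simp add: numeral_2_eq_2)
  have 3: "3 * int (n + 3 choose 3) = (int n + 3) * int (n + 2 choose 2)"
    using s[of 2 "n + 2"] by (simp add: numeral_3_eq_3 numeral_2_eq_2)
  have 4: "4 * int (n + 4 choose 4) = (int n + 4) * int (n + 3 choose 3)"
    using s[of 3 "n + 3"] by (simp add: eval_nat_numeral)
  have 5: "5 * int (n + 5 choose 5) = (int n + 5) * int (n + 4 choose 4)"
    using s[of 4 "n + 4"] by (simp add: eval_nat_numeral)
  show a: "2 * int (n + 2 choose 2) = (int n + 1) * (int n + 2)" using 2 c by simp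
  show b: "6 * int (n + 3 choose 3) = (int n + 1) * (int n + 2) * (int n + 3)"
    using 3 a by algebra
  show "120 * int (n + 5 choose 5) = (int n + 1) * (int n + 2) * (int n + 3) * (int n + 4) * (int n + 5)"
    using 5 4 b by algebra
qed

lemma qco_11 [simp]: "qco d 1 1 c = 2"
  by (simp add: qco_def)

lemma qco_22: "qco 1 2 2 c = - 2 * (int c + 1) * (int c + 4)"
  by (simp add: qco_def algebra_simps)

text \<open>For odd W, moving the index all the way from one factor to the other returns the same
  monomial with opposite sign. For even W >= 10 the two reductions of x_1 x_2 x_3 x_l, l = W - 6,
  are compared.\<close>

lemma generator_in_symC2:
  assumes "k > 0" "odd W \<and> W \<ge> 3 \<or> W \<ge> 10"
  shows "X 1 * X (W - 1) \<in> symC2 k"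
proof (cases "odd W")
  case True
  define w where "w = W - 2"
  have w: "W = w + 2" "odd w" using True assms(2) by (auto simp: w_def)
  have "X (w + 1) * X 1 - of_int ((- 1) ^ w * int (w choose w)) * (X 1 * X (w + 1)) \<in> symC2 k"
    using quadratic_reduction[of "w + 1" 1 k] by simp
  then have "of_int 2 * (X 1 * X (w + 1)) \<in> symC2 k" using w(2) by (simp add: algebra_simps)
  then show ?thesis using symC2_of_int_cancel[of 2 "X 1 * X (w + 1)" k] w by simp
next
  case False
  define l where "l = W - 6"
  then have l: "W = l + 6" "even l" "l \<ge> 4" using False assms by auto
  note S = csub_symC2[of k]
  let ?T = "X 1 * X (l + 5)"
  \<comment> \<open>Both contain the quartic x_1 x_2 x_3 x_l, with coefficients 2 and 4, so twice
    the first minus the second has quadratic terms only. All of them carry a factor 4k, and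
    \<open>u\<close> is the quotient.\<close>
  have A: "Qop k 1 1 (X 3 * X l) \<in> symC2 k" and B: "Qop k 2 2 (X 1 * X l) \<in> symC2 k"
    using l by (auto intro!: Qop_symC2 VL_mult)
  define u where "u = 16 * (X 6 * X l) + of_nat (2 * l) * (X 3 * X (l + 3)) + of_nat (l * (l + 1) * (l + 4)) * ?T"
  have A1: "Qop k 1 1 (X 3 * X l) = X 3 * Qop k 1 1 (X l) + of_int (2 * int k * int 3 * qco 1 1 1 3) * (X 6 * X l)"
    by (rule Qop_X_idx) simp_all
  have A2: "Qop k 1 1 (X l * 1) = X l * Qop k 1 1 1 + of_int (2 * int k * int l * qco 1 1 1 l) * (X (l + 3) * 1)"
    by (rule Qop_X_idx) simp_all
  have A3: "Qop k 1 1 1 = of_int (int 1) * (X 2 * X 1) + of_int (int 1) * (X 1 * X 2)"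
    by (rule Qop_1_idx) simp_all
  have B1: "Qop k 2 2 (X 1 * X l) = X 1 * Qop k 2 2 (X l) + of_int (2 * int k * int 1 * qco 1 2 2 1) * (X 6 * X l)"
    by (rule Qop_X_idx) simp_all
  have B2: "Qop k 2 2 (X l * 1) = X l * Qop k 2 2 1 + of_int (2 * int k * int l * qco 1 2 2 l) * (X (l + 5) * 1)"
    by (rule Qop_X_idx) simp_all
  have B3: "Qop k 2 2 1 = of_int (int 2) * (X 3 * X 2) + of_int (int 2) * (X 2 * X 3)"
    by (rule Qop_1_idx) simp_all
  have "2 * Qop k 1 1 (X 3 * X l) - Qop k 2 2 (X 1 * X l) = of_int (4 * int k) * u"
    unfolding A1 B1 A2[unfolded mult_1_right] B2[unfolded mult_1_right] A3 B3 qco_11 qco_22 u_def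
    by (simp add: algebra_simps)
  then have "of_int (4 * int k) * u \<in> symC2 k"
    using csub_diff[OF S csub_numeral[OF S A] B] by metis
  then have u: "u \<in> symC2 k" using symC2_of_int_cancel[of "4 * int k" u k] assms by simp
  define c where "c = - 16 * int (l + 4 choose 5) + 2 * int l * int (l + 4 choose 2) + int l * (int l + 1) * (int l + 4)"
  have r6: "X 6 * X l + of_int (int (l + 4 choose 5)) * ?T \<in> symC2 k"
    using quadratic_reduction[of 6 l k] l by (simp add: add.commute)
  have r3: "X 3 * X (l + 3) - of_int (int (l + 4 choose 2)) * ?T \<in> symC2 k"
    using quadratic_reduction[of 3 "l + 3" k] l by (simp add: add.commute)
  have "of_int c * ?T = u - 16 * (X 6 * X l + of_int (int (l + 4 choose 5)) * ?T)
     - of_int (int (2 * l)) * (X 3 * X (l + 3) - of_int (int (l + 4 choose 2)) * ?T)"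
    by (simp add: c_def u_def algebra_simps)
  also have "\<dots> \<in> symC2 k"
    by (intro csub_diff[OF S] u csub_numeral[OF S] csub_of_int[OF S] r6 r3)
  finally have "of_int c * ?T \<in> symC2 k" .
  moreover have "c \<noteq> 0"
  proof -
    obtain n where n: "l = n + 1" using l by (metis Suc_eq_plus1 not0_implies_Suc not_numeral_le_zero)
    have "120 * int (l + 4 choose 5) = int l * (int l + 1) * (int l + 2) * (int l + 3) * (int l + 4)"
      using choose_small(3)[of n] by (simp add: n algebra_simps)
    moreover have "2 * int (l + 4 choose 2) = (int l + 3) * (int l + 4)"
    proof -
      have e: "l + 2 + 2 = l + 4" by simp
      show ?thesis using choose_small(1)[of "l + 2", unfolded e] by (simp add: algebra_simps)
    qed
    \<comment> \<open>Among positive \<open>l\<close> the last factor vanishes only for l = 2, that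
      is in weight 8, where the generator survives and J_(-1) J is needed.\<close>
    ultimately have "120 * c = int l * (int l + 2) * (int l + 4) * (240 - 16 * (int l + 1) * (int l + 3))"
      unfolding c_def by algebra
    moreover have "(int l + 1) * (int l + 3) \<ge> 5 * 7" using l by (intro mult_mono) auto
    then have "240 - 16 * (int l + 1) * (int l + 3) \<noteq> 0"
      unfolding mult.assoc by linarith
    ultimately have "120 * c \<noteq> 0" using l by simp
    then show ?thesis by simp
  qed
  ultimately show ?thesis using symC2_of_int_cancel l by (simp add: add.commute)
qed

lemma charge_0_symC2:
  assumes "k > 0" "0 \<notin># a" "size a < sum_mset a" "odd (sum_mset a) \<or> sum_mset a \<ge> 10"
  shows "bvec (a, 0) \<in> symC2 k"
proof -
  have "sum_mset a \<noteq> 1"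
  proof
    assume "sum_mset a = 1"
    then have "a = {#}" using assms(3) by simp
    then show False using \<open>sum_mset a = 1\<close> by simp
  qed
  then have "odd (sum_mset a) \<Longrightarrow> sum_mset a \<ge> 3" by presburger
  then have "X 1 * X (sum_mset a - 1) \<in> symC2 k"
    using assms by (intro generator_in_symC2) auto
  then have "modC2 k {X 1 * X (sum_mset a - 1)} \<subseteq> symC2 k"
    by (intro modC2_subset csub_symC2) auto
  then show ?thesis using charge_0_reduction[OF assms(2,3)] by blast
qed

text \<open>In weight 1 the vector is a derivative; in weight 3 one relation and one derivative
  leave the coefficient 4k - 4. From weight 5 on one starts with a cubic term and eliminates down to
  length one.\<close>

lemma charge_1_generator:
  assumes "k \<ge> 2" "odd W \<or> W \<ge> 6"
  shows "X W * ee 1 \<in> symC2 k"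
proof -
  note S = csub_symC2[of k]
  have t: "tder f \<in> symC2 k" if "f \<in> VL" for f using tder_symC2 that .
  have E0: "Qop k 1 1 (ee 1) = of_int (int 1) * (X 2 * (X 1 * ee 1)) + of_int (int 1) * (X 1 * (X 2 * ee 1))
      + of_int (2 * int k * 1 * 2) * (X 3 * ee 1)"
    using Qop_ee_idx[of 1 1 2 2 3 k 1] unfolding qco_11 by simp
  have "W = 1 \<or> W = 3 \<or> W \<ge> 5" using assms(2) by presburger
  then consider "W = 1" | "W = 3" | "W \<ge> 5" by blast
  then show ?thesis
  proof cases
    case 1 then show ?thesis using t[of "ee 1"] by (simp add: tder_ee)
  next
    case 2
    have "tder (X 2 * ee 1) = X 2 * tder (ee 1) + of_int (int 2) * (X 3 * ee 1)"
      by (rule tder_X_idx) simp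
    then have "Qop k 1 1 (ee 1) - 2 * tder (X 2 * ee 1) = of_int (4 * int k - 4) * (X 3 * ee 1)"
      unfolding E0 tder_ee by (simp add: algebra_simps)
    moreover have "Qop k 1 1 (ee 1) - 2 * tder (X 2 * ee 1) \<in> symC2 k"
      by (intro csub_diff[OF S] csub_numeral[OF S] t Qop_symC2) (auto intro: VL_mult)
    ultimately show ?thesis using symC2_of_int_cancel[of "4 * int k - 4"] assms 2 by auto
  next
    case 3
    define c where "c = W - 3"
    have c: "W = c + 3" "c \<ge> 2" using 3 by (auto simp: c_def)
    define q3 where "q3 = qco 1 1 (c + 1) 0"
    define q4 where "q4 = qco 1 2 c 0"
    define N where "N = 4 * int k * int c - 4 * int k * (int k - 1) * q4 + 4 * int k ^ 2 * int c * q3 - 2 * int k * int c * (int c + 1) * (int c + 2)"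
    have E1: "Qop k 1 1 (X c * ee 1) = X c * Qop k 1 1 (ee 1) + of_int (2 * int k * int c * qco 1 1 1 c) * (X (c + 3) * ee 1)"
      by (rule Qop_X_idx) simp_all
    have E2: "tder (X 2 * (X c * ee 1)) = X 2 * tder (X c * ee 1) + of_int (int 2) * (X 3 * (X c * ee 1))"
      "tder (X c * ee 1) = X c * tder (ee 1) + of_int (int c) * (X (c + 1) * ee 1)"
      by (rule tder_X_idx, simp)+
    have E3: "Qop k 1 (c + 1) (ee 1) = of_int (int 1) * (X 2 * (X (c + 1) * ee 1)) + of_int (int (c + 1)) * (X 1 * (X (c + 2) * ee 1))
        + of_int (2 * int k * 1 * q3) * (X (c + 3) * ee 1)"
      unfolding q3_def by (rule Qop_ee_idx) simp_all
    have E4: "Qop k 2 c (ee 1) = of_int (int 2) * (X 3 * (X c * ee 1)) + of_int (int c) * (X 2 * (X (c + 1) * ee 1))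
        + of_int (2 * int k * 1 * q4) * (X (c + 3) * ee 1)"
      unfolding q4_def by (rule Qop_ee_idx) (use c in simp_all)
    have E5: "tder (X (c + 2) * ee 1) = X (c + 2) * tder (ee 1) + of_int (int (c + 2)) * (X (c + 3) * ee 1)"
      by (rule tder_X_idx) simp
    \<comment> \<open>The terms remove x_1 x_2 x_c, x_3 x_c, x_2 x_(c+1) and x_1 x_(c+2) in this
      order, which fixes each coefficient; x_(c+3) is what remains.\<close>
    have "of_int N * (X (c + 3) * ee 1) = Qop k 1 1 (X c * ee 1) - 2 * tder (X 2 * (X c * ee 1))
       - of_int (2 * int k - 2) * Qop k 2 c (ee 1) + of_int (2 * int k * int c) * Qop k 1 (c + 1) (ee 1)
       - of_int (2 * int k * int c * (int c + 1)) * tder (X (c + 2) * ee 1)"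
      unfolding E1 E0 E2 E3 E4 E5 tder_ee qco_11 N_def by (simp add: algebra_simps power2_eq_square)
    also have "\<dots> \<in> symC2 k"
      by (intro csub_diff[OF S] csub_add[OF S] csub_numeral[OF S] csub_of_int[OF S] t Qop_symC2) (use c in \<open>auto intro!: VL_mult\<close>)
    finally have "of_int N * (X (c + 3) * ee 1) \<in> symC2 k" .
    moreover have "N \<noteq> 0"
    proof -
      define e where "e = (-1::int) ^ c"
      have "c + 2 choose c = c + 2 choose 2" using binomial_symmetric[of c "c + 2"] by simp
      then have q3: "2 * q3 = 2 * e + (int c + 1) * (int c + 2)"
        using choose_small(1)[of c] by (simp add: q3_def qco_def e_def)
      obtain d where d: "c = d + 1" using c(2) by (metis Suc_eq_plus1 not0_implies_Suc not_numeral_le_zero)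
      have "d + 3 choose d = d + 3 choose 3" using binomial_symmetric[of d "d + 3"] by simp
      moreover have "q4 = - e * (int c + 2) - int (d + 3 choose d)"
        by (simp add: q4_def qco_def e_def d numeral_3_eq_3 del: binomial_Suc_Suc)
      ultimately have q4: "6 * q4 = - 6 * e * (int c + 2) - int c * (int c + 1) * (int c + 2)"
        using choose_small(2)[of d] by (simp add: d algebra_simps del: binomial_Suc_Suc)
      have N: "3 * N = 4 * int k * (2 * (int k - 1) * int c * (int c + 1) * (int c + 2)
           + 3 * e * (int k * int c + (int k - 1) * (int c + 2)) + 3 * int c)"
        unfolding N_def using q3 q4 by algebra
      \<comment> \<open>For even c all summands are nonnegative and the last is positive. For odd c
        the expression factors; among positive c the factor c(c+2) - 3 vanishes only at c = 1, which
        is weight 4.\<close>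
      show ?thesis
      proof (cases "even c")
        case True
        then have "e = 1" by (simp add: e_def)
        have "2 * (int k - 1) * int c * (int c + 1) * (int c + 2)
           + 3 * e * (int k * int c + (int k - 1) * (int c + 2)) + 3 * int c > 0"
          using assms(1) c \<open>e = 1\<close> by (intro add_nonneg_pos add_nonneg_nonneg mult_nonneg_nonneg) auto
        then show ?thesis using N assms(1) by auto
      next
        case False
        then have e: "e = -1" by (simp add: e_def)
        have c3: "c \<ge> 3" using c(2) False by presburger
        have "3 * N = 4 * int k * ((int k - 1) * (2 * (int c + 1)) * (int c * (int c + 2) - 3))"
          unfolding N e by algebra
        moreover have "int c * (int c + 2) \<ge> 3 * 5" using c3 by (intro mult_mono) auto
        ultimately show ?thesis using assms(1) by auto
      qed
    qed
    ultimately show ?thesis using symC2_of_int_cancel c by simp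
  qed
qed

subsection \<open>Powers of the first generator\<close>

definition low :: "nat \<Rightarrow> vec set" where
  "low W = vec.span {bvec (b, 0) | b. 0 \<notin># b \<and> sum_mset b = W \<and> size b < W}"

lemma csub_low: "csub (low W)"
  unfolding low_def by (rule csub_span)

lemma low_bvec: "0 \<notin># b \<Longrightarrow> sum_mset b = W \<Longrightarrow> size b < W \<Longrightarrow> bvec (b, 0) \<in> low W"
  unfolding low_def by (rule vec.span_base) blast

lemma low_subset:
  assumes "csub U" "\<And>b. 0 \<notin># b \<Longrightarrow> sum_mset b = W \<Longrightarrow> size b < W \<Longrightarrow> bvec (b, 0) \<in> U"
  shows "low W \<subseteq> U"
proof
  fix x assume "x \<in> low W"
  then show "x \<in> U"
    unfolding low_def
    by (induction rule: vec.span_induct_alt)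
       (use assms in \<open>auto simp: csub_0 smul_eq intro!: csub_add csub_cst\<close>)
qed

lemma low_symC2: assumes "k > 0" "W \<ge> 10 \<or> odd W" shows "low W \<subseteq> symC2 k"
  by (intro low_subset csub_symC2 charge_0_symC2) (use assms in auto)

lemma X1_power: "X 1 ^ n = bvec (replicate_mset n 1, 0)"
  by (induction n) (simp_all add: bvec_empty bvec_add_mset)

lemma csub_vimage_mult: "csub U \<Longrightarrow> csub {v. v * w \<in> U}"
  by (auto simp: csub_def distrib_right mult.assoc)

lemma low_mult_bvec:
  assumes "x \<in> low m" "0 \<notin># b" "sum_mset b = n" "size b \<le> n"
  shows "x * bvec (b, 0) \<in> low (m + n)"
proof -
  have "low m \<subseteq> {v. v * bvec (b, 0) \<in> low (m + n)}"
    by (intro low_subset csub_vimage_mult csub_low) (use assms in \<open>auto simp: bvec_mult intro!: low_bvec\<close>)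
  then show ?thesis using assms(1) by blast
qed

lemma low_mult: assumes "x \<in> low m" "y \<in> low n" shows "x * y \<in> low (m + n)"
proof -
  have "low n \<subseteq> {v. v * x \<in> low (m + n)}"
  proof (intro low_subset csub_vimage_mult csub_low CollectI)
    fix b :: "nat multiset" assume "0 \<notin># b" "sum_mset b = n" "size b < n"
    then show "bvec (b, 0) * x \<in> low (m + n)"
      using low_mult_bvec[OF assms(1), of b n] by (simp add: mult.commute)
  qed
  then show ?thesis using assms(2) by (auto simp: mult.commute)
qed

text \<open>Reads off the coefficient of x_1^n in weight n. Once \<open>low n\<close> consists of
  relations, this number alone decides what \<open>v\<close> says about x_1^n.\<close>

definition leads :: "nat \<Rightarrow> vec \<Rightarrow> complex \<Rightarrow> bool" where
  "leads n v c \<longleftrightarrow> v - cst c * X 1 ^ n \<in> low n"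

lemma leads_cst: "leads n v c \<Longrightarrow> leads n (cst a * v) (a * c)"
  using csub_cst[OF csub_low, of "v - cst c * X 1 ^ n" n a] by (simp add: leads_def cst_mult algebra_simps)

lemma leads_add: "leads n v c \<Longrightarrow> leads n w d \<Longrightarrow> leads n (v + w) (c + d)"
  using csub_add[OF csub_low, of "v - cst c * X 1 ^ n" n "w - cst d * X 1 ^ n"]
  by (simp add: leads_def cst_add algebra_simps)

lemma leads_sum: "(\<And>i. i \<in> A \<Longrightarrow> leads n (v i) (c i)) \<Longrightarrow> leads n (sum v A) (sum c A)"
proof (induction A rule: infinite_finite_induct)
  case (insert x A) then show ?case by (auto intro: leads_add)
qed (simp_all add: leads_def csub_0[OF csub_low])

lemma leads_X: "j > 0 \<Longrightarrow> leads j (X j) (if j = 1 then 1 else 0)"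
proof (cases "j = 1")
  case True then show ?thesis by (simp add: leads_def csub_0[OF csub_low])
next
  case False
  assume "j > 0"
  then have "bvec ({#j#}, 0) \<in> low j" using False by (intro low_bvec) auto
  then show ?thesis using False by (simp add: leads_def bvec_add_mset bvec_empty)
qed

lemma leads_1: "leads 0 1 1"
  by (simp add: leads_def csub_0[OF csub_low])

lemma leads_mult:
  assumes "leads m v c" "leads n w d" shows "leads (m + n) (v * w) (c * d)"
proof -
  note L = csub_low[of "m + n"]
  define x y where "x = v - cst c * X 1 ^ m" and "y = w - cst d * X 1 ^ n"
  have xy: "x \<in> low m" "y \<in> low n" using assms by (auto simp: leads_def x_def y_def)
  have "x * X 1 ^ n \<in> low (m + n)"
    unfolding X1_power by (rule low_mult_bvec[OF xy(1)]) auto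
  moreover have "y * X 1 ^ m \<in> low (m + n)"
    unfolding X1_power using low_mult_bvec[OF xy(2), of "replicate_mset m 1" m] by (simp add: add.commute)
  ultimately have "x * y + cst d * (x * X 1 ^ n) + cst c * (y * X 1 ^ m) \<in> low (m + n)"
    using low_mult[OF xy] by (intro csub_add[OF L] csub_cst[OF L])
  moreover have "v * w - cst (c * d) * X 1 ^ (m + n) = x * y + cst d * (x * X 1 ^ n) + cst c * (y * X 1 ^ m)"
    by (simp add: x_def y_def cst_mult power_add algebra_simps)
  ultimately show ?thesis by (simp add: leads_def)
qed

text \<open>\<open>Sc c n\<close> is the coefficient of \<open>z\<^sup>n\<close> in \<open>exp (\<Sum>\<^sub>j c x\<^sub>j z\<^sup>j / j)\<close>.\<close>

function Sc :: "complex \<Rightarrow> nat \<Rightarrow> vec" where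
  "Sc c n = (if n = 0 then 1 else cst (c / of_nat n) * (\<Sum>j\<in>{1..n}. X j * Sc c (n - j)))"
  by auto
termination by (relation "measure snd") auto

declare Sc.simps [simp del]

lemma Sc_0 [simp]: "Sc c 0 = 1"
  by (simp add: Sc.simps)

lemma Sc_rec: "of_nat n * Sc c n = cst c * (\<Sum>j=1..n. X j * Sc c (n - j))"
proof (cases "n = 0")
  case False
  have "cst (of_nat n) * (cst (c / of_nat n) * v) = cst c * v" for v
    unfolding mult.assoc[symmetric] cst_mult[symmetric] using False by simp
  then show ?thesis using False by (subst Sc.simps) simp
qed simp

text \<open>\<open>Sm\<close> admits only integer parameters, as produced by vertex operators; the
  vector fed into them needs the parameter 1/(2k) up to sign, hence \<open>Sc\<close>.\<close>

lemma Sm_Sc: "Sm p (int n) = Sc (of_int p) n"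
proof (induction n rule: less_induct)
  case (less n)
  show ?case
  proof (cases "n = 0")
    case False
    have "of_nat n * Sm p (int n) = of_int p * (\<Sum>j=1..n. X j * Sm p (int n - int j))"
      using Sm_rec[of "int n" p] by simp
    also have "(\<Sum>j=1..n. X j * Sm p (int n - int j)) = (\<Sum>j=1..n. X j * Sc (of_int p) (n - j))"
      by (rule sum.cong) (auto simp: less of_nat_diff[symmetric] simp del: of_nat_diff)
    finally have "cst (of_nat n) * (Sm p (int n) - Sc (of_int p) n) = 0"
      using Sc_rec[of n "of_int p"] by (simp add: right_diff_distrib)
    then show ?thesis using cst_cancel[of "of_nat n"] False by fastforce
  qed simp
qed

lemma VL_Sc: "Sc c n \<in> VL"
proof (induction n rule: less_induct)
  case (less n)
  then show ?case
    by (cases "n = 0", use VL_cst[of 1] in simp)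
       (subst Sc.simps, auto intro!: VL_cst_mult csub_sum[OF csub_VL] VL_mult)
qed

lemma theta_Sc: "theta (Sc c n * u) = Sc (- c) n * theta u"
proof (induction n rule: less_induct)
  case (less n)
  show ?case
  proof (cases "n = 0")
    case False
    have "theta (Sc c n * u) = cst (c / of_nat n) * (\<Sum>j=1..n. theta (X j * (Sc c (n - j) * u)))"
      using False by (subst Sc.simps) (simp add: sum_distrib_right lin_sum[OF lin_theta] mult.assoc del: theta_X)
    also have "(\<Sum>j=1..n. theta (X j * (Sc c (n - j) * u))) = (\<Sum>j=1..n. - (X j * (Sc (- c) (n - j) * theta u)))"
      by (rule sum.cong) (auto simp: less)
    also have "cst (c / of_nat n) * \<dots> = Sc (- c) n * theta u"
      using False by (subst Sc.simps) (simp add: sum_distrib_right sum_negf mult.assoc cst_minus)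
    finally show ?thesis .
  qed simp
qed

text \<open>With all variables but x_1 discarded the generating function is exp(c x_1 z).\<close>

lemma leads_Sc: "leads n (Sc c n) (c ^ n / fact n)"
proof (induction n rule: less_induct)
  case (less n)
  show ?case
  proof (cases n)
    case 0 then show ?thesis by (simp add: leads_1)
  next
    case (Suc m)
    have "leads n (X j * Sc c (n - j)) ((if j = 1 then 1 else 0) * (c ^ (n - j) / fact (n - j)))" if "j \<in> {1..n}" for j
      using leads_mult[OF leads_X[of j] less[of "n - j"]] that by simp
    then have "leads n (\<Sum>j=1..n. X j * Sc c (n - j)) (\<Sum>j=1..n. (if j = 1 then 1 else 0) * (c ^ (n - j) / fact (n - j)))"
      by (rule leads_sum)
    also have "(\<Sum>j=1..n. (if j = 1 then 1 else 0) * (c ^ (n - j) / fact (n - j))) = c ^ m / fact m"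
      using Suc by (subst sum.remove[of _ 1]) (auto intro!: sum.neutral)
    finally have "leads n (cst (c / of_nat n) * (\<Sum>j=1..n. X j * Sc c (n - j))) (c / of_nat n * (c ^ m / fact m))"
      by (rule leads_cst)
    moreover have "Sc c n = cst (c / of_nat n) * (\<Sum>j=1..n. X j * Sc c (n - j))"
      using Suc by (subst Sc.simps) simp
    ultimately have "leads n (Sc c n) (c / of_nat n * (c ^ m / fact m))" by simp
    moreover have "c / of_nat n * (c ^ m / fact m) = c ^ n / fact n"
      using Suc by (simp add: field_simps)
    ultimately show ?thesis by simp
  qed
qed

section \<open>Lattice vertex operators on Schur polynomials\<close>

lemma sum_antidiagonal:
  fixes f :: "nat \<Rightarrow> nat \<Rightarrow> vec"
  shows "(\<Sum>j=1..r. \<Sum>i\<le>r - j. f j i) = (\<Sum>i\<le>r. \<Sum>j=1..r - i. f j i)"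
    and "(\<Sum>j=1..r. \<Sum>i\<le>r - j. f j i) = (\<Sum>n\<le>r. \<Sum>j=1..n. f j (n - j))"
proof -
  have 1: "(\<Sum>j=1..r. \<Sum>i\<le>r - j. f j i) = (\<Sum>(j, i)\<in>Sigma {1..r} (\<lambda>j. {..r - j}). f j i)"
    by (rule sum.Sigma) auto
  show "(\<Sum>j=1..r. \<Sum>i\<le>r - j. f j i) = (\<Sum>i\<le>r. \<Sum>j=1..r - i. f j i)"
    unfolding 1 by (subst sum.Sigma, simp, simp)
      (rule sum.reindex_bij_witness[of _ "\<lambda>(i, j). (j, i)" "\<lambda>(j, i). (i, j)"], auto)
  show "(\<Sum>j=1..r. \<Sum>i\<le>r - j. f j i) = (\<Sum>n\<le>r. \<Sum>j=1..n. f j (n - j))"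
    unfolding 1 by (subst sum.Sigma, simp, simp)
      (rule sum.reindex_bij_witness[of _ "\<lambda>(n, j). (j, n - j)" "\<lambda>(j, i). (i + j, j)"], auto)
qed

text \<open>The translation \<open>x\<^sub>n \<mapsto> x\<^sub>n - 2kp z\<^sup>-\<^sup>n\<close> multiplies the generating function of \<open>Sc c\<close> by
  \<open>(1 - t)\<^bsup>2kpc\<^esup>\<close>, whose coefficients \<open>D\<close> are characterized by the recursion below.\<close>

lemma cst_sum: "cst (sum f A) = (\<Sum>x\<in>A. cst (f x))"
  by (induction A rule: infinite_finite_induct) (simp_all add: cst_add)

lemma vop_Sc:
  fixes D :: "nat \<Rightarrow> complex" and d :: complex
  assumes d: "of_int (2 * int k * p) * c = d"
    and D: "D 0 = 1" "\<And>n. of_nat n * D n = - d * (\<Sum>j=1..n. D (n - j))"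
  shows "vop k p q (Sc c r * ee m) = (\<Sum>i\<le>r. cst (D i) * (Sc c (r - i) * vop k p (q - int i) (ee m)))"
proof (induction r arbitrary: q rule: less_induct)
  case (less r)
  let ?V = "\<lambda>q. vop k p q (ee m)"
  show ?case
  proof (cases "r = 0")
    case True then show ?thesis by (simp add: D)
  next
    case False
    \<comment> \<open>Multiplication by r makes the recursion for \<open>Sc\<close> applicable.
      Resumming, the part with x_j yields r - i times the i-th term and the shifted part yields i
      times it, by the recursion for \<open>D\<close>; the two add up to r.\<close>
    have "of_nat r * vop k p q (Sc c r * ee m) = vop k p q (of_nat r * Sc c r * ee m)"
      by (simp add: lin_of_nat[OF lin_vop] mult.assoc)
    also have "\<dots> = cst c * (\<Sum>j=1..r. vop k p q (X j * (Sc c (r - j) * ee m)))"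
      by (simp add: Sc_rec sum_distrib_right mult.assoc lin_cst[OF lin_vop] lin_sum[OF lin_vop])
    also have "\<dots> = (\<Sum>j=1..r. cst c * (X j * vop k p q (Sc c (r - j) * ee m))
        + cst (- d) * vop k p (q - int j) (Sc c (r - j) * ee m))"
      unfolding sum_distrib_left d[symmetric]
      by (rule sum.cong) (simp_all add: vop_X algebra_simps cst_minus cst_mult)
    also have "\<dots> = (\<Sum>j=1..r. \<Sum>i\<le>r - j. cst c * (X j * (cst (D i) * (Sc c (r - j - i) * ?V (q - int i)))))
        + (\<Sum>j=1..r. \<Sum>i\<le>r - j. cst (- d) * (cst (D i) * (Sc c (r - j - i) * ?V (q - int j - int i))))"
      by (subst sum.distrib[symmetric]) (rule sum.cong, auto simp: less sum_distrib_left)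
    also have "(\<Sum>j=1..r. \<Sum>i\<le>r - j. cst c * (X j * (cst (D i) * (Sc c (r - j - i) * ?V (q - int i)))))
        = (\<Sum>i\<le>r. cst (D i) * (of_nat (r - i) * Sc c (r - i) * ?V (q - int i)))"
      unfolding sum_antidiagonal(1) Sc_rec sum_distrib_left sum_distrib_right
      by (intro sum.cong refl) (simp add: ac_simps diff_right_commute)
    also have "(\<Sum>j=1..r. \<Sum>i\<le>r - j. cst (- d) * (cst (D i) * (Sc c (r - j - i) * ?V (q - int j - int i))))
        = (\<Sum>n\<le>r. of_nat n * (cst (D n) * (Sc c (r - n) * ?V (q - int n))))"
      unfolding sum_antidiagonal(2)
    proof (rule sum.cong)
      fix n
      have "(\<Sum>j=1..n. cst (- d) * (cst (D (n - j)) * (Sc c (r - j - (n - j)) * ?V (q - int j - int (n - j)))))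
          = (\<Sum>j=1..n. cst (- d * D (n - j)) * (Sc c (r - n) * ?V (q - int n)))"
        by (rule sum.cong) (auto simp: cst_mult cst_minus mult.assoc)
      also have "\<dots> = cst (of_nat n * D n) * (Sc c (r - n) * ?V (q - int n))"
      proof -
        have "(\<Sum>j=1..n. cst (- d * D (n - j))) = cst (\<Sum>j=1..n. - d * D (n - j))"
          by (rule cst_sum[symmetric])
        then show ?thesis unfolding sum_distrib_right[symmetric] D(2) by (simp add: sum_distrib_left)
      qed
      finally show "(\<Sum>j=1..n. cst (- d) * (cst (D (n - j)) * (Sc c (r - j - (n - j)) * ?V (q - int j - int (n - j)))))
          = of_nat n * (cst (D n) * (Sc c (r - n) * ?V (q - int n)))"
        by (simp add: cst_mult mult.assoc)
    qed simp
    also have "(\<Sum>i\<le>r. cst (D i) * (of_nat (r - i) * Sc c (r - i) * ?V (q - int i)))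
        + (\<Sum>n\<le>r. of_nat n * (cst (D n) * (Sc c (r - n) * ?V (q - int n))))
        = of_nat r * (\<Sum>i\<le>r. cst (D i) * (Sc c (r - i) * ?V (q - int i)))"
      unfolding sum.distrib[symmetric] sum_distrib_left
      by (rule sum.cong) (auto simp: of_nat_diff algebra_simps)
    finally have "cst (of_nat r) * (vop k p q (Sc c r * ee m) - (\<Sum>i\<le>r. cst (D i) * (Sc c (r - i) * ?V (q - int i)))) = 0"
      by (simp add: right_diff_distrib)
    then show ?thesis using cst_cancel[of "of_nat r"] False by fastforce
  qed
qed

text \<open>Since p alpha(-1) e^(p alpha) = L(-1) e^(p alpha), this is the rule (L(-1)v)_q = -q
  v_(q-1). At q = -2 it turns a mode -3 of the exponential into a mode -2 of another vector.\<close>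

lemma vop_derivative: "of_int p * Yl k [1] p q u = - of_int q * vop k p (q - 1) u"
proof -
  have b: "bin 1 j = 1" for j by (simp add: bin_def)
  have nt: "nop_term k 1 (vop k p) q u j = (if j < 0 then heis k j (vop k p (q - j - 1) u) else vop k p (q - j - 1) (heis k j u))" for q u j
    by (simp only: nop_term_def b) simp
  have "\<forall>q. of_int p * nop k 1 (vop k p) q u = - of_int q * vop k p (q - 1) u"
  proof (induction u rule: vec_induct_X)
    case (add u v)
    then show ?case by (simp add: lin_add[OF lin_nop[OF fld_vop]] lin_add[OF lin_vop] distrib_left)
  next
    case (cst c u)
    show ?case
    proof
      fix q
      have "of_int p * nop k 1 (vop k p) q (cst c * u) = cst c * (of_int p * nop k 1 (vop k p) q u)"
        unfolding lin_cst[OF lin_nop[OF fld_vop]] by (rule mult.left_commute)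
      also have "\<dots> = cst c * (- of_int q * vop k p (q - 1) u)" using cst by simp
      also have "\<dots> = - of_int q * vop k p (q - 1) (cst c * u)"
        unfolding lin_cst[OF lin_vop] by (rule mult.left_commute)
      finally show "of_int p * nop k 1 (vop k p) q (cst c * u) = - of_int q * vop k p (q - 1) (cst c * u)" .
    qed
  next
    case (ee m)
    show ?case
    proof
      fix q
      define N where "N = - q - 2 * int k * p * m"
      let ?t = "nop_term k 1 (vop k p) q (ee m)"
      let ?A = "(\<lambda>i. - int i) ` {1..nat N}"
      have ti: "?t (- int i) = X i * (Sm p (N - int i) * ee (p + m))" if "i > 0" for i
      proof -
        have "q - (- int i) - 1 = q + int i - 1" "- (q + int i - 1) - 1 - 2 * int k * p * m = N - int i" by (simp_all add: N_def)
        then show ?thesis using that by (simp only: nt heis_neg vop_ee) (simp add: heis_neg)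
      qed
      have t0: "?t 0 = of_int (2 * int k * m) * (Sm p N * ee (p + m))"
      proof -
        have "- (q - 0 - 1) - 1 - 2 * int k * p * m = N" by (simp add: N_def)
        then show ?thesis by (simp only: nt heis_0_ee lin_of_int[OF lin_vop] vop_ee) simp
      qed
      have "nop k 1 (vop k p) q (ee m) = (\<Sum>j\<in>insert 0 ?A. ?t j)"
      proof (rule nop_eqI)
        fix j assume j: "j \<notin> insert 0 ?A"
        show "?t j = 0"
        proof (cases "j > 0")
          case True then show ?thesis unfolding nt by (simp add: heis_pos_ee lin_0[OF lin_vop])
        next
          case False
          then obtain i where i: "j = - int i" "i > 0" using j by (metis insertI1 linorder_neqE_linordered_idom neg_equal_0_iff_equal nonpos_int_cases not_gr_zero of_nat_0 not_less)
          then have "i \<notin> {1..nat N}" using j by auto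
          then have "N - int i < 0" using i by auto
          then show ?thesis unfolding i(1) ti[OF i(2)] by (simp add: Sm_neg)
        qed
      qed simp
      also have "\<dots> = ?t 0 + (\<Sum>j\<in>?A. ?t j)" by (rule sum.insert) auto
      also have "(\<Sum>j\<in>?A. ?t j) = (\<Sum>i=1..nat N. X i * Sm p (N - int i)) * ee (p + m)"
      proof -
        have "(\<Sum>j\<in>?A. ?t j) = (\<Sum>i=1..nat N. ?t (- int i))"
          by (subst sum.reindex) (auto simp: inj_on_def)
        also have "\<dots> = (\<Sum>i=1..nat N. X i * (Sm p (N - int i) * ee (p + m)))"
          by (rule sum.cong[OF refl], rule ti) simp
        finally show ?thesis by (simp only: sum_distrib_right mult.assoc)
      qed
      finally have "of_int p * nop k 1 (vop k p) q (ee m) = of_int (2 * int k * p * m) * (Sm p N * ee (p + m)) + of_int N * Sm p N * ee (p + m)"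
        unfolding t0 Sm_rec by (simp add: algebra_simps)
      also have "\<dots> = - of_int q * (Sm p N * ee (p + m))"
        by (simp add: N_def algebra_simps)
      also have "Sm p N * ee (p + m) = vop k p (q - 1) (ee m)"
        by (simp add: vop_ee N_def)
      finally show "of_int p * nop k 1 (vop k p) q (ee m) = - of_int q * vop k p (q - 1) (ee m)" .
    qed
  next
    case (X c u)
    \<comment> \<open>The commutator of the vertex operator with \<open>X c\<close>, as a field, so
      that \<open>nop_X\<close> applies.\<close>
    define G :: "int \<Rightarrow> vec \<Rightarrow> vec" where "G q u = - (of_int (2 * int k * p) * vop k p (q - int c) u)" for q u
    have G: "fld G"
    proof -
      have "\<exists>N. \<forall>q\<ge>N. G q u = 0" for u
      proof -
        obtain N where "\<forall>q\<ge>N. vop k p q u = 0" using fld_vop unfolding fld_def by blast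
        then show ?thesis by (intro exI[of _ "N + int c"]) (simp add: G_def)
      qed
      moreover have "lin (G q)" for q
        unfolding G_def by (intro lin_uminus lin_mult lin_vop)
      ultimately show ?thesis by (simp add: fld_def)
    qed
    have nG: "nop k 1 G q u = - (of_int (2 * int k * p) * nop k 1 (vop k p) (q - int c) u)" for q
    proof -
      have fin: "finite {j. nop_term k 1 (vop k p) (q - int c) u j \<noteq> 0}" by (rule finite_nop_term[OF fld_vop])
      have e: "q - j - int 1 - int c = q - int c - j - 1" for j by simp
      have "nop_term k 1 G q u = (\<lambda>j. cst (- of_int (2 * int k * p)) * nop_term k 1 (vop k p) (q - int c) u j)"
        unfolding nt fun_eq_iff nop_term_def b G_def e
        by (simp add: lin_minus[OF lin_heis] lin_of_int[OF lin_heis] cst_minus cst_mult del: of_int_mult)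
      then have "nop k 1 G q u = cst (- of_int (2 * int k * p)) * nop k 1 (vop k p) (q - int c) u"
        unfolding nop_def by (simp only: Sum_any_right_distrib[OF fin])
      then show ?thesis by (simp add: cst_minus del: of_int_mult)
    qed
    have n: "nop k 1 (vop k p) q (X c * u) = X c * nop k 1 (vop k p) q u + nop k 1 G q u + of_nat (2 * k * c) * vop k p (q - int c - 1) u" for q
    proof -
      have "nop k 1 (vop k p) q (X c * u) = X c * nop k 1 (vop k p) q u + nop k 1 G q u
          + cst (of_nat (2 * k * c) * bin 1 (int c)) * vop k p (q - int c - int 1) u"
        by (rule nop_X[OF fld_vop G]) (simp add: vop_X G_def)
      then show ?thesis by (simp only: b mult_1_right cst_of_nat of_nat_1)
    qed
    show ?case
    proof
      fix q
      have e: "q - int c - 1 = q - 1 - int c" by simp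
      have IH1: "of_int p * nop k 1 (vop k p) q u = - of_int q * vop k p (q - 1) u"
        and IH2: "of_int p * nop k 1 (vop k p) (q - int c) u = - of_int (q - int c) * vop k p (q - 1 - int c) u"
        using X e by metis+
      have "of_int p * nop k 1 (vop k p) q (X c * u) = X c * (of_int p * nop k 1 (vop k p) q u)
          - of_int (2 * int k * p) * (of_int p * nop k 1 (vop k p) (q - int c) u) + of_int p * of_nat (2 * k * c) * vop k p (q - 1 - int c) u"
        unfolding n nG e by (simp add: algebra_simps)
      also have "\<dots> = - of_int q * vop k p (q - 1) (X c * u)"
        unfolding IH1 IH2 vop_X by (simp add: algebra_simps)
      finally show "of_int p * nop k 1 (vop k p) q (X c * u) = - of_int q * vop k p (q - 1) (X c * u)" .
    qed
  qed
  then show ?thesis by (simp add: Yl_Cons Yl_Nil)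
qed

lemma Evec_eq: "Evec = ee 1 + ee (- 1)"
  by (simp add: Evec_def bvec_empty)

text \<open>The charge 0 part of the mode -1-s of E on the symmetrized Schur vector has weight r +
  2k + s. The case s = 1 is a mode -2 of E itself, s = 2 comes from L(-1)E.
  \<open>W \<ge> 10\<close> puts all other monomials of that weight into
  \<open>symC2\<close>.\<close>

lemma X1_power_symC2_aux:
  assumes k: "k \<ge> 2" and s: "s = 1 \<or> s = 2" and W: "W = r + 2 * k + s" "W \<ge> 10"
  shows "cst (\<Sum>l\<le>r. (- 1 / (2 * of_nat k)) ^ l / (fact l * fact (W - l))) * X 1 ^ W \<in> symC2 k"
proof -
  define y :: complex where "y = 1 / (2 * of_nat k)"
  have y: "of_int (2 * int k * 1) * y = 1" "of_int (2 * int k * 1) * (- y) = - 1"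
    "of_int (2 * int k * (- 1)) * y = - 1" "of_int (2 * int k * (- 1)) * (- y) = 1"
    using k by (simp_all add: y_def)
  \<comment> \<open>The coefficients of 1 - t.\<close>
  define D where "D = (\<lambda>n::nat. if n = 0 then 1 else if n = 1 then - 1 else 0 :: complex)"
  have D: "D 0 = 1" "\<And>n. of_nat n * D n = - 1 * (\<Sum>j=1..n. D (n - j))"
  proof -
    show "D 0 = 1" by (simp add: D_def)
    fix n
    have "(\<Sum>j=1..n. D (n - j)) = (\<Sum>i<n. D i)"
      by (rule sum.reindex_bij_witness[of _ "\<lambda>i. n - i" "\<lambda>j. n - j"]) auto
    also have "\<dots> = (if n = 1 then 1 else 0)"
    proof -
      have "(\<Sum>i<Suc (Suc m). D i) = 0" for m
        by (induction m) (simp_all add: D_def)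
      then show ?thesis by (cases n; cases "n - 1") (auto simp: D_def)
    qed
    finally show "of_nat n * D n = - 1 * (\<Sum>j=1..n. D (n - j))" by (simp add: D_def)
  qed
  define q where "q = - 1 - int s"
  define g where "g = Sc (- y) r * ee (- 1)"
  have gVL: "g \<in> VL" unfolding g_def by (intro VL_mult VL_Sc VL_ee)
  have tg: "theta g = Sc y r * ee 1" by (simp add: g_def theta_Sc)
  \<comment> \<open>The recursion for the coefficients of 1/(1 - t), all equal to 1.\<close>
  have one: "of_nat n * 1 = - (- 1) * (\<Sum>j=1..n. 1 :: complex)" for n by simp
  define B where "B = (\<Sum>i\<le>r. Sc (- y) (r - i) * Sc 1 (2 * k + s + i))"
  have v1: "vop k 1 q g = B"
  proof -
    have "vop k 1 q g = (\<Sum>i\<le>r. cst 1 * (Sc (- y) (r - i) * vop k 1 (q - int i) (ee (- 1))))"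
      unfolding g_def by (rule vop_Sc[OF y(2) refl one])
    also have "\<dots> = B" unfolding B_def
    proof (rule sum.cong[OF refl])
      fix i
      have "- (q - int i) - 1 - 2 * int k * 1 * (- 1) = int (2 * k + s + i)" by (simp add: q_def)
      then have "vop k 1 (q - int i) (ee (- 1)) = Sc 1 (2 * k + s + i)"
        unfolding vop_ee by (simp only: Sm_Sc) simp
      then show "cst 1 * (Sc (- y) (r - i) * vop k 1 (q - int i) (ee (- 1))) = Sc (- y) (r - i) * Sc 1 (2 * k + s + i)"
        by simp
    qed
    finally show ?thesis .
  qed
  have v2: "vop k (- 1) q (theta g) = theta B"
  proof -
    have "vop k (- 1) q (theta g) = (\<Sum>i\<le>r. cst 1 * (Sc y (r - i) * vop k (- 1) (q - int i) (ee 1)))"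
      unfolding tg by (rule vop_Sc[OF y(3) refl one])
    also have "\<dots> = theta B" unfolding B_def lin_sum[OF lin_theta]
    proof (rule sum.cong[OF refl])
      fix i
      have "- (q - int i) - 1 - 2 * int k * (- 1) * 1 = int (2 * k + s + i)" by (simp add: q_def)
      then have "vop k (- 1) (q - int i) (ee 1) = Sc (- 1) (2 * k + s + i)"
        unfolding vop_ee by (simp only: Sm_Sc) simp
      moreover have "theta (Sc 1 n) = Sc (- 1) n" for n
      proof -
        have "theta (1::vec) = 1" by (metis ee_0 minus_zero theta_ee)
        then show ?thesis using theta_Sc[of 1 n 1] by simp
      qed
      ultimately show "cst 1 * (Sc y (r - i) * vop k (- 1) (q - int i) (ee 1)) = theta (Sc (- y) (r - i) * Sc 1 (2 * k + s + i))"
        by (simp add: theta_Sc)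
    qed
    finally show ?thesis .
  qed
  \<comment> \<open>The charge 2 and -2 terms involve Schur polynomials of index s + i - 2k, which
    is negative for s <= 2, i <= 1 and k >= 2.\<close>
  have z: "vop k p (q - int i) (ee p) = 0" if "p = 1 \<or> p = - 1" "i \<le> 1" for p i
  proof -
    have "- (q - int i) - 1 - 2 * int k * p * p < 0" using that k s by (auto simp: q_def)
    then show ?thesis by (simp add: vop_ee Sm_neg)
  qed
  have w0: "(\<Sum>i\<le>r. cst (D i) * (Sc c (r - i) * vop k p (q - int i) (ee p))) = 0" if "p = 1 \<or> p = - 1" for p c
    by (rule sum.neutral) (use z[OF that, of 0] z[OF that, of 1] in \<open>auto simp: D_def\<close>)
  have w1: "vop k 1 q (theta g) = 0"
  proof -
    have "vop k 1 q (theta g) = (\<Sum>i\<le>r. cst (D i) * (Sc y (r - i) * vop k 1 (q - int i) (ee 1)))"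
      unfolding tg by (rule vop_Sc[OF y(1) D])
    then show ?thesis using w0[of 1 y] by simp
  qed
  have w2: "vop k (- 1) q g = 0"
  proof -
    have "vop k (- 1) q g = (\<Sum>i\<le>r. cst (D i) * (Sc (- y) (r - i) * vop k (- 1) (q - int i) (ee (- 1))))"
      unfolding g_def by (rule vop_Sc[OF y(4) D])
    then show ?thesis using w0[of "-1" "- y"] by simp
  qed
  have sum: "vop k 1 q (g + theta g) + vop k (- 1) q (g + theta g) = B + theta B"
    by (simp add: lin_add[OF lin_vop] v1 v2 w1 w2)
  have gp: "g + theta g \<in> VLplus" by (rule VLplus_theta[OF gVL])
  have "B \<in> symC2 k"
  proof (cases "s = 1")
    case True
    have "ee 1 + ee (- 1) \<in> VLplus" by (simp add: VLplus_def VL_add add.commute)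
    from mode_C2[OF gp this, of k] have "mode k (ee 1 + ee (- 1)) (- 2) (g + theta g) \<in> C2 k" .
    moreover have "mode k (ee p) (- 2) u = vop k p q u" for p u
      unfolding ee_def by (simp add: mode_bvec Yl_Nil q_def True)
    ultimately show ?thesis by (simp add: lin_add[OF lin_mode] sum symC2_def)
  next
    case False
    then have q: "q = - 3" using s by (simp add: q_def)
    \<comment> \<open>This vector is L(-1)E; its mode -2 equals twice the mode -3 of E.\<close>
    have "X 1 * ee 1 - X 1 * ee (- 1) \<in> VLplus"
      by (simp add: VLplus_def csub_diff[OF csub_VL] VL_mult)
    from mode_C2[OF gp this, of k] have "mode k (X 1 * ee 1 - X 1 * ee (- 1)) (- 2) (g + theta g) \<in> C2 k" .
    moreover have "mode k (X 1 * ee p) (- 2) u = Yl k [1] p (- 2) u" for p u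
      unfolding bvec_empty[symmetric] bvec_add_mset[symmetric] by (simp add: mode_bvec)
    moreover have "Yl k [1] 1 (- 2) u - Yl k [1] (- 1) (- 2) u = 2 * (vop k 1 q u + vop k (- 1) q u)" for u
    proof -
      have "Yl k [1] 1 (- 2) u = 2 * vop k 1 q u" "- Yl k [1] (- 1) (- 2) u = 2 * vop k (- 1) q u"
        using vop_derivative[of 1 k "-2" u] vop_derivative[of "-1" k "-2" u] by (simp_all add: q)
      then show ?thesis by (metis diff_conv_add_uminus distrib_left)
    qed
    ultimately have "cst 2 * (B + theta B) \<in> C2 k" by (simp add: lin_diff[OF lin_mode] sum del: distrib_left_numeral)
    then show ?thesis using csub_cst_iff[OF csub_C2, of 2 "B + theta B" k] by (simp add: symC2_def)
  qed
  moreover have "leads W B (\<Sum>l\<le>r. (- y) ^ l / (fact l * fact (W - l)))"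
  proof -
    have "leads W (Sc (- y) (r - i) * Sc 1 (2 * k + s + i)) ((- y) ^ (r - i) / fact (r - i) * (1 / fact (2 * k + s + i)))"
      if "i \<in> {..r}" for i
    proof -
      have "r - i + (2 * k + s + i) = W" using that W by simp
      then show ?thesis
        using leads_mult[OF leads_Sc[of "r - i" "- y"] leads_Sc[of "2 * k + s + i" 1]] by (simp only: power_one)
    qed
    then have "leads W B (\<Sum>i\<le>r. (- y) ^ (r - i) / fact (r - i) * (1 / fact (2 * k + s + i)))"
      unfolding B_def by (rule leads_sum)
    also have "(\<Sum>i\<le>r. (- y) ^ (r - i) / fact (r - i) * (1 / fact (2 * k + s + i))) = (\<Sum>l\<le>r. (- y) ^ l / (fact l * fact (W - l)))"
      by (rule sum.reindex_bij_witness[of _ "\<lambda>l. r - l" "\<lambda>i. r - i"]) (use W in \<open>auto simp: algebra_simps\<close>)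
    finally show ?thesis .
  qed
  moreover have "low W \<subseteq> symC2 k" by (rule low_symC2) (use k W in auto)
  ultimately have "B \<in> symC2 k" "B - cst (\<Sum>l\<le>r. (- y) ^ l / (fact l * fact (W - l))) * X 1 ^ W \<in> symC2 k"
    unfolding leads_def by blast+
  from csub_diff[OF csub_symC2 this] show ?thesis by (simp add: y_def)
qed

text \<open>The same weight is reached from s = 2 with r and from s = 1 with r + 1, with consecutive
  partial sums as coefficients.\<close>

lemma X1_power_symC2:
  assumes "k \<ge> 2" "W \<ge> 2 * k + 2" "W \<ge> 10"
  shows "X 1 ^ W \<in> symC2 k"
proof -
  define r where "r = W - 2 * k - 2"
  define \<tau> where "\<tau> = (\<lambda>r. \<Sum>l\<le>r. (- 1 / (2 * of_nat k)) ^ l / (fact l * fact (W - l)) :: complex)"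
  have 1: "cst (\<tau> r) * X 1 ^ W \<in> symC2 k"
    unfolding \<tau>_def by (rule X1_power_symC2_aux[of _ 2]) (use assms in \<open>auto simp: r_def\<close>)
  have 2: "cst (\<tau> (Suc r)) * X 1 ^ W \<in> symC2 k"
    unfolding \<tau>_def by (rule X1_power_symC2_aux[of _ 1]) (use assms in \<open>auto simp: r_def\<close>)
  \<comment> \<open>The difference is the single term with l = r + 1, so the two sums cannot both
    vanish.\<close>
  have "\<tau> (Suc r) - \<tau> r \<noteq> 0" using assms by (simp add: \<tau>_def del: of_nat_Suc)
  then have "\<tau> (Suc r) \<noteq> 0 \<or> \<tau> r \<noteq> 0" by auto
  then show ?thesis using 1 2 csub_cst_iff[OF csub_symC2] by blast
qed

subsection \<open>Explicit relations in low weight\<close>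

lemma Pop_X_idx:
  "m > 0 \<Longrightarrow> n > 0 \<Longrightarrow> r = m + n + c \<Longrightarrow> z = 2 * int c * qco 0 m n c \<Longrightarrow>
   Pop k m n (X c * u) = X c * Pop k m n u + of_int z * (of_nat k * (X r * u))"
  using Pop_X[of m n k c u] by (simp add: ac_simps)

lemma Pop_1_idx: "m > 0 \<Longrightarrow> n > 0 \<Longrightarrow> Pop k m n 1 = X m * X n"
  using Pop_ee[of m n k 0] by simp

lemma Qop_X_idx':
  "m > 0 \<Longrightarrow> n > 0 \<Longrightarrow> r = m + n + c + 1 \<Longrightarrow> z = 2 * int c * qco 1 m n c \<Longrightarrow>
   Qop k m n (X c * u) = X c * Qop k m n u + of_int z * (of_nat k * (X r * u))"
  using Qop_X[of m n k c u] by (simp add: ac_simps)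

text \<open>Contracting x_c with one of the s factors of alpha(z)^s leaves alpha(z)^(s-1). At s = 0
  the truncated \<open>s - 1\<close> is harmless, since the factor \<open>s\<close> is zero.\<close>

lemma Yl_ones_X:
  "Yl k (replicate s 1) 0 q (X c * u) = X c * Yl k (replicate s 1) 0 q u
    + of_nat (2 * k * c * s) * Yl k (replicate (s - 1) 1) 0 (q - int c - 1) u"
proof (induction s arbitrary: q u)
  case 0
  then show ?case by (simp add: Yl_Nil vop_X)
next
  case (Suc s)
  define a :: complex where "a = of_nat (2 * k * c * s)"
  define F where "F = Yl k (replicate s 1) 0"
  define F' where "F' = Yl k (replicate (s - 1) 1) 0"
  define G where "G = (\<lambda>q u. cst a * F' (q - int c - 1) u)"
  have b: "bin 1 j = 1" for j by (simp add: bin_def)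
  have F: "fld F" "fld F'" by (simp_all add: F_def F'_def fld_Yl)
  have G: "fld G"
  proof -
    have "\<exists>N. \<forall>q\<ge>N. G q u = 0" for u
    proof -
      obtain N where "\<forall>q\<ge>N. F' q u = 0" using F(2) unfolding fld_def by blast
      then show ?thesis by (intro exI[of _ "N + int c + 1"]) (simp add: G_def)
    qed
    moreover have "lin (G q)" for q
      unfolding G_def by (intro lin_mult fld_lin F)
    ultimately show ?thesis by (simp add: fld_def)
  qed
  have nG: "nop k 1 G q u = cst a * nop k 1 F' (q - int c - 1) u"
  proof -
    have fin: "finite {j. nop_term k 1 F' (q - int c - 1) u j \<noteq> 0}" by (rule finite_nop_term[OF F(2)])
    have e: "q - j - int 1 - int c - 1 = q - int c - 1 - j - int 1" for j by simp
    have "nop_term k 1 G q u = (\<lambda>j. cst a * nop_term k 1 F' (q - int c - 1) u j)"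
      unfolding fun_eq_iff nop_term_def b G_def e by (simp add: lin_cst[OF lin_heis])
    then show ?thesis unfolding nop_def by (simp only: Sum_any_right_distrib[OF fin])
  qed
  have "nop k 1 F q (X c * u) = X c * nop k 1 F q u + nop k 1 G q u
      + cst (of_nat (2 * k * c) * bin 1 (int c)) * F (q - int c - int 1) u"
    by (rule nop_X[OF F(1) G]) (simp only: F_def F'_def G_def a_def Suc.IH cst_of_nat)
  moreover have "cst a * nop k 1 F' (q - int c - 1) u = cst a * F (q - int c - 1) u"
    by (cases s) (simp_all add: a_def F_def F'_def Yl_Cons)
  ultimately have "nop k 1 F q (X c * u) = X c * nop k 1 F q u + of_nat (2 * k * c * Suc s) * F (q - int c - 1) u"
    unfolding nG b by (simp add: a_def algebra_simps cst_mult)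
  then show ?case by (simp add: F_def Yl_Cons)
qed

lemma Yl_ones_1:
  assumes "n > 0"
  shows "Yl k (replicate (Suc s) 1) 0 (- int n) 1 = (\<Sum>j=1..n. X j * Yl k (replicate s 1) 0 (- int (n + 1 - j)) 1)"
proof -
  let ?F = "Yl k (replicate s 1) 0"
  let ?A = "(\<lambda>j. - int j) ` {1..n}"
  have b: "bin 1 j = 1" for j by (simp add: bin_def)
  have z: "?F q 1 = 0" if "q \<ge> 0" for q using Yl_1_aux[of "replicate s 1" k 0] that by auto
  have nt: "nop_term k 1 ?F (- int n) 1 j = (if j < 0 then X (nat (- j)) * ?F (- int n - j - 1) 1 else 0)" for j
    by (simp add: nop_term_def b[simplified] heis_nonneg_1 heis_less lin_0[OF lin_Yl])
  have "nop k 1 ?F (- int n) 1 = (\<Sum>j\<in>?A. nop_term k 1 ?F (- int n) 1 j)"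
  proof (rule nop_eqI)
    fix j assume j: "j \<notin> ?A"
    show "nop_term k 1 ?F (- int n) 1 j = 0"
    proof (cases "j < 0")
      case True
      have "nat (- j) \<notin> {1..n}"
      proof
        assume "nat (- j) \<in> {1..n}"
        then have "j \<in> ?A" using True by (intro image_eqI[of _ _ "nat (- j)"]) auto
        then show False using j by simp
      qed
      then have "- int n - j - 1 \<ge> 0" using True by auto
      then have "?F (- int n - j - 1) 1 = 0" by (rule z)
      then show ?thesis unfolding nt by simp
    qed (simp only: nt if_False)
  qed simp
  also have "\<dots> = (\<Sum>i=1..n. nop_term k 1 ?F (- int n) 1 (- int i))"
    by (subst sum.reindex) (auto simp: inj_on_def)
  also have "\<dots> = (\<Sum>j=1..n. X j * ?F (- int (n + 1 - j)) 1)"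
  proof (rule sum.cong[OF refl])
    fix i assume i: "i \<in> {1..n}"
    then have e: "- int n - (- int i) - 1 = - int (n + 1 - i)" by auto
    show "nop_term k 1 ?F (- int n) 1 (- int i) = X i * ?F (- int (n + 1 - i)) 1"
      using i unfolding nt e by simp
  qed
  finally show ?thesis by (simp add: Yl_Cons)
qed

lemma sum_upto:
  fixes f :: "nat \<Rightarrow> vec"
  shows "(\<Sum>j=1..1. f j) = f 1" "(\<Sum>j=1..2. f j) = f 1 + f 2" "(\<Sum>j=1..3. f j) = f 1 + f 2 + f 3"
    "(\<Sum>j=1..4. f j) = f 1 + f 2 + f 3 + f 4" "(\<Sum>j=1..5. f j) = f 1 + f 2 + f 3 + f 4 + f 5"
    "(\<Sum>j=1..6. f j) = f 1 + f 2 + f 3 + f 4 + f 5 + f 6" "(\<Sum>j=1..7. f j) = f 1 + f 2 + f 3 + f 4 + f 5 + f 6 + f 7"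
  by (simp_all add: eval_nat_numeral)

lemma Yl_one_1: "n > 0 \<Longrightarrow> Yl k (replicate 1 1) 0 (- int n) 1 = X n"
  using heis_neg[of n k 1] by (simp add: Yl_single bin_def)

lemma Yl_two_1: "n > 0 \<Longrightarrow> Yl k (replicate 2 1) 0 (- int n) 1 = (\<Sum>j=1..n. X j * X (n + 1 - j))"
proof -
  assume n: "n > 0"
  have "Yl k (replicate 2 1) 0 (- int n) 1 = (\<Sum>j=1..n. X j * Yl k (replicate 1 1) 0 (- int (n + 1 - j)) 1)"
    using Yl_ones_1[OF n, of k 1] by (simp add: numeral_2_eq_2)
  also have "\<dots> = (\<Sum>j=1..n. X j * X (n + 1 - j))"
    by (rule sum.cong[OF refl], subst Yl_one_1) auto
  finally show ?thesis .
qed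

lemma Yl_three_1: "n > 0 \<Longrightarrow> Yl k (replicate 3 1) 0 (- int n) 1 = (\<Sum>j=1..n. X j * (\<Sum>i=1..n + 1 - j. X i * X (n + 1 - j + 1 - i)))"
proof -
  assume n: "n > 0"
  have "Yl k (replicate 3 1) 0 (- int n) 1 = (\<Sum>j=1..n. X j * Yl k (replicate 2 1) 0 (- int (n + 1 - j)) 1)"
    using Yl_ones_1[OF n, of k 2] by (simp add: numeral_2_eq_2 numeral_3_eq_3)
  also have "\<dots> = (\<Sum>j=1..n. X j * (\<Sum>i=1..n + 1 - j. X i * X (n + 1 - j + 1 - i)))"
    by (rule sum.cong[OF refl], subst Yl_two_1) auto
  finally show ?thesis .
qed

lemma ones_2_5: "Yl k (replicate 2 1) 0 (- 5) 1 = 2 * (X 1 * X 5) + 2 * (X 2 * X 4) + X 3 * X 3"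
  using Yl_two_1[of 5 k] unfolding sum_upto by (simp add: mult.commute)

lemma ones_2_7: "Yl k (replicate 2 1) 0 (- 7) 1 = 2 * (X 1 * X 7) + 2 * (X 2 * X 6) + 2 * (X 3 * X 5) + X 4 * X 4"
  using Yl_two_1[of 7 k] unfolding sum_upto by (simp add: mult.commute)

lemma ones_3_3: "Yl k (replicate 3 1) 0 (- 3) 1 = 3 * (X 1 * (X 1 * X 3)) + 3 * (X 1 * (X 2 * X 2))"
  using Yl_three_1[of 3 k] unfolding sum_upto by (simp add: sum_upto[simplified] algebra_simps flip: numeral_2_eq_2)

lemma ones_3_4: "Yl k (replicate 3 1) 0 (- 4) 1 = 3 * (X 1 * (X 1 * X 4)) + 6 * (X 1 * (X 2 * X 3)) + X 2 * (X 2 * X 2)"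
  using Yl_three_1[of 4 k] unfolding sum_upto by (simp add: sum_upto[simplified] algebra_simps flip: numeral_2_eq_2)

lemma ones_3_5: "Yl k (replicate 3 1) 0 (- 5) 1 = 3 * (X 1 * (X 1 * X 5)) + 6 * (X 1 * (X 2 * X 4)) + 3 * (X 1 * (X 3 * X 3)) + 3 * (X 2 * (X 2 * X 3))"
  using Yl_three_1[of 5 k] unfolding sum_upto by (simp add: sum_upto[simplified] algebra_simps flip: numeral_2_eq_2)

text \<open>Contraction constants for expanding L(-2) and the modes of J on explicit monomials;
  \<open>Qop_values\<close> does the same for the relations.\<close>

lemma Pop_values:
  "Pop k 1 1 (X 1 * u) = X 1 * Pop k 1 1 u + of_int 4 * (of_nat k * (X 3 * u))"
  "Pop k 1 1 (X 2 * u) = X 2 * Pop k 1 1 u + of_int 8 * (of_nat k * (X 4 * u))"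
  "Pop k 1 1 (X 3 * u) = X 3 * Pop k 1 1 u + of_int 12 * (of_nat k * (X 5 * u))"
  "Pop k 1 1 (X 5 * u) = X 5 * Pop k 1 1 u + of_int 20 * (of_nat k * (X 7 * u))"
  "Pop k 1 3 (X 1 * u) = X 1 * Pop k 1 3 u + of_int 18 * (of_nat k * (X 5 * u))"
  "Pop k 1 3 (X 2 * u) = X 2 * Pop k 1 3 u + of_int 64 * (of_nat k * (X 6 * u))"
  "Pop k 1 3 (X 3 * u) = X 3 * Pop k 1 3 u + of_int 150 * (of_nat k * (X 7 * u))"
  "Pop k 2 2 (X 1 * u) = X 1 * Pop k 2 2 u + of_int (- 32) * (of_nat k * (X 5 * u))"
  "Pop k 2 2 (X 2 * u) = X 2 * Pop k 2 2 u + of_int (- 120) * (of_nat k * (X 6 * u))"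
  "Pop k 2 2 (X 3 * u) = X 3 * Pop k 2 2 u + of_int (- 288) * (of_nat k * (X 7 * u))"
  by (rule Pop_X_idx; simp add: qco_def eval_nat_numeral)+

lemma Qop_values:
  "Qop k 1 1 (X 1 * u) = X 1 * Qop k 1 1 u + of_int 4 * (of_nat k * (X 4 * u))"
  "Qop k 1 1 (X 2 * u) = X 2 * Qop k 1 1 u + of_int 8 * (of_nat k * (X 5 * u))"
  "Qop k 1 1 (X 3 * u) = X 3 * Qop k 1 1 u + of_int 12 * (of_nat k * (X 6 * u))"
  "Qop k 1 2 (X 1 * u) = X 1 * Qop k 1 2 u + of_int 4 * (of_nat k * (X 5 * u))"
  "Qop k 1 2 (X 2 * u) = X 2 * Qop k 1 2 u + of_int 8 * (of_nat k * (X 6 * u))"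
  "Qop k 1 2 (X 3 * u) = X 3 * Qop k 1 2 u + of_int 12 * (of_nat k * (X 7 * u))"
  "Qop k 1 3 (X 1 * u) = X 1 * Qop k 1 3 u + of_int 26 * (of_nat k * (X 6 * u))"
  "Qop k 1 3 (X 2 * u) = X 2 * Qop k 1 3 u + of_int 84 * (of_nat k * (X 7 * u))"
  "Qop k 1 4 (X 1 * u) = X 1 * Qop k 1 4 u + of_int 32 * (of_nat k * (X 7 * u))"
  "Qop k 2 2 (X 1 * u) = X 1 * Qop k 2 2 u + of_int (- 40) * (of_nat k * (X 6 * u))"
  "Qop k 2 2 (X 2 * u) = X 2 * Qop k 2 2 u + of_int (- 144) * (of_nat k * (X 7 * u))"
  by (rule Qop_X_idx'; simp add: qco_def eval_nat_numeral)+

lemma Pop_1_values: "Pop k 1 1 1 = X 1 * (X 1 * 1)" "Pop k 1 3 1 = X 1 * (X 3 * 1)" "Pop k 2 2 1 = X 2 * (X 2 * 1)"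
  by (simp_all add: Pop_1_idx)

lemma Qop_1_idx':
  "m > 0 \<Longrightarrow> n > 0 \<Longrightarrow> m' = m + 1 \<Longrightarrow> n' = n + 1 \<Longrightarrow> i = int m \<Longrightarrow> j = int n \<Longrightarrow>
   Qop k m n 1 = of_int i * (X m' * (X n * 1)) + of_int j * (X m * (X n' * 1))"
  using Qop_1_idx by simp

lemma Qop_1_values:
  "Qop k 1 1 1 = of_int 1 * (X 2 * (X 1 * 1)) + of_int 1 * (X 1 * (X 2 * 1))"
  "Qop k 1 2 1 = of_int 1 * (X 2 * (X 2 * 1)) + of_int 2 * (X 1 * (X 3 * 1))"
  "Qop k 1 3 1 = of_int 1 * (X 2 * (X 3 * 1)) + of_int 3 * (X 1 * (X 4 * 1))"
  "Qop k 1 4 1 = of_int 1 * (X 2 * (X 4 * 1)) + of_int 4 * (X 1 * (X 5 * 1))"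
  "Qop k 1 6 1 = of_int 1 * (X 2 * (X 6 * 1)) + of_int 6 * (X 1 * (X 7 * 1))"
  "Qop k 2 2 1 = of_int 2 * (X 3 * (X 2 * 1)) + of_int 2 * (X 2 * (X 3 * 1))"
  "Qop k 2 3 1 = of_int 2 * (X 3 * (X 3 * 1)) + of_int 3 * (X 2 * (X 4 * 1))"
  by (rule Qop_1_idx'; simp)+

lemmas lin_Yl_simps = linD[OF lin_Yl] lin_of_nat[OF lin_Yl] lin_of_int[OF lin_Yl] lin_numeral[OF lin_Yl]

text \<open>4k^2 J, so that only integers and powers of k occur below. The trailing factor 1 lets
  the rules for \<open>X c * u\<close> strip every factor.\<close>

definition Jint :: "nat \<Rightarrow> vec" where
  "Jint k = X 1 * (X 1 * (X 1 * (X 1 * 1))) - 4 * (of_nat k * (X 1 * (X 3 * 1))) + 3 * (of_nat k * (X 2 * (X 2 * 1)))"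

definition Jop :: "nat \<Rightarrow> vec \<Rightarrow> vec" where
  "Jop k u = Yl k (replicate 4 1) 0 (- 1) u - 4 * (of_nat k * Pop k 1 3 u) + 3 * (of_nat k * Pop k 2 2 u)"

text \<open>J and L(-2)^2 1 have proportional x_1^4 terms, so a suitable difference is quadratic.
  The coefficient of the relation is chosen to leave only x_1 x_3; its nonzero constant makes x_1
  x_3 expressible by generators.\<close>

lemma weight_4_relation:
  "Jint k - Pop k 1 1 (Pop k 1 1 1) = 3 * (of_nat k * Qop k 1 2 1) - 18 * (of_nat k * (X 1 * X 3))"
  unfolding Jint_def Pop_1_values Pop_values Qop_1_values by (simp add: algebra_simps)

lemma Pop_cube: "Pop k 1 1 (Pop k 1 1 (Pop k 1 1 1)) = X 1 * (X 1 * (X 1 * (X 1 * (X 1 * (X 1 * 1)))))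
    + 24 * (of_nat k * (X 1 * (X 1 * (X 1 * (X 3 * 1))))) + 96 * (of_nat k * (of_nat k * (X 1 * (X 5 * 1))))
    + 32 * (of_nat k * (of_nat k * (X 3 * (X 3 * 1))))"
  unfolding Pop_1_values Pop_values lin_Yl_simps by (simp add: algebra_simps)

text \<open>The same in weight 6: after the cancellation of x_1^6 the coefficients of the relations
  solve the linear system that removes every monomial except x_1 x_5.\<close>

lemma weight_6_relation:
  "2 * (Pop k 1 1 (Jint k) - Pop k 1 1 (Pop k 1 1 (Pop k 1 1 1))) =
     9 * (of_nat k * Qop k 1 1 (X 1 * (X 2 * 1))) - 12 * (of_nat k * Qop k 1 2 (X 1 * (X 1 * 1)))
     + 204 * (of_nat k * (of_nat k * Qop k 1 4 1)) - 48 * (of_nat k * (of_nat k * Qop k 2 3 1))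
     - 1080 * (of_nat k * (of_nat k * (X 1 * X 5)))"
  unfolding Pop_cube Jint_def Pop_1_values Pop_values Qop_1_values Qop_values lin_Yl_simps by (simp add: algebra_simps)

text \<open>The expansion of 16k^4 J_(-1) J into monomials, on which the identity in weight 8 is
  checked.\<close>

lemma Jop_Jint: "Jop k (Jint k) =
    X 1 * (X 1 * (X 1 * (X 1 * (X 1 * (X 1 * (X 1 * (X 1 * 1)))))))
    + 88 * (of_nat k * (X 1 * (X 1 * (X 1 * (X 1 * (X 1 * (X 3 * 1)))))))
    + 102 * (of_nat k * (X 1 * (X 1 * (X 1 * (X 1 * (X 2 * (X 2 * 1)))))))
    - 384 * (of_nat k * (of_nat k * (X 1 * (X 1 * (X 1 * (X 5 * 1))))))
    - 80 * (of_nat k * (of_nat k * (X 1 * (X 1 * (X 3 * (X 3 * 1))))))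
    + 6624 * (of_nat k * (of_nat k * (of_nat k * (X 1 * (X 7 * 1)))))
    + 168 * (of_nat k * (of_nat k * (X 1 * (X 2 * (X 2 * (X 3 * 1))))))
    + 672 * (of_nat k * (of_nat k * (of_nat k * (X 3 * (X 5 * 1)))))
    + 288 * (of_nat k * (of_nat k * (X 1 * (X 1 * (X 2 * (X 4 * 1))))))
    + 105 * (of_nat k * (of_nat k * (X 2 * (X 2 * (X 2 * (X 2 * 1))))))
    - 3696 * (of_nat k * (of_nat k * (of_nat k * (X 2 * (X 6 * 1)))))"
proof -
  have one: "Yl k (replicate 4 1) 0 (- 1) 1 = X 1 * (X 1 * (X 1 * (X 1 * 1)))"
    using Yl_1(1)[of "replicate 4 1" k 0] by (simp add: bvec_add_mset bvec_empty eval_nat_numeral)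
  \<comment> \<open>Each rule moves alpha(z)^s past one factor; a contraction lowers s by one and
    the mode by c + 1. Only the values on 1 remain to be inserted.\<close>
  have 4: "Yl k (replicate 4 1) 0 (- 1) (X c * u) = X c * Yl k (replicate 4 1) 0 (- 1) u
      + 8 * (of_nat k * (of_nat c * Yl k (replicate 3 1) 0 (- int (c + 2)) u))" for c u
    using Yl_ones_X[of k 4 "- 1" c u] by (simp add: algebra_simps numeral_3_eq_3)
  have 3: "Yl k (replicate 3 1) 0 (- int n) (X c * u) = X c * Yl k (replicate 3 1) 0 (- int n) u
      + 6 * (of_nat k * (of_nat c * Yl k (replicate 2 1) 0 (- int (n + c + 1)) u))" for n c u
  proof -
    have "- int n - int c - 1 = - int (n + c + 1)" "(3::nat) - 1 = 2" "2 * k * c * 3 = 6 * k * c" by simp_all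
    then show ?thesis using Yl_ones_X[of k 3 "- int n" c u] by (simp only: of_nat_mult of_nat_numeral mult.assoc)
  qed
  have 2: "Yl k (replicate 2 1) 0 (- int n) (X c * u) = X c * Yl k (replicate 2 1) 0 (- int n) u
      + 4 * (of_nat k * (of_nat c * Yl k (replicate 1 1) 0 (- int (n + c + 1)) u))" for n c u
  proof -
    have "- int n - int c - 1 = - int (n + c + 1)" "(2::nat) - 1 = 1" "2 * k * c * 2 = 4 * k * c" by simp_all
    then show ?thesis using Yl_ones_X[of k 2 "- int n" c u] by (simp only: of_nat_mult of_nat_numeral mult.assoc)
  qed
  have 1: "Yl k (replicate 1 1) 0 (- int n) (X c * 1) = X c * X n" if "n > 0" for n c
    using Yl_ones_X[of k 1 "- int n" c 1] Yl_one_1[OF that, of k] that by (simp add: Yl_Nil vop_0)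
  have s3: "Yl k (replicate 3 1) 0 (- int 3) 1 = 3 * (X 1 * (X 1 * X 3)) + 3 * (X 1 * (X 2 * X 2))"
    "Yl k (replicate 3 1) 0 (- int 4) 1 = 3 * (X 1 * (X 1 * X 4)) + 6 * (X 1 * (X 2 * X 3)) + X 2 * (X 2 * X 2)"
    "Yl k (replicate 3 1) 0 (- int 5) 1 = 3 * (X 1 * (X 1 * X 5)) + 6 * (X 1 * (X 2 * X 4)) + 3 * (X 1 * (X 3 * X 3)) + 3 * (X 2 * (X 2 * X 3))"
    "Yl k (replicate 2 1) 0 (- int 5) 1 = 2 * (X 1 * X 5) + 2 * (X 2 * X 4) + X 3 * X 3"
    "Yl k (replicate 2 1) 0 (- int 7) 1 = 2 * (X 1 * X 7) + 2 * (X 2 * X 6) + 2 * (X 3 * X 5) + X 4 * X 4"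
    by (simp_all add: ones_3_3[simplified] ones_3_4[simplified] ones_3_5[simplified] ones_2_5[simplified] ones_2_7[simplified])
  have i: "(1::nat) + 2 = 3" "(3::nat) + 2 = 5" "(2::nat) + 2 = 4" "(3::nat) + 1 + 1 = 5" "(5::nat) + 1 + 1 = 7"
    "(3::nat) + 3 + 1 = 7" "(5::nat) + 3 + 1 = 9" "(4::nat) + 2 + 1 = 7" by simp_all
  have "Yl k (replicate 4 1) 0 (- 1) (X 1 * (X 1 * (X 1 * (X 1 * 1)))) =
     X 1 * (X 1 * (X 1 * (X 1 * (X 1 * (X 1 * (X 1 * (X 1 * 1)))))))
     + 96 * (of_nat k * (X 1 * (X 1 * (X 1 * (X 1 * (X 1 * (X 3 * 1)))))))
     + 96 * (of_nat k * (X 1 * (X 1 * (X 1 * (X 1 * (X 2 * (X 2 * 1)))))))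
     + 288 * (of_nat k * (of_nat k * (X 1 * (X 1 * (2 * (X 1 * X 5) + 2 * (X 2 * X 4) + X 3 * X 3)))))
     + 768 * (of_nat k * (of_nat k * (of_nat k * (X 1 * (X 7 * 1)))))"
  proof -
    have 1: "Yl k (replicate 1 1) 0 (- int 7) (X 1 * 1) = X 1 * X 7" by (rule 1) simp
    have 0: "Yl k (replicate 1 1) 0 (- int 7) 1 = X 7" by (rule Yl_one_1) simp
    show ?thesis
      unfolding 4 3 2 i one s3 1 0 by (simp add: algebra_simps)
  qed
  moreover have "Yl k (replicate 4 1) 0 (- 1) (X 1 * (X 3 * 1)) = X 1 * (X 3 * (X 1 * (X 1 * (X 1 * (X 1 * 1)))))
     + 8 * (of_nat k * (X 3 * (3 * (X 1 * (X 1 * X 3)) + 3 * (X 1 * (X 2 * X 2)))))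
     + 24 * (of_nat k * (X 1 * (3 * (X 1 * (X 1 * X 5)) + 6 * (X 1 * (X 2 * X 4)) + 3 * (X 1 * (X 3 * X 3)) + 3 * (X 2 * (X 2 * X 3)))))
     + 144 * (of_nat k * (of_nat k * (2 * (X 1 * X 7) + 2 * (X 2 * X 6) + 2 * (X 3 * X 5) + X 4 * X 4)))"
    unfolding 4 3 2 i one s3 by (simp add: algebra_simps)
  moreover have "Yl k (replicate 4 1) 0 (- 1) (X 2 * (X 2 * 1)) = X 2 * (X 2 * (X 1 * (X 1 * (X 1 * (X 1 * 1)))))
     + 32 * (of_nat k * (X 2 * (3 * (X 1 * (X 1 * X 4)) + 6 * (X 1 * (X 2 * X 3)) + X 2 * (X 2 * X 2))))
     + 192 * (of_nat k * (of_nat k * (2 * (X 1 * X 7) + 2 * (X 2 * X 6) + 2 * (X 3 * X 5) + X 4 * X 4)))"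
    unfolding 4 3 2 i one s3 by (simp add: algebra_simps)
  ultimately have A: "Yl k (replicate 4 1) 0 (- 1) (Jint k) =
     (X 1 * (X 1 * (X 1 * (X 1 * (X 1 * (X 1 * (X 1 * (X 1 * 1)))))))
     + 96 * (of_nat k * (X 1 * (X 1 * (X 1 * (X 1 * (X 1 * (X 3 * 1)))))))
     + 96 * (of_nat k * (X 1 * (X 1 * (X 1 * (X 1 * (X 2 * (X 2 * 1)))))))
     + 288 * (of_nat k * (of_nat k * (X 1 * (X 1 * (2 * (X 1 * X 5) + 2 * (X 2 * X 4) + X 3 * X 3)))))
     + 768 * (of_nat k * (of_nat k * (of_nat k * (X 1 * (X 7 * 1))))))
     - 4 * (of_nat k * (X 1 * (X 3 * (X 1 * (X 1 * (X 1 * (X 1 * 1)))))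
     + 8 * (of_nat k * (X 3 * (3 * (X 1 * (X 1 * X 3)) + 3 * (X 1 * (X 2 * X 2)))))
     + 24 * (of_nat k * (X 1 * (3 * (X 1 * (X 1 * X 5)) + 6 * (X 1 * (X 2 * X 4)) + 3 * (X 1 * (X 3 * X 3)) + 3 * (X 2 * (X 2 * X 3)))))
     + 144 * (of_nat k * (of_nat k * (2 * (X 1 * X 7) + 2 * (X 2 * X 6) + 2 * (X 3 * X 5) + X 4 * X 4)))))
     + 3 * (of_nat k * (X 2 * (X 2 * (X 1 * (X 1 * (X 1 * (X 1 * 1)))))
     + 32 * (of_nat k * (X 2 * (3 * (X 1 * (X 1 * X 4)) + 6 * (X 1 * (X 2 * X 3)) + X 2 * (X 2 * X 2))))
     + 192 * (of_nat k * (of_nat k * (2 * (X 1 * X 7) + 2 * (X 2 * X 6) + 2 * (X 3 * X 5) + X 4 * X 4)))))"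
    unfolding Jint_def lin_Yl_simps by (simp only:)
  show ?thesis
    unfolding Jop_def A unfolding Jint_def lin_Yl_simps Pop_values Pop_1_values by (simp add: algebra_simps)
qed

text \<open>J_(-1) J minus the matching multiple of L(-2)^4 1, reduced by relations to x_1 x_7. The
  constant 67824 only has to be nonzero.\<close>

lemma weight_8_relation:
  "Jop k (Jint k) - Pop k 1 1 (Pop k 1 1 (Pop k 1 1 (Pop k 1 1 1))) =
     40 * (of_nat k * (of_nat k * Qop k 1 1 (X 2 * (X 3 * 1))))
     + 41 * (of_nat k * Qop k 1 1 (X 1 * (X 1 * (X 1 * (X 2 * 1)))))
     - 200 * (of_nat k * (of_nat k * Qop k 1 2 (X 1 * (X 3 * 1))))
     + 105 * (of_nat k * (of_nat k * Qop k 1 2 (X 2 * (X 2 * 1))))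
     + 20 * (of_nat k * Qop k 1 2 (X 1 * (X 1 * (X 1 * (X 1 * 1)))))
     + 50 * (of_nat k * (of_nat k * Qop k 1 3 (X 1 * (X 2 * 1))))
     - 354 * (of_nat k * (of_nat k * Qop k 1 4 (X 1 * (X 1 * 1))))
     - 6876 * (of_nat k * (of_nat k * (of_nat k * Qop k 1 6 1)))
     + 7 * (of_nat k * (of_nat k * Qop k 2 2 (X 1 * (X 2 * 1))))
     + 67824 * (of_nat k * (of_nat k * (of_nat k * (X 1 * X 7))))"
  unfolding Jop_Jint Pop_cube lin_Yl_simps Pop_values Pop_1_values Qop_values Qop_1_values by (simp add: algebra_simps)

subsection \<open>Charge and weight\<close>

text \<open>Only a lower bound on the weight is recorded: it is stable under all operators used and
  suffices to see that L(-2)^3 e^alpha starts in weight 6.\<close>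

definition ch :: "int \<Rightarrow> nat \<Rightarrow> vec set" where
  "ch p w = vec.span {bvec (a, p) | a. 0 \<notin># a \<and> w \<le> sum_mset a}"

lemma csub_ch: "csub (ch p w)"
  unfolding ch_def by (rule csub_span)

lemma ch_bvec: "0 \<notin># a \<Longrightarrow> w \<le> sum_mset a \<Longrightarrow> bvec (a, p) \<in> ch p w"
  unfolding ch_def by (rule vec.span_base) blast

lemma ch_subset:
  assumes "csub U" "\<And>a. 0 \<notin># a \<Longrightarrow> w \<le> sum_mset a \<Longrightarrow> bvec (a, p) \<in> U"
  shows "ch p w \<subseteq> U"
proof
  fix x assume "x \<in> ch p w"
  then show "x \<in> U"
    unfolding ch_def
    by (induction rule: vec.span_induct_alt)
       (use assms in \<open>auto simp: csub_0 smul_eq intro!: csub_add csub_cst\<close>)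
qed

lemma ch_antimono: "w \<le> w' \<Longrightarrow> ch p w' \<subseteq> ch p w"
  by (rule ch_subset[OF csub_ch]) (auto intro: ch_bvec)

lemma ch_X: assumes "u \<in> ch p w" "c > 0" shows "X c * u \<in> ch p (w + c)"
proof -
  have "ch p w \<subseteq> {v. X c * v \<in> ch p (w + c)}"
    by (rule ch_subset[OF csub_vimage_X[OF csub_ch]])
       (use assms(2) in \<open>auto simp: bvec_add_mset[symmetric] intro!: ch_bvec\<close>)
  then show ?thesis using assms(1) by blast
qed

lemma ch_ee: "ee p \<in> ch p 0"
  using ch_bvec[of "{#}" 0 p] by (simp add: bvec_empty)

lemma csub_vimage_lin: "lin F \<Longrightarrow> csub U \<Longrightarrow> csub {v. F v \<in> U}"
  by (auto simp: csub_def linD)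

lemma Pop_ch:
  assumes "m > 0" "n > 0" "u \<in> ch p w"
  shows "Pop k m n u \<in> ch p (w + m + n)"
proof -
  have b: "Pop k m n (bvec (a, p)) \<in> ch p (sum_mset a + m + n)" if "0 \<notin># a" for a
    using that
  proof (induction a)
    case empty
    have "X m * (X n * ee p) \<in> ch p (0 + n + m)" "X (m + n) * ee p \<in> ch p (0 + (m + n))"
      by (rule ch_X[OF ch_X[OF ch_ee assms(2)] assms(1)], rule ch_X[OF ch_ee]) (use assms in simp)
    then show ?case
      unfolding bvec_empty Pop_ee[OF assms(1,2)]
      by (intro csub_add[OF csub_ch] csub_of_int[OF csub_ch]) (simp_all add: ac_simps)
  next
    case (add c a)
    then have c: "c > 0" "0 \<notin># a" by auto
    have "X c * Pop k m n (bvec (a, p)) \<in> ch p (sum_mset a + m + n + c)"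
      using add.IH c by (intro ch_X) auto
    moreover have "X (m + n + c) * bvec (a, p) \<in> ch p (sum_mset a + (m + n + c))"
      using c by (intro ch_X ch_bvec) auto
    ultimately show ?case
      unfolding bvec_add_mset Pop_X[OF assms(1,2)]
      by (intro csub_add[OF csub_ch] csub_of_int[OF csub_ch]) (simp_all add: ac_simps)
  qed
  have "ch p w \<subseteq> {v. Pop k m n v \<in> ch p (w + m + n)}"
  proof (rule ch_subset[OF csub_vimage_lin[OF lin_Yl csub_ch]], rule CollectI)
    fix a :: "nat multiset" assume a: "0 \<notin># a" "w \<le> sum_mset a"
    show "Pop k m n (bvec (a, p)) \<in> ch p (w + m + n)"
      using b[OF a(1)] ch_antimono[of "w + m + n" "sum_mset a + m + n" p] a(2) by auto
  qed
  then show ?thesis using assms(3) by blast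
qed

lemma csub_M1: "csub M1"
  unfolding csub_def
proof (intro conjI ballI allI)
  show "0 \<in> M1" by (simp add: M1_def)
  fix u assume u: "u \<in> M1"
  show "cst c * u \<in> M1" for c
    using u VL_cst_mult[of u c] by (auto simp: M1_def in_keys_iff lookup_cst_mult)
  fix v assume "v \<in> M1"
  then show "u + v \<in> M1" using u VL_add[of u v] keys_add[of u v] by (auto simp: M1_def)
qed

lemma M1_eq_ch: "M1 = ch 0 0"
proof
  show "ch 0 0 \<subseteq> M1"
    by (rule ch_subset[OF csub_M1]) (auto simp: M1_def bvec_def VL_def)
  show "M1 \<subseteq> ch 0 0"
  proof
    fix v assume v: "v \<in> M1"
    then have "v \<in> VL" by (simp add: M1_def)
    then show "v \<in> ch 0 0"
    proof (induction v rule: VL_induct)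
      case (bvec a m)
      then have "m = 0" using v by (auto simp: M1_def)
      then show ?case using bvec by (simp add: ch_bvec)
    qed (auto intro: csub_0[OF csub_ch] csub_add[OF csub_ch] csub_cst[OF csub_ch])
  qed
qed

lemma csub_M1plus: "csub M1plus"
  unfolding csub_def M1plus_def using csubD(1-3)[OF csub_M1] by auto

lemma Lm2_eq: "Lm2 k v = cst (1 / (4 * of_nat k)) * Pop k 1 1 v"
proof -
  have "mode k (bvec ({#1, 1#}, 0)) (- 1) v = Pop k 1 1 v"
    by (simp add: mode_bvec)
  then show ?thesis
    by (simp add: Lm2_def omega_def smul_eq lin_cst[OF lin_mode])
qed

lemma lin_Lm2: "lin (Lm2 k)"
  unfolding Lm2_eq[abs_def] by (intro lin_mult lin_Yl)

lemma theta_Lm2: "theta (Lm2 k v) = Lm2 k (theta v)"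
  by (simp add: Lm2_eq theta_Pop)

lemma Lm2_power_add: "(Lm2 k ^^ i) (u + v) = (Lm2 k ^^ i) u + (Lm2 k ^^ i) v"
  by (induction i) (simp_all add: lin_add[OF lin_Lm2])

lemma theta_Lm2_power: "theta ((Lm2 k ^^ i) v) = (Lm2 k ^^ i) (theta v)"
  by (induction i) (simp_all add: theta_Lm2)

lemma Lm2_ch: "u \<in> ch p w \<Longrightarrow> Lm2 k u \<in> ch p (w + 2)"
  using Pop_ch[of 1 1 u p w k] csub_cst[OF csub_ch] by (simp add: Lm2_eq)

lemma Lm2_power_ch: "u \<in> ch p w \<Longrightarrow> (Lm2 k ^^ i) u \<in> ch p (w + 2 * i)"
proof (induction i)
  case (Suc i) then show ?case using Lm2_ch[of "(Lm2 k ^^ i) u" p "w + 2 * i" k] by simp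
qed simp

lemma Pop_Lm2: "k > 0 \<Longrightarrow> Pop k 1 1 v = cst (4 * of_nat k) * Lm2 k v"
  unfolding Lm2_eq by (rule cst_mult_cancel[symmetric]) simp

lemma Pop_Lm2_power: "k > 0 \<Longrightarrow> (Pop k 1 1 ^^ i) v = cst ((4 * of_nat k) ^ i) * (Lm2 k ^^ i) v"
proof (induction i)
  case (Suc i)
  then have "(Pop k 1 1 ^^ Suc i) v = cst ((4 * of_nat k) ^ i) * Pop k 1 1 ((Lm2 k ^^ i) v)"
    by (simp add: lin_cst[OF lin_Yl])
  then show ?case using Pop_Lm2[OF Suc.prems, of "(Lm2 k ^^ i) v"]
    by (simp add: cst_mult mult.assoc[symmetric])
qed simp

subsection \<open>The charge one part\<close>

text \<open>Trades x_2 e^alpha for L(-2) e^alpha modulo a derivative, as 4k - 1 is nonzero.\<close>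

lemma charge_1_weight_2:
  "Pop k 1 1 (ee 1) = tder (X 1 * ee 1) + of_int (4 * int k - 1) * (X 2 * ee 1)"
proof -
  have "Pop k 1 1 (ee 1) = X 1 * (X 1 * ee 1) + of_int (2 * int k * 1 * 2) * (X 2 * ee 1)"
    using Pop_ee[of 1 1 k 1] unfolding qco_11 by (simp flip: numeral_2_eq_2)
  moreover have "tder (X 1 * ee 1) = X 1 * tder (ee 1) + of_int (int 1) * (X 2 * ee 1)"
    by (rule tder_X_idx) simp
  ultimately show ?thesis unfolding tder_ee by (simp add: algebra_simps)
qed

text \<open>Eliminates the longer monomials of L(-2)^2 e^alpha in favour of x_4 e^alpha. The factors
  4k - 1 and 4k - 9 are nonzero because 4k is divisible by 4.\<close>

lemma charge_1_weight_4:
  "Pop k 1 1 (Pop k 1 1 (ee 1)) = tder (X 1 * (X 1 * (X 1 * ee 1))) + of_int (8 * int k - 3) * tder (X 1 * (X 2 * ee 1))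
     + of_int (16 * int k ^ 2 - 8 * int k + 3) * Qop k 1 2 (ee 1) + of_int (8 * int k - 32 * int k ^ 2) * tder (X 3 * ee 1)
     - of_int (4 * int k * (4 * int k - 1) * (4 * int k - 9)) * (X 4 * ee 1)"
proof -
  have P: "Pop k 1 1 (ee 1) = X 1 * (X 1 * ee 1) + 4 * (of_nat k * (X 2 * ee 1))"
    using Pop_ee[of 1 1 k 1] unfolding qco_11 by (simp add: mult.assoc flip: numeral_2_eq_2)
  have "qco 1 1 2 0 = 2" by (simp add: qco_def eval_nat_numeral)
  then have Q: "Qop k 1 2 (ee 1) = X 2 * (X 2 * ee 1) + 2 * (X 1 * (X 3 * ee 1)) + 4 * (of_nat k * (X 4 * ee 1))"
    using Qop_ee_idx[of 1 2 2 3 4 k 1] by (simp add: mult.assoc)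
  have t: "tder (X 1 * u) = X 1 * tder u + X 2 * u" "tder (X 2 * u) = X 2 * tder u + 2 * (X 3 * u)"
    "tder (X 3 * u) = X 3 * tder u + 3 * (X 4 * u)" for u
    using tder_X_idx[of 2 1 u] tder_X_idx[of 3 2 u] tder_X_idx[of 4 3 u] by simp_all
  show ?thesis
    unfolding P Q lin_Yl_simps Pop_values t tder_ee
    unfolding P by (simp add: algebra_simps power2_eq_square)
qed

text \<open>The surviving vectors x_W e^alpha in weights 2 and 4 are exchanged for powers of L(-2)
  by the two preceding identities; weight 0 is the zeroth power.\<close>

lemma charge_1_span:
  assumes k: "k \<ge> 2" and a: "0 \<notin># a"
  shows "bvec (a, 1) \<in> modC2 k {(Lm2 k ^^ i) (ee 1) | i. i \<le> 2}"
proof -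
  let ?Z = "modC2 k {(Lm2 k ^^ i) (ee 1) | i. i \<le> 2}"
  note Z = csub_modC2[of k "{(Lm2 k ^^ i) (ee 1) | i. i \<le> 2}"]
  have S: "x \<in> symC2 k \<Longrightarrow> x \<in> ?Z" for x using symC2_subset_modC2 by blast
  have t: "tder f \<in> ?Z" if "f \<in> VL" for f using S[OF tder_symC2[OF that]] .
  have L: "(Lm2 k ^^ i) (ee 1) \<in> ?Z" if "i \<le> 2" for i by (rule modC2_base) (use that in auto)
  have k0: "k > 0" using k by simp
  have i: "of_int c * x \<in> ?Z \<Longrightarrow> c \<noteq> 0 \<Longrightarrow> x \<in> ?Z" for c x
    using csub_cst_iff[OF Z, of "of_int c" x] by simp
  have P1: "Pop k 1 1 (ee 1) \<in> ?Z"
    using csub_cst[OF Z L[of 1]] Pop_Lm2_power[OF k0, of 1 "ee 1"] by simp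
  have P2: "Pop k 1 1 (Pop k 1 1 (ee 1)) \<in> ?Z"
    using csub_cst[OF Z L[of 2]] Pop_Lm2_power[OF k0, of 2 "ee 1"] by (simp add: numeral_2_eq_2)
  have x2: "X 2 * ee 1 \<in> ?Z"
  proof -
    have "of_int (4 * int k - 1) * (X 2 * ee 1) = Pop k 1 1 (ee 1) - tder (X 1 * ee 1)"
      unfolding charge_1_weight_2 by simp
    also have "\<dots> \<in> ?Z" by (intro csub_diff[OF Z] P1 t VL_mult) auto
    finally show ?thesis using i[of "4 * int k - 1"] k by auto
  qed
  have x4: "X 4 * ee 1 \<in> ?Z"
  proof -
    have "of_int (4 * int k * (4 * int k - 1) * (4 * int k - 9)) * (X 4 * ee 1) = tder (X 1 * (X 1 * (X 1 * ee 1))) + of_int (8 * int k - 3) * tder (X 1 * (X 2 * ee 1))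
     + of_int (16 * int k ^ 2 - 8 * int k + 3) * Qop k 1 2 (ee 1) + of_int (8 * int k - 32 * int k ^ 2) * tder (X 3 * ee 1)
     - Pop k 1 1 (Pop k 1 1 (ee 1))"
      unfolding charge_1_weight_4 by (simp only: diff_diff_eq2 add_diff_cancel_left')
    also have "\<dots> \<in> ?Z"
      by (intro csub_diff[OF Z] csub_add[OF Z] csub_of_int[OF Z] P2 t S[OF Qop_symC2] VL_mult) auto
    finally have "of_int (4 * int k * (4 * int k - 1) * (4 * int k - 9)) * (X 4 * ee 1) \<in> ?Z" .
    moreover have "4 * int k * (4 * int k - 1) * (4 * int k - 9) \<noteq> 0"
    proof -
      have "4 * int k \<noteq> 9" "4 * int k \<noteq> 1" by presburger+
      then show ?thesis using k by auto
    qed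
    ultimately show ?thesis using i by blast
  qed
  show ?thesis
  proof (cases "a = {#}")
    case True then show ?thesis using L[of 0] by (simp add: bvec_empty)
  next
    case False
    define W where "W = sum_mset a"
    have "W \<noteq> 0" using False a by (metis W_def size_le_sum_mset le_zero_eq size_eq_0_iff_empty)
    then have "W = 2 \<or> W = 4 \<or> odd W \<or> W \<ge> 6" by presburger
    then have "X W * ee 1 \<in> ?Z"
      using x2 x4 S[OF charge_1_generator[OF k, of W]] by blast
    then have "modC2 k {X W * ee 1} \<subseteq> ?Z"
      using S by (intro modC2_subset Z) auto
    then show ?thesis using charge_1_reduction[OF a False, of k] by (auto simp: W_def)
  qed
qed

lemma ch_1_6_symC2: assumes "k \<ge> 2" shows "ch 1 6 \<subseteq> symC2 k"
proof (rule ch_subset[OF csub_symC2])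
  fix a :: "nat multiset" assume a: "0 \<notin># a" "6 \<le> sum_mset a"
  then have "X (sum_mset a) * ee 1 \<in> symC2 k"
    using charge_1_generator[OF assms] by blast
  then have "modC2 k {X (sum_mset a) * ee 1} \<subseteq> symC2 k"
    by (intro modC2_subset csub_symC2) auto
  moreover have "a \<noteq> {#}" using a(2) by auto
  ultimately show "bvec (a, 1) \<in> symC2 k" using charge_1_reduction[OF a(1), of k] by blast
qed

section \<open>V_L^+(1) as the symmetrization of charge one\<close>

lemma Lm2_power_Evec: "(Lm2 k ^^ i) Evec = (Lm2 k ^^ i) (ee 1) + theta ((Lm2 k ^^ i) (ee 1))"
  by (simp add: Evec_eq Lm2_power_add theta_Lm2_power)

lemma tensor_e_bvec: "tensor_e (bvec (a, m)) p = bvec (a, p)"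
  by (simp add: tensor_e_def)

lemma lin_tensor_e: "lin (\<lambda>f. tensor_e f p)"
  unfolding tensor_e_def by (rule lin_lext)

lemma theta_tensor_e:
  assumes "f \<in> M1" shows "theta (tensor_e f p) = tensor_e (theta f) (- p)"
proof -
  have "csub {f. theta (tensor_e f p) = tensor_e (theta f) (- p)}"
    by (auto simp: csub_def linD[OF lin_tensor_e])
  then have "ch 0 0 \<subseteq> {f. theta (tensor_e f p) = tensor_e (theta f) (- p)}"
    by (rule ch_subset) (simp add: tensor_e_bvec theta_bvec lin_cst[OF lin_tensor_e])
  then show ?thesis using assms M1_eq_ch by blast
qed

text \<open>The involution exchanges charges 1 and -1, so the charge 1 half determines the vector.
  This is the form in which \<open>symC2\<close> can be applied.\<close>

lemma VLplus1_subset: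
  assumes "x \<in> VLplus1" obtains y where "y \<in> ch 1 0" "x = y + theta y"
proof -
  obtain f g where x: "x = (tensor_e f 1 + tensor_e f (- 1)) + (tensor_e g 1 - tensor_e g (- 1))"
    and f: "f \<in> M1" "theta f = f" and g: "g \<in> M1" "theta g = - g"
    using assms by (auto simp: VLplus1_def M1plus_def M1minus_def)
  have t: "tensor_e h 1 \<in> ch 1 0" if "h \<in> M1" for h
  proof -
    have "ch 0 0 \<subseteq> {h. tensor_e h 1 \<in> ch 1 0}"
      by (rule ch_subset[OF csub_vimage_lin[OF lin_tensor_e csub_ch]]) (simp add: tensor_e_bvec ch_bvec)
    then show ?thesis using that M1_eq_ch by blast
  qed
  show thesis
  proof (rule that)
    show "tensor_e f 1 + tensor_e g 1 \<in> ch 1 0" using t f g by (intro csub_add[OF csub_ch]) auto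
    show "x = (tensor_e f 1 + tensor_e g 1) + theta (tensor_e f 1 + tensor_e g 1)"
      unfolding x using f g by (simp add: theta_tensor_e lin_minus[OF lin_tensor_e])
  qed
qed

lemma csub_M1minus: "csub M1minus"
  unfolding csub_def M1minus_def using csubD(1-3)[OF csub_M1] by auto

lemma csub_VLplus1: "csub VLplus1"
proof -
  define H where "H f g = (tensor_e f 1 + tensor_e f (-1)) + (tensor_e g 1 - tensor_e g (-1))" for f g
  have I: "H f g \<in> VLplus1" if "f \<in> M1plus" "g \<in> M1minus" for f g
    using that by (auto simp: VLplus1_def H_def)
  have E: "\<exists>f\<in>M1plus. \<exists>g\<in>M1minus. x = H f g" if "x \<in> VLplus1" for x
    using that by (auto simp: VLplus1_def H_def)
  note P = csubD(1-3)[OF csub_M1plus] csubD(1-3)[OF csub_M1minus]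
  show ?thesis
    unfolding csub_def
  proof (intro conjI ballI allI)
    show "0 \<in> VLplus1" using I[OF P(1,4)] by (simp add: H_def lin_0[OF lin_tensor_e])
    fix u assume "u \<in> VLplus1"
    then obtain f g where u: "f \<in> M1plus" "g \<in> M1minus" "u = H f g" using E by blast
    show "cst c * u \<in> VLplus1" for c
    proof -
      have "cst c * u = H (cst c * f) (cst c * g)"
        by (simp add: u H_def lin_cst[OF lin_tensor_e] distrib_left right_diff_distrib)
      then show ?thesis using I P(3,6) u by simp
    qed
    fix v assume "v \<in> VLplus1"
    then obtain f' g' where v: "f' \<in> M1plus" "g' \<in> M1minus" "v = H f' g'" using E by blast
    have "u + v = H (f + f') (g + g')"
      by (simp add: u v H_def lin_add[OF lin_tensor_e] algebra_simps)
    then show "u + v \<in> VLplus1" using I P(2,5) u v by simp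
  qed
qed

lemma ch_1_VLplus1: assumes "y \<in> ch 1 0" shows "y + theta y \<in> VLplus1"
proof -
  have "csub {y. y + theta y \<in> VLplus1}"
    by (rule csub_vimage_lin[of "\<lambda>y. y + theta y"]) (auto intro: lin_theta csub_VLplus1)
  then have "ch 1 0 \<subseteq> {y. y + theta y \<in> VLplus1}"
  proof (rule ch_subset, intro CollectI)
    fix a :: "nat multiset" assume a: "0 \<notin># a"
    have M: "bvec (a, 0) \<in> M1" using a by (simp add: M1_eq_ch ch_bvec)
    show "bvec (a, 1) + theta (bvec (a, 1)) \<in> VLplus1"
    proof (cases "even (size a)")
      case True
      then have "bvec (a, 0) \<in> M1plus" using M by (simp add: M1plus_def theta_bvec)
      moreover have "bvec (a, 1) + theta (bvec (a, 1)) =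
        (tensor_e (bvec (a, 0)) 1 + tensor_e (bvec (a, 0)) (- 1)) + (tensor_e 0 1 - tensor_e 0 (- 1))"
        using True by (simp add: tensor_e_bvec theta_bvec lin_0[OF lin_tensor_e])
      ultimately show ?thesis using csub_0[OF csub_M1minus] unfolding VLplus1_def by blast
    next
      case False
      then have "bvec (a, 0) \<in> M1minus" using M by (simp add: M1minus_def theta_bvec cst_minus)
      moreover have "bvec (a, 1) + theta (bvec (a, 1)) =
        (tensor_e 0 1 + tensor_e 0 (- 1)) + (tensor_e (bvec (a, 0)) 1 - tensor_e (bvec (a, 0)) (- 1))"
        using False by (simp add: tensor_e_bvec theta_bvec lin_0[OF lin_tensor_e] cst_minus)
      ultimately show ?thesis using csub_0[OF csub_M1plus] unfolding VLplus1_def by blast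
    qed
  qed
  then show ?thesis using assms by blast
qed

lemma span_subset:
  assumes "csub U" "A \<subseteq> U" shows "vec.span A \<subseteq> U"
proof
  fix x assume "x \<in> vec.span A"
  then show "x \<in> U"
    by (induction rule: vec.span_induct_alt)
       (use assms in \<open>auto simp: csub_0 smul_eq intro!: csub_add csub_cst\<close>)
qed

lemma charge_1_part:
  assumes "k \<ge> 2"
  shows "setsum VLplus1 (C2 k) = setsum (cspan {(Lm2 k ^^ i) Evec | i. i \<le> 2}) (C2 k)"
proof -
  let ?B = "{(Lm2 k ^^ i) (ee 1) | i. i \<le> 2}" and ?E = "{(Lm2 k ^^ i) Evec | i. i \<le> 2}"
  have 1: "\<exists>u\<in>vec.span ?E. \<exists>c\<in>C2 k. x = u + c" if x: "x \<in> VLplus1" for x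
  proof -
    obtain y where y: "y \<in> ch 1 0" "x = y + theta y" using VLplus1_subset[OF x] .
    have "ch 1 0 \<subseteq> modC2 k ?B"
      by (rule ch_subset[OF csub_modC2]) (rule charge_1_span[OF assms])
    then obtain u s where us: "u \<in> vec.span ?B" "s \<in> symC2 k" "y = u + s"
      using y(1) unfolding modC2_def by blast
    \<comment> \<open>The decomposition found in charge 1 is symmetrized term by term: generators
      become powers of L(-2) on E, and the remainder lands in C_2.\<close>
    have "vec.span ?B \<subseteq> {u. u + theta u \<in> vec.span ?E}"
    proof (rule span_subset)
      show "csub {u. u + theta u \<in> vec.span ?E}"
        by (rule csub_vimage_lin[of "\<lambda>y. y + theta y"]) (auto intro: lin_theta csub_span)
      show "?B \<subseteq> {u. u + theta u \<in> vec.span ?E}"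
      proof clarify
        fix i :: nat assume "i \<le> 2"
        then have "(Lm2 k ^^ i) Evec \<in> vec.span ?E" by (intro vec.span_base) blast
        then show "(Lm2 k ^^ i) (ee 1) + theta ((Lm2 k ^^ i) (ee 1)) \<in> vec.span ?E"
          by (simp only: Lm2_power_Evec)
      qed
    qed
    then have "u + theta u \<in> vec.span ?E" using us by blast
    moreover have "s + theta s \<in> C2 k" using us by (simp add: symC2_def)
    moreover have "x = (u + theta u) + (s + theta s)" by (simp add: y us)
    ultimately show ?thesis by blast
  qed
  have 2: "vec.span ?E \<subseteq> VLplus1"
  proof (rule span_subset[OF csub_VLplus1])
    show "?E \<subseteq> VLplus1"
    proof clarify
      fix i
      have "(Lm2 k ^^ i) (ee 1) \<in> ch 1 (0 + 2 * i)" by (rule Lm2_power_ch[OF ch_ee])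
      then have "(Lm2 k ^^ i) (ee 1) \<in> ch 1 0" using ch_antimono[of 0 "0 + 2 * i" 1] by blast
      then show "(Lm2 k ^^ i) Evec \<in> VLplus1" unfolding Lm2_power_Evec by (rule ch_1_VLplus1)
    qed
  qed
  have 3: "x + c \<in> setsum (vec.span ?E) (C2 k)" if x: "x \<in> VLplus1" and c: "c \<in> C2 k" for x c
  proof -
    obtain u c' where "u \<in> vec.span ?E" "c' \<in> C2 k" "x = u + c'" using 1[OF x] by blast
    then show ?thesis
      unfolding setsum_def using csub_add[OF csub_C2, of c' k c] c
      by (intro CollectI exI[of _ u] exI[of _ "c' + c"]) (simp add: add.assoc)
  qed
  have "setsum VLplus1 (C2 k) \<subseteq> setsum (vec.span ?E) (C2 k)"
    unfolding setsum_def[of VLplus1] using 3 by blast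
  moreover have "setsum (vec.span ?E) (C2 k) \<subseteq> setsum VLplus1 (C2 k)"
    using 2 unfolding setsum_def by blast
  ultimately show ?thesis unfolding cspan_eq by blast
qed

lemma Lm2_cube_Evec: assumes "k \<ge> 2" shows "(Lm2 k ^^ 3) Evec \<in> C2 k"
proof -
  have "(Lm2 k ^^ 3) (ee 1) \<in> ch 1 (0 + 2 * 3)" by (rule Lm2_power_ch[OF ch_ee])
  then have "(Lm2 k ^^ 3) (ee 1) \<in> symC2 k" using ch_1_6_symC2[OF assms] by auto
  then show ?thesis unfolding Lm2_power_Evec symC2_def by simp
qed

subsection \<open>The charge zero part\<close>

lemma Pop_lead:
  assumes "csub U" "0 \<notin># a"
    "\<And>b. 0 \<notin># b \<Longrightarrow> sum_mset b = sum_mset a + 2 \<Longrightarrow> size b \<le> size a \<Longrightarrow> bvec (b, 0) \<in> U"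
  shows "Pop k 1 1 (bvec (a, 0)) - X 1 * (X 1 * bvec (a, 0)) \<in> U"
  using assms
proof (induction a arbitrary: U)
  case empty
  then show ?case using Pop_1_idx[of 1 1 k] by (simp add: bvec_empty csub_0)
next
  case (add c a)
  have c: "c > 0" "0 \<notin># a" using add.prems(2) by auto
  let ?d = "\<lambda>a. Pop k 1 1 (bvec (a, 0)) - X 1 * (X 1 * bvec (a, 0))"
  have "?d a \<in> {v. X c * v \<in> U}"
  proof (rule add.IH[OF csub_vimage_X[OF add.prems(1)] c(2)])
    fix b :: "nat multiset" assume b: "0 \<notin># b" "sum_mset b = sum_mset a + 2" "size b \<le> size a"
    then have "bvec (add_mset c b, 0) \<in> U"
      using c by (intro add.prems(3)) auto
    then show "bvec (b, 0) \<in> {v. X c * v \<in> U}" by (simp add: bvec_add_mset)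
  qed
  then have 1: "X c * ?d a \<in> U" by simp
  have "bvec (add_mset (c + 2) a, 0) \<in> U"
    using c by (intro add.prems(3)) auto
  then have 2: "of_int (2 * int k * int c * 2) * (X (1 + 1 + c) * bvec (a, 0)) \<in> U"
    unfolding bvec_add_mset by (intro csub_of_int[OF add.prems(1)]) (simp add: add.commute)
  have "Pop k 1 1 (X c * bvec (a, 0)) = X c * Pop k 1 1 (bvec (a, 0)) + of_int (2 * int k * int c * 2) * (X (1 + 1 + c) * bvec (a, 0))"
    using Pop_X[of 1 1 k c "bvec (a, 0)", OF zero_less_one zero_less_one] unfolding qco_11 .
  then have "?d (add_mset c a) = X c * ?d a + of_int (2 * int k * int c * 2) * (X (1 + 1 + c) * bvec (a, 0))"
    unfolding bvec_add_mset by (simp add: algebra_simps)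
  then show ?case using csub_add[OF add.prems(1) 1 2] by (simp only:)
qed

text \<open>4k L(-2) is multiplication by x_1^2 up to shorter monomials. This is how x_1^(2m) is
  exchanged for L(-2)^m 1.\<close>

lemma leads_Pop: assumes "leads n v c" shows "leads (n + 2) (Pop k 1 1 v) c"
proof -
  note L = csub_low[of "n + 2"]
  have b: "Pop k 1 1 (bvec (a, 0)) - X 1 * (X 1 * bvec (a, 0)) \<in> low (n + 2)" if "0 \<notin># a" "sum_mset a = n" for a
  proof (rule Pop_lead[OF L that(1)])
    fix b :: "nat multiset" assume "0 \<notin># b" "sum_mset b = sum_mset a + 2" "size b \<le> size a"
    moreover have "size a \<le> n" using size_le_sum_mset[OF that(1)] that(2) by simp
    ultimately show "bvec (b, 0) \<in> low (n + 2)" using that(2) by (intro low_bvec) auto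
  qed
  have "low n \<subseteq> {v. Pop k 1 1 v \<in> low (n + 2)}"
  proof (rule low_subset[OF csub_vimage_lin[OF lin_Yl L]], rule CollectI)
    fix a :: "nat multiset" assume a: "0 \<notin># a" "sum_mset a = n" "size a < n"
    have "X 1 * (X 1 * bvec (a, 0)) \<in> low (n + 2)"
      unfolding bvec_add_mset[symmetric] using a by (intro low_bvec) auto
    then show "Pop k 1 1 (bvec (a, 0)) \<in> low (n + 2)"
      using csub_diff_iff[OF L] b[OF a(1,2)] by blast
  qed
  then have 1: "Pop k 1 1 (v - cst c * X 1 ^ n) \<in> low (n + 2)" using assms by (auto simp: leads_def)
  have "Pop k 1 1 (X 1 ^ n) - X 1 * (X 1 * X 1 ^ n) \<in> low (n + 2)"
    unfolding X1_power by (rule b) auto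
  then have 2: "cst c * (Pop k 1 1 (X 1 ^ n) - X 1 * (X 1 * X 1 ^ n)) \<in> low (n + 2)"
    by (rule csub_cst[OF L])
  have "Pop k 1 1 v - cst c * X 1 ^ (n + 2) =
     Pop k 1 1 (v - cst c * X 1 ^ n) + cst c * (Pop k 1 1 (X 1 ^ n) - X 1 * (X 1 * X 1 ^ n))"
    by (simp add: lin_diff[OF lin_Yl] lin_cst[OF lin_Yl] right_diff_distrib)
  then show ?thesis unfolding leads_def using csub_add[OF L 1 2] by simp
qed

lemma leads_Lm2_power: "leads (2 * m) ((Lm2 k ^^ m) 1) ((1 / (4 * of_nat k)) ^ m)"
proof (induction m)
  case 0 then show ?case using leads_1 by simp
next
  case (Suc m)
  from leads_cst[OF leads_Pop[OF Suc], of "1 / (4 * of_nat k)" k]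
  show ?case by (simp add: Lm2_eq)
qed

lemma theta_1 [simp]: "theta 1 = 1"
  using theta_ee[of 0] by simp

lemma Lm2_power_vac_M1plus: "(Lm2 k ^^ m) 1 \<in> M1plus"
proof -
  have "(Lm2 k ^^ m) (ee 0) \<in> ch 0 (0 + 2 * m)" by (rule Lm2_power_ch[OF ch_ee])
  then have "(Lm2 k ^^ m) 1 \<in> M1" using ch_antimono[of 0 "0 + 2 * m" 0] by (auto simp: M1_eq_ch)
  then show ?thesis by (simp add: M1plus_def theta_Lm2_power)
qed

lemma Lm2_M1plus: "v \<in> M1plus \<Longrightarrow> Lm2 k v \<in> M1plus"
  using Lm2_ch[of v 0 0 k] ch_antimono[of 0 "0 + 2" 0] by (auto simp: M1plus_def M1_eq_ch theta_Lm2)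

lemma M1plus_1: "1 \<in> M1plus"
  using Lm2_power_vac_M1plus[where m = 0] by simp

lemma M1plus_pair: "u \<in> M1plus \<Longrightarrow> a > 0 \<Longrightarrow> b > 0 \<Longrightarrow> X a * (X b * u) \<in> M1plus"
  using ch_X[OF ch_X[of u 0 0 b], of a] ch_antimono[of 0 "0 + b + a" 0]
  by (auto simp: M1plus_def M1_eq_ch)

lemma M1plus_scale:
  "u \<in> M1plus \<Longrightarrow> of_nat n * u \<in> M1plus" "u \<in> M1plus \<Longrightarrow> numeral w * u \<in> M1plus"
  by (erule csub_of_nat[OF csub_M1plus], erule csub_numeral[OF csub_M1plus])

lemma Jint_eq: assumes "k > 0" shows "Jint k = cst (4 * of_nat k ^ 2) * Jvec k"
proof -
  have k: "of_nat k \<noteq> (0 :: complex)" using assms by simp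
  have c: "(4 * of_nat k ^ 2) * (1 / (4 * of_nat k ^ 2)) = (1 :: complex)"
    "(4 * of_nat k ^ 2) * (1 / of_nat k) = (4 * of_nat k :: complex)"
    "(4 * of_nat k ^ 2) * (3 / (4 * of_nat k)) = (3 * of_nat k :: complex)"
    using k by (simp_all add: power2_eq_square)
  have "cst (4 * of_nat k ^ 2) * Jvec k = cst ((4 * of_nat k ^ 2) * (1 / (4 * of_nat k ^ 2))) * bvec ({#1, 1, 1, 1#}, 0)
      - cst ((4 * of_nat k ^ 2) * (1 / of_nat k)) * bvec ({#3, 1#}, 0)
      + cst ((4 * of_nat k ^ 2) * (3 / (4 * of_nat k))) * bvec ({#2, 2#}, 0)"
    unfolding Jvec_def smul_eq cst_mult[of "4 * of_nat k ^ 2"] by (simp only: distrib_left right_diff_distrib mult.assoc)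
  also have "\<dots> = Jint k"
    unfolding c Jint_def bvec_add_mset bvec_empty by (simp add: cst_mult algebra_simps)
  finally show ?thesis by simp
qed

lemma Jint_M1plus: "Jint k \<in> M1plus"
  unfolding Jint_def
  by (intro csub_add[OF csub_M1plus] csub_diff[OF csub_M1plus] M1plus_scale M1plus_pair M1plus_1) simp_all

lemma Jop_M1plus: "Jop k (Jint k) \<in> M1plus"
  unfolding Jop_Jint
  by (intro csub_add[OF csub_M1plus] csub_diff[OF csub_M1plus] M1plus_scale M1plus_pair M1plus_1) simp_all

lemma Jop_eq: assumes "k > 0" shows "Jop k u = cst (4 * of_nat k ^ 2) * mode k (Jvec k) (- 1) u"
proof -
  have "mode k (Jint k) (- 1) u = Jop k u"
  proof -
    have J: "Jint k = bvec ({#1, 1, 1, 1#}, 0) - 4 * (of_nat k * bvec ({#3, 1#}, 0)) + 3 * (of_nat k * bvec ({#2, 2#}, 0))"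
      unfolding Jint_def bvec_add_mset bvec_empty ee_0 by (simp only: mult.left_commute[of "X 3"])
    have s: "sorted_list_of_multiset {#1, 1, 1, 1::nat#} = replicate 4 1" "sorted_list_of_multiset {#3, 1::nat#} = [1, 3]"
      "sorted_list_of_multiset {#2, 2::nat#} = [2, 2]"
      by (simp_all add: numeral_eq_Suc)
    show ?thesis
      unfolding J Jop_def linD[OF lin_mode] lin_numeral[OF lin_mode] lin_of_nat[OF lin_mode] mode_bvec s ..
  qed
  then show ?thesis unfolding Jint_eq[OF assms] lin_cst[OF lin_mode] by simp
qed

definition gens :: "nat \<Rightarrow> vec set" where
  "gens k = {(Lm2 k ^^ m) 1 | m. m \<le> 2 * k + 2} \<union> {Jvec k, mode k (Jvec k) (- 1) (Jvec k), Lm2 k (Jvec k)}"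

text \<open>Besides giving one inclusion, this makes the remainder in a decomposition of a fixed
  vector fixed again, so that it lies in C_2 itself.\<close>

lemma gens_M1plus: assumes "k > 0" shows "gens k \<subseteq> M1plus"
proof -
  have c: "cst c * x \<in> M1plus \<longleftrightarrow> x \<in> M1plus" if "c \<noteq> 0" for c x
    by (rule csub_cst_iff[OF csub_M1plus that])
  have J: "Jvec k \<in> M1plus"
    using Jint_M1plus[of k] c[of "4 * of_nat k ^ 2"] assms by (simp add: Jint_eq)
  have "mode k (Jvec k) (- 1) (Jint k) \<in> M1plus"
    using Jop_M1plus[of k] c[of "4 * of_nat k ^ 2"] assms by (simp add: Jop_eq)
  then have "mode k (Jvec k) (- 1) (Jvec k) \<in> M1plus"
    using c[of "4 * of_nat k ^ 2"] assms by (simp add: Jint_eq lin_cst[OF lin_mode_right])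
  then show ?thesis using J Lm2_M1plus[OF J] Lm2_power_vac_M1plus by (auto simp: gens_def)
qed

text \<open>In these weights the generator is not shown to vanish. The explicit identities of
  weights 4, 6 and 8 are solved for it; in weight 2 it already is a multiple of L(-2) 1.\<close>

lemma quadratic_gens:
  assumes k: "k > 0" and W: "W \<in> {2, 4, 6, 8}"
  shows "X 1 * X (W - 1) \<in> modC2 k (gens k)"
proof -
  note Z = csub_modC2[of k "gens k"]
  have S: "x \<in> symC2 k \<Longrightarrow> x \<in> modC2 k (gens k)" for x using symC2_subset_modC2 by blast
  have q: "Qop k m n f \<in> modC2 k (gens k)" if "f \<in> VL" "0 < m" "m \<le> n" for m n f
    using S Qop_symC2[OF that(2,3,1)] by blast
  have vl: "X a * u \<in> VL" if "a > 0" "u \<in> VL" for a u using that by (intro VL_mult) auto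
  have v1: "1 \<in> VL" using VL_cst[of 1] by simp
  have g: "x \<in> gens k \<Longrightarrow> x \<in> modC2 k (gens k)" for x by (rule modC2_base)
  have c: "cst c * x \<in> modC2 k (gens k) \<longleftrightarrow> x \<in> modC2 k (gens k)" if "c \<noteq> 0" for c x
    by (rule csub_cst_iff[OF Z that])
  have P: "(Pop k 1 1 ^^ m) 1 \<in> modC2 k (gens k)" if "m \<le> 2 * k + 2" for m
    unfolding Pop_Lm2_power[OF k] by (intro csub_cst[OF Z] g) (use that in \<open>auto simp: gens_def\<close>)
  have P1: "Pop k 1 1 1 \<in> modC2 k (gens k)" and P2: "Pop k 1 1 (Pop k 1 1 1) \<in> modC2 k (gens k)"
    and P3: "Pop k 1 1 (Pop k 1 1 (Pop k 1 1 1)) \<in> modC2 k (gens k)"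
    and P4: "Pop k 1 1 (Pop k 1 1 (Pop k 1 1 (Pop k 1 1 1))) \<in> modC2 k (gens k)"
    using P[of 1] P[of 2] P[of 3] P[of 4] k by (simp_all add: eval_nat_numeral)
  have J: "Jint k \<in> modC2 k (gens k)"
    unfolding Jint_eq[OF k] by (intro csub_cst[OF Z] g) (simp add: gens_def)
  have LJ: "Pop k 1 1 (Jint k) \<in> modC2 k (gens k)"
    unfolding Pop_Lm2[OF k] Jint_eq[OF k] lin_cst[OF lin_Lm2] by (intro csub_cst[OF Z] g) (simp add: gens_def)
  have JJ: "Jop k (Jint k) \<in> modC2 k (gens k)"
    unfolding Jop_eq[OF k] unfolding Jint_eq[OF k] lin_cst[OF lin_mode_right] by (intro csub_cst[OF Z] g) (simp add: gens_def)
  have cancel: "x = t - y" if "y = t - x" for x y t :: vec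
    using that by simp
  note closed = csub_diff[OF Z] csub_add[OF Z] csub_numeral[OF Z] csub_of_nat[OF Z]
  have rat: "x \<in> modC2 k (gens k)" if "numeral w * (of_nat (k ^ i) * x) \<in> modC2 k (gens k)" for w i x
  proof -
    have "cst (numeral w) * (cst (of_nat (k ^ i)) * x) \<in> modC2 k (gens k)"
      using that by (simp only: cst_numeral cst_of_nat)
    then have "cst (of_nat (k ^ i)) * x \<in> modC2 k (gens k)"
      by (rule c[THEN iffD1, rotated]) simp
    then show ?thesis by (rule c[THEN iffD1, rotated]) (use k in simp)
  qed
  have "X 1 * X 3 \<in> modC2 k (gens k)"
  proof (rule rat[of _ 1])
    have "18 * (of_nat k * (X 1 * X 3)) = 3 * (of_nat k * Qop k 1 2 1) - (Jint k - Pop k 1 1 (Pop k 1 1 1))"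
      by (rule cancel[OF weight_4_relation])
    also have "\<dots> \<in> modC2 k (gens k)" by (intro closed J P2 q v1) auto
    finally show "18 * (of_nat (k ^ 1) * (X 1 * X 3)) \<in> modC2 k (gens k)" by simp
  qed
  moreover have "X 1 * X 5 \<in> modC2 k (gens k)"
  proof (rule rat[of _ 2])
    let ?q = "9 * (of_nat k * Qop k 1 1 (X 1 * (X 2 * 1))) - 12 * (of_nat k * Qop k 1 2 (X 1 * (X 1 * 1)))
     + 204 * (of_nat k * (of_nat k * Qop k 1 4 1)) - 48 * (of_nat k * (of_nat k * Qop k 2 3 1))"
    have "1080 * (of_nat k * (of_nat k * (X 1 * X 5))) = ?q - 2 * (Pop k 1 1 (Jint k) - Pop k 1 1 (Pop k 1 1 (Pop k 1 1 1)))"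
      by (rule cancel[OF weight_6_relation])
    also have "\<dots> \<in> modC2 k (gens k)" by (intro closed LJ P3 q v1 vl) auto
    finally show "1080 * (of_nat (k ^ 2) * (X 1 * X 5)) \<in> modC2 k (gens k)" by (simp add: power2_eq_square mult.assoc)
  qed
  moreover have "X 1 * X 7 \<in> modC2 k (gens k)"
  proof (rule rat[of _ 3])
    let ?q = "40 * (of_nat k * (of_nat k * Qop k 1 1 (X 2 * (X 3 * 1))))
     + 41 * (of_nat k * Qop k 1 1 (X 1 * (X 1 * (X 1 * (X 2 * 1)))))
     - 200 * (of_nat k * (of_nat k * Qop k 1 2 (X 1 * (X 3 * 1))))
     + 105 * (of_nat k * (of_nat k * Qop k 1 2 (X 2 * (X 2 * 1))))
     + 20 * (of_nat k * Qop k 1 2 (X 1 * (X 1 * (X 1 * (X 1 * 1)))))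
     + 50 * (of_nat k * (of_nat k * Qop k 1 3 (X 1 * (X 2 * 1))))
     - 354 * (of_nat k * (of_nat k * Qop k 1 4 (X 1 * (X 1 * 1))))
     - 6876 * (of_nat k * (of_nat k * (of_nat k * Qop k 1 6 1)))
     + 7 * (of_nat k * (of_nat k * Qop k 2 2 (X 1 * (X 2 * 1))))"
    have "67824 * (of_nat k * (of_nat k * (of_nat k * (X 1 * X 7)))) =
        Jop k (Jint k) - Pop k 1 1 (Pop k 1 1 (Pop k 1 1 (Pop k 1 1 1))) - ?q"
      unfolding weight_8_relation by (simp only: add_diff_cancel_left')
    also have "\<dots> \<in> modC2 k (gens k)" by (intro closed JJ P4 q v1 vl) auto
    finally show "67824 * (of_nat (k ^ 3) * (X 1 * X 7)) \<in> modC2 k (gens k)" by (simp add: power3_eq_cube mult.assoc)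
  qed
  moreover have "X 1 * X 1 \<in> modC2 k (gens k)"
    using P1 Pop_1_idx[of 1 1 k] by simp
  ultimately show ?thesis using W by auto
qed

lemma low_gens: assumes k: "k > 0" shows "low W \<subseteq> modC2 k (gens k)"
proof -
  note Z = csub_modC2[of k "gens k"]
  consider "odd W \<or> W \<ge> 10" | "W \<in> {2, 4, 6, 8}" | "W = 0"
  proof -
    have "odd W \<or> W \<ge> 10 \<or> W = 2 \<or> W = 4 \<or> W = 6 \<or> W = 8 \<or> W = 0" by presburger
    then show thesis using that by blast
  qed
  then show ?thesis
  proof cases
    case 1 then show ?thesis using low_symC2[OF k, of W] symC2_subset_modC2 by blast
  next
    case 2
    show ?thesis
    proof (rule low_subset[OF Z])
      fix b :: "nat multiset" assume b: "0 \<notin># b" "sum_mset b = W" "size b < W"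
      have "modC2 k {X 1 * X (W - 1)} \<subseteq> modC2 k (gens k)"
        using quadratic_gens[OF k 2] by (intro modC2_subset Z symC2_subset_modC2) auto
      then show "bvec (b, 0) \<in> modC2 k (gens k)" using charge_0_reduction[of b k] b by auto
    qed
  next
    case 3 then show ?thesis by (intro low_subset[OF Z]) auto
  qed
qed

text \<open>The weight 2m is large enough for x_1^(2m) and for all shorter monomials of that weight
  to lie in \<open>symC2\<close>.\<close>

lemma Lm2_power_high:
  assumes "k \<ge> 2" "m \<ge> 2 * k + 3" shows "(Lm2 k ^^ m) 1 \<in> symC2 k"
proof -
  note S = csub_symC2[of k]
  have "low (2 * m) \<subseteq> symC2 k" using assms by (intro low_symC2) auto
  then have "(Lm2 k ^^ m) 1 - cst ((1 / (4 * of_nat k)) ^ m) * X 1 ^ (2 * m) \<in> symC2 k"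
    using leads_Lm2_power[of m k] by (auto simp: leads_def)
  moreover have "X 1 ^ (2 * m) \<in> symC2 k" using assms by (intro X1_power_symC2) auto
  ultimately show ?thesis using csub_diff_iff[OF S csub_cst[OF S]] by blast
qed

lemma charge_0_span:
  assumes k: "k \<ge> 2" and a: "0 \<notin># a"
  shows "bvec (a, 0) \<in> modC2 k (gens k)"
proof (cases "size a < sum_mset a")
  case True
  then show ?thesis using low_gens[of k "sum_mset a"] low_bvec[OF a refl True] k by auto
next
  case False
  note Z = csub_modC2[of k "gens k"]
  define n where "n = size a"
  have "sum_mset a = n" using False size_le_sum_mset[OF a] by (simp add: n_def)
  have "a = replicate_mset n 1"
  proof -
    have "a = replicate_mset (size a) 1" if "0 \<notin># a" "sum_mset a = size a" for a :: "nat multiset"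
      using that
    proof (induction a)
      case (add x a)
      then have "size a \<le> sum_mset a" "x > 0" by (auto intro: size_le_sum_mset)
      then have "x = 1" "sum_mset a = size a" using add.prems by auto
      then show ?case using add by simp
    qed simp
    then show ?thesis using a \<open>sum_mset a = n\<close> by (simp add: n_def)
  qed
  then have X: "bvec (a, 0) = X 1 ^ n" by (simp only: X1_power)
  show ?thesis
  proof (cases "odd n")
    case True
    then show ?thesis using symC2_odd[of a k] symC2_subset_modC2 by (auto simp: n_def)
  next
    case False
    then obtain m where m: "n = 2 * m" by auto
    show ?thesis
    proof (cases "m \<le> 2 * k + 2")
      case True
      let ?c = "(1 / (4 * of_nat k)) ^ m :: complex"
      have "(Lm2 k ^^ m) 1 \<in> modC2 k (gens k)" by (rule modC2_base) (use True in \<open>auto simp: gens_def\<close>)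
      \<comment> \<open>All other monomials of weight n are already in the span, so the nonzero
        leading coefficient allows solving for x_1^n.\<close>
      moreover have "(Lm2 k ^^ m) 1 - cst ?c * X 1 ^ n \<in> modC2 k (gens k)"
        using leads_Lm2_power[of m k] low_gens[of k n] k m by (auto simp: leads_def)
      ultimately have "(Lm2 k ^^ m) 1 - ((Lm2 k ^^ m) 1 - cst ?c * X 1 ^ n) \<in> modC2 k (gens k)"
        by (rule csub_diff[OF Z])
      then have "cst ?c * X 1 ^ n \<in> modC2 k (gens k)" by simp
      moreover have "?c \<noteq> 0" using k by simp
      ultimately show ?thesis using csub_cst_iff[OF Z] X by simp
    next
      case False
      then have "X 1 ^ n \<in> symC2 k" using k m by (intro X1_power_symC2) auto
      then show ?thesis using X symC2_subset_modC2 by auto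
    qed
  qed
qed

lemma charge_0_part:
  assumes "k \<ge> 2"
  shows "setsum M1plus (C2 k) = setsum (cspan (gens k)) (C2 k)"
proof -
  have k: "k > 0" using assms by simp
  have 1: "\<exists>u\<in>vec.span (gens k). \<exists>c\<in>C2 k. x = u + c" if x: "x \<in> M1plus" for x
  proof -
    have "ch 0 0 \<subseteq> modC2 k (gens k)"
      by (rule ch_subset[OF csub_modC2]) (rule charge_0_span[OF assms])
    moreover have "x \<in> ch 0 0" using x by (simp add: M1plus_def M1_eq_ch)
    ultimately obtain u s where us: "u \<in> vec.span (gens k)" "s \<in> symC2 k" "x = u + s"
      unfolding modC2_def by blast
    have "u \<in> M1plus" using span_subset[OF csub_M1plus gens_M1plus[OF k]] us(1) by blast
    \<comment> \<open>Both \<open>x\<close> and \<open>u\<close> are fixed, hence so is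
      \<open>s\<close>; for fixed vectors \<open>symC2\<close> and \<open>C2\<close> agree.\<close>
    then have "theta s = s" using x us(3) by (simp add: M1plus_def)
    then show ?thesis using us symC2_fixed by blast
  qed
  have 2: "vec.span (gens k) \<subseteq> M1plus" by (rule span_subset[OF csub_M1plus gens_M1plus[OF k]])
  have 3: "x + c \<in> setsum (vec.span (gens k)) (C2 k)" if x: "x \<in> M1plus" and c: "c \<in> C2 k" for x c
  proof -
    obtain u c' where "u \<in> vec.span (gens k)" "c' \<in> C2 k" "x = u + c'" using 1[OF x] by blast
    then show ?thesis
      unfolding setsum_def using csub_add[OF csub_C2, of c' k c] c
      by (intro CollectI exI[of _ u] exI[of _ "c' + c"]) (simp add: add.assoc)
  qed
  have "setsum M1plus (C2 k) \<subseteq> setsum (vec.span (gens k)) (C2 k)"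
    unfolding setsum_def[of M1plus] using 3 by blast
  moreover have "setsum (vec.span (gens k)) (C2 k) \<subseteq> setsum M1plus (C2 k)"
    using 2 unfolding setsum_def by blast
  ultimately show ?thesis unfolding cspan_eq by blast
qed

theorem mainTheorem20:
  fixes k :: nat
  assumes "3 \<le> k"
  shows "setsum VLplus1 (C2 k) = setsum (cspan {(Lm2 k ^^ i) Evec | i. i \<le> 2}) (C2 k)
    \<and> setsum M1plus (C2 k) =
        setsum (cspan ({(Lm2 k ^^ m) vac | m. m \<le> 2 * k + 2}
                       \<union> {Jvec k, mode k (Jvec k) (-1) (Jvec k), Lm2 k (Jvec k)})) (C2 k)
    \<and> (Lm2 k ^^ 3) Evec \<in> C2 k
    \<and> (Lm2 k ^^ (2 * k + 3)) vac \<in> C2 k"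
proof (intro conjI)
  have k: "k \<ge> 2" using assms by simp
  show "setsum VLplus1 (C2 k) = setsum (cspan {(Lm2 k ^^ i) Evec | i. i \<le> 2}) (C2 k)"
    by (rule charge_1_part[OF k])
  show "setsum M1plus (C2 k) =
        setsum (cspan ({(Lm2 k ^^ m) vac | m. m \<le> 2 * k + 2}
                       \<union> {Jvec k, mode k (Jvec k) (-1) (Jvec k), Lm2 k (Jvec k)})) (C2 k)"
    using charge_0_part[OF k] unfolding gens_def vac_eq .
  show "(Lm2 k ^^ 3) Evec \<in> C2 k"
    by (rule Lm2_cube_Evec[OF k])
  have "theta ((Lm2 k ^^ (2 * k + 3)) 1) = (Lm2 k ^^ (2 * k + 3)) 1"
    by (simp add: theta_Lm2_power)
  then show "(Lm2 k ^^ (2 * k + 3)) vac \<in> C2 k"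
    using Lm2_power_high[OF k order_refl] symC2_fixed unfolding vac_eq by blast
qed

end
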